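(* Let $(M,\Omega)$ be a symplectic manifold of dimension $2$. Every preferred symplectic connection on $(M,\Omega)$ is critical.
   Context: Abstract index notation is used. Indices are raised and lowered by $X_i=X^p\Omega_{pi}$, $X^i=\Omega^{ip}X_p$, where $\Omega^{ip}\Omega_{pj}=-\delta_j{}^i$. A symplectic connection is a torsion-free affine connection $\nabla$ with $\nabla\Omega=0$; $\mathcal{S}(M,\Omega)$ is the affine space of these, modeled on $\Gamma(S^3(T^*M))$ ($\nabla+t\Pi$ has difference tensor $t\Pi_{ij}{}^k=t\,\Omega^{kp}\Pi_{ijp}$ with $\nabla$). Curvature: $\nabla_i\nabla_jX^k-\nabla_j\nabla_iX^k=R_{ijp}{}^kX^p$, $R_{ij}=R_{pij}{}^p$, $R_{ijkl}=R_{ijk}{}^p\Omega_{pl}$. A symplectic connection is preferred if $\nabla_{(i}R_{jk)}=0$ (complete symmetrization). Define $\mathcal{K}(\nabla)=\nabla^i\nabla^jR_{ij}-\tfrac12R^{ij}R_{ij}+\tfrac14R^{ijkl}R_{ijkl}$ (in dimension $2$ this equals $\nabla^i\nabla^jR_{ij}$). The connection $\nabla$ is critical if it is a critical point, with respect to arbitrary compactly supported variations $\nabla+t\Pi$, $\Pi\in\Gamma(S^3(T^*M))$, of $\mathcal{E}(\nabla)=\int_M\mathcal{K}(\nabla)^2\,\Omega$ (if $M$ is noncompact this means $\tfrac{d}{dt}|_{t=0}\int_M(\mathcal{K}(\nabla+t\Pi)^2-\mathcal{K}(\nabla)^2)\,\Omega=0$ for all compactly supported $\Pi$). *)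

theory Defs
  imports "HOL-Analysis.Analysis"
begin

section \<open>Smooth functions on open subsets of Euclidean space\<close>

definition pd :: "'n::finite \<Rightarrow> (real^'n \<Rightarrow> real) \<Rightarrow> real^'n \<Rightarrow> real" where
  "pd i f x = frechet_derivative f (at x) (axis i 1)"

primrec Ck_on :: "nat \<Rightarrow> (real^'n::finite) set \<Rightarrow> (real^'n \<Rightarrow> real) \<Rightarrow> bool" where
  "Ck_on 0 S f \<longleftrightarrow> continuous_on S f"
| "Ck_on (Suc k) S f \<longleftrightarrow> f differentiable_on S \<and> (\<forall>i. Ck_on k S (pd i f))"

(* Used for open S only, so that the derivatives in pd do not see values outside S. *)
definition smooth_on :: "(real^'n::finite) set \<Rightarrow> (real^'n \<Rightarrow> real) \<Rightarrow> bool" where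
  "smooth_on S f \<longleftrightarrow> (\<forall>k. Ck_on k S f)"


section \<open>Smooth manifolds\<close>

(* A chart is a pair (U, phi); the values of phi outside U are irrelevant. *)
type_synonym ('a, 'n) chart = "'a set \<times> ('a \<Rightarrow> real^'n)"

definition is_chart :: "'a topology \<Rightarrow> ('a, 'n::finite) chart \<Rightarrow> bool" where
  "is_chart X c \<longleftrightarrow> openin X (fst c) \<and> open (snd c ` fst c) \<and>
     homeomorphic_map (subtopology X (fst c)) (top_of_set (snd c ` fst c)) (snd c)"

definition trans_map ::
  "('a, 'n::finite) chart \<Rightarrow> ('a, 'n) chart \<Rightarrow> real^'n \<Rightarrow> real^'n" where
  "trans_map c d x = snd d (inv_into (fst c) (snd c) x)"

definition overlap :: "('a, 'n::finite) chart \<Rightarrow> ('a, 'n) chart \<Rightarrow> (real^'n) set" where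
  "overlap c d = snd c ` (fst c \<inter> fst d)"

(* The atlas need not be maximal: tensor fields and connections are determined by, and can be
   prescribed through, their components in the charts of any atlas. *)
definition smooth_manifold :: "'a topology \<Rightarrow> ('a, 'n::finite) chart set \<Rightarrow> bool" where
  "smooth_manifold X A \<longleftrightarrow>
     Hausdorff_space X \<and> second_countable X \<and>
     (\<forall>c\<in>A. is_chart X c) \<and> (\<Union>c\<in>A. fst c) = topspace X \<and>
     (\<forall>c\<in>A. \<forall>d\<in>A. \<forall>a. smooth_on (overlap c d) (\<lambda>x. trans_map c d x $ a))"


section \<open>Covariant tensor fields and affine connections\<close>

(* A covariant tensor field is the family of its component functions: T c [i,j,...] x is the
   component T_{ij...} in the chart c at the point with coordinates x. *)
type_synonym ('a, 'n) tensor = "('a, 'n) chart \<Rightarrow> 'n list \<Rightarrow> real^'n \<Rightarrow> real"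

(* jac c d i a is the partial derivative of the a-th coordinate of d by the i-th one of c. *)
definition jac ::
  "('a, 'n::finite) chart \<Rightarrow> ('a, 'n) chart \<Rightarrow> 'n \<Rightarrow> 'n \<Rightarrow> real^'n \<Rightarrow> real" where
  "jac c d i a x = pd i (\<lambda>z. trans_map c d z $ a) x"

definition tensor_field ::
  "('a, 'n::finite) chart set \<Rightarrow> nat \<Rightarrow> ('a, 'n) tensor \<Rightarrow> bool" where
  "tensor_field A k T \<longleftrightarrow>
     (\<forall>c\<in>A. \<forall>js. length js = k \<longrightarrow> smooth_on (snd c ` fst c) (T c js)) \<and>
     (\<forall>c\<in>A. \<forall>d\<in>A. \<forall>x\<in>overlap c d. \<forall>js. length js = k \<longrightarrow>
        T c js x = (\<Sum>ls | length ls = k.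
          (\<Prod>m<k. jac c d (js ! m) (ls ! m) x) * T d ls (trans_map c d x)))"

(* An affine connection is the family of its Christoffel symbols: \<Gamma> c i j k is the coefficient
   in nabla_i X^k = d_i X^k + \<Gamma>_{ij}^k X^j. *)
type_synonym ('a, 'n) conn = "('a, 'n) chart \<Rightarrow> 'n \<Rightarrow> 'n \<Rightarrow> 'n \<Rightarrow> real^'n \<Rightarrow> real"

definition affine_connection ::
  "('a, 'n::finite) chart set \<Rightarrow> ('a, 'n) conn \<Rightarrow> bool" where
  "affine_connection A \<Gamma> \<longleftrightarrow>
     (\<forall>c\<in>A. \<forall>i j k. smooth_on (snd c ` fst c) (\<Gamma> c i j k)) \<and>
     (\<forall>c\<in>A. \<forall>d\<in>A. \<forall>x\<in>overlap c d. \<forall>i j m.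
        (\<Sum>k\<in>UNIV. \<Gamma> c i j k x * jac c d k m x) =
        (\<Sum>a\<in>UNIV. \<Sum>b\<in>UNIV. jac c d i a x * jac c d j b x * \<Gamma> d a b m (trans_map c d x))
        + pd i (jac c d j m) x)"

(* In the remaining definitions of this section \<Gamma>, T are the components in a single chart.
   The differentiation index comes first: covd \<Gamma> T [i,j,k] is nabla_i T_{jk}. *)
fun covd :: "('n::finite \<Rightarrow> 'n \<Rightarrow> 'n \<Rightarrow> real^'n \<Rightarrow> real) \<Rightarrow>
    ('n list \<Rightarrow> real^'n \<Rightarrow> real) \<Rightarrow> 'n list \<Rightarrow> real^'n \<Rightarrow> real" where
  "covd \<Gamma> T [] x = 0"
| "covd \<Gamma> T (i # js) x =
     pd i (T js) x - (\<Sum>m<length js. \<Sum>p\<in>UNIV. \<Gamma> i (js ! m) p x * T (js[m := p]) x)"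

(* curv \<Gamma> i j p k is R_{ijp}^k with nabla_i nabla_j X^k - nabla_j nabla_i X^k = R_{ijp}^k X^p
   (for torsion-free \<Gamma>). *)
definition curv :: "('n::finite \<Rightarrow> 'n \<Rightarrow> 'n \<Rightarrow> real^'n \<Rightarrow> real) \<Rightarrow>
    'n \<Rightarrow> 'n \<Rightarrow> 'n \<Rightarrow> 'n \<Rightarrow> real^'n \<Rightarrow> real" where
  "curv \<Gamma> i j p k x =
     pd i (\<Gamma> j p k) x - pd j (\<Gamma> i p k) x
     + (\<Sum>q\<in>UNIV. \<Gamma> i q k x * \<Gamma> j p q x - \<Gamma> j q k x * \<Gamma> i p q x)"

(* R_{ij} = R_{pij}^p; the value on lists of other lengths is irrelevant. *)
fun ric :: "('n::finite \<Rightarrow> 'n \<Rightarrow> 'n \<Rightarrow> real^'n \<Rightarrow> real) \<Rightarrow>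
    'n list \<Rightarrow> real^'n \<Rightarrow> real" where
  "ric \<Gamma> [i, j] x = (\<Sum>p\<in>UNIV. curv \<Gamma> p i j p x)"
| "ric \<Gamma> _ x = 0"


section \<open>Symplectic manifolds and symplectic connections\<close>

definition symplectic_manifold ::
  "'a topology \<Rightarrow> ('a, 'n::finite) chart set \<Rightarrow> ('a, 'n) tensor \<Rightarrow> bool" where
  "symplectic_manifold X A \<omega> \<longleftrightarrow>
     smooth_manifold X A \<and> tensor_field A 2 \<omega> \<and>
     (\<forall>c\<in>A. \<forall>x\<in>snd c ` fst c.
        (\<forall>i j. \<omega> c [i, j] x = - \<omega> c [j, i] x) \<and>
        invertible (\<chi> i j. \<omega> c [i, j] x) \<and>
        (\<forall>i j k. pd i (\<omega> c [j, k]) x + pd j (\<omega> c [k, i]) x + pd k (\<omega> c [i, j]) x = 0))"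

definition symplectic_connection ::
  "('a, 'n::finite) chart set \<Rightarrow> ('a, 'n) tensor \<Rightarrow> ('a, 'n) conn \<Rightarrow> bool" where
  "symplectic_connection A \<omega> \<Gamma> \<longleftrightarrow>
     affine_connection A \<Gamma> \<and>
     (\<forall>c\<in>A. \<forall>x\<in>snd c ` fst c. \<forall>i j k.
        \<Gamma> c i j k x = \<Gamma> c j i k x \<and> covd (\<Gamma> c) (\<omega> c) [i, j, k] x = 0)"

definition preferred ::
  "('a, 'n::finite) chart set \<Rightarrow> ('a, 'n) conn \<Rightarrow> bool" where
  "preferred A \<Gamma> \<longleftrightarrow>
     (\<forall>c\<in>A. \<forall>x\<in>snd c ` fst c. \<forall>i j k.
        (let D = (\<lambda>i j k. covd (\<Gamma> c) (ric (\<Gamma> c)) [i, j, k] x)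
         in (D i j k + D i k j + D j i k + D j k i + D k i j + D k j i) / 6 = 0))"

(* The bivector W^{ij} inverse to the form w_{ij} (components in one chart), with the convention
   W^{ip} w_{pj} = - delta_j^i. *)
definition bivec :: "('n::finite list \<Rightarrow> real^'n \<Rightarrow> real) \<Rightarrow> 'n \<Rightarrow> 'n \<Rightarrow> real^'n \<Rightarrow> real" where
  "bivec w i j x = - matrix_inv (\<chi> i j. w [i, j] x) $ i $ j"

definition raise_all :: "('n::finite list \<Rightarrow> real^'n \<Rightarrow> real) \<Rightarrow>
    ('n list \<Rightarrow> real^'n \<Rightarrow> real) \<Rightarrow> 'n list \<Rightarrow> real^'n \<Rightarrow> real" where
  "raise_all w T is x =
     (\<Sum>ps | length ps = length is. (\<Prod>m<length is. bivec w (is ! m) (ps ! m) x) * T ps x)"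

(* R_{ijkl} = R_{ijk}^p w_{pl}; the value on lists of other lengths is irrelevant. *)
fun curv_low :: "('n::finite list \<Rightarrow> real^'n \<Rightarrow> real) \<Rightarrow>
    ('n \<Rightarrow> 'n \<Rightarrow> 'n \<Rightarrow> real^'n \<Rightarrow> real) \<Rightarrow> 'n list \<Rightarrow> real^'n \<Rightarrow> real" where
  "curv_low w \<Gamma> [i, j, k, l] x = (\<Sum>p\<in>UNIV. curv \<Gamma> i j k p x * w [p, l] x)"
| "curv_low w \<Gamma> _ x = 0"

(* The scalar K = nabla^i nabla^j R_{ij} - (1/2) R^{ij} R_{ij} + (1/4) R^{ijkl} R_{ijkl},
   computed in one chart. *)
definition K_coord :: "('n::finite list \<Rightarrow> real^'n \<Rightarrow> real) \<Rightarrow>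
    ('n \<Rightarrow> 'n \<Rightarrow> 'n \<Rightarrow> real^'n \<Rightarrow> real) \<Rightarrow> real^'n \<Rightarrow> real" where
  "K_coord w \<Gamma> x =
     (\<Sum>i\<in>UNIV. \<Sum>j\<in>UNIV. \<Sum>p\<in>UNIV. \<Sum>q\<in>UNIV.
        bivec w i p x * bivec w j q x * covd \<Gamma> (covd \<Gamma> (ric \<Gamma>)) [p, q, i, j] x)
     - 1/2 * (\<Sum>is | length is = 2. raise_all w (ric \<Gamma>) is x * ric \<Gamma> is x)
     + 1/4 * (\<Sum>is | length is = 4. raise_all w (curv_low w \<Gamma>) is x * curv_low w \<Gamma> is x)"

(* K as a function on the manifold. The chart around p is chosen arbitrarily, which is
   immaterial because K_coord is a scalar. *)
definition K_fun :: "('a, 'n::finite) chart set \<Rightarrow> ('a, 'n) tensor \<Rightarrow> ('a, 'n) conn \<Rightarrow>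
    'a \<Rightarrow> real" where
  "K_fun A \<omega> \<Gamma> p = (let c = (SOME c. c \<in> A \<and> p \<in> fst c) in K_coord (\<omega> c) (\<Gamma> c) (snd c p))"


section \<open>Variations\<close>

definition sym_cubic :: "('a, 'n::finite) chart set \<Rightarrow> ('a, 'n) tensor \<Rightarrow> bool" where
  "sym_cubic A P \<longleftrightarrow> tensor_field A 3 P \<and>
     (\<forall>c\<in>A. \<forall>x\<in>snd c ` fst c. \<forall>i j k.
        P c [i, j, k] x = P c [j, i, k] x \<and> P c [i, j, k] x = P c [i, k, j] x)"

definition compactly_supported ::
  "'a topology \<Rightarrow> ('a, 'n::finite) chart set \<Rightarrow> nat \<Rightarrow> ('a, 'n) tensor \<Rightarrow> bool" where
  "compactly_supported X A k T \<longleftrightarrow>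
     (\<exists>C. compactin X C \<and>
        (\<forall>c\<in>A. \<forall>p\<in>fst c - C. \<forall>js. length js = k \<longrightarrow> T c js (snd c p) = 0))"

(* nabla + t P, whose difference tensor with nabla is t P_{ij}^k = t W^{kp} P_{ijp}. *)
definition vary :: "('a, 'n::finite) tensor \<Rightarrow> ('a, 'n) conn \<Rightarrow> real \<Rightarrow> ('a, 'n) tensor \<Rightarrow>
    ('a, 'n) conn" where
  "vary \<omega> \<Gamma> t P c i j k x = \<Gamma> c i j k x + t * (\<Sum>p\<in>UNIV. bivec (\<omega> c) k p x * P c [i, j, p] x)"


section \<open>The functional on symplectic surfaces\<close>

(* Integration against the form on a surface oriented by it: the Borel measure which in every
   chart is |w_{12}| dx dy. It is unique because countably many chart domains cover X. *)
definition is_symplectic_measure ::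
  "'a topology \<Rightarrow> ('a, 2) chart set \<Rightarrow> ('a, 2) tensor \<Rightarrow> 'a measure \<Rightarrow> bool" where
  "is_symplectic_measure X A \<omega> \<mu> \<longleftrightarrow>
     space \<mu> = topspace X \<and> sets \<mu> = sigma_sets (topspace X) {U. openin X U} \<and>
     (\<forall>c\<in>A. \<forall>B\<in>sets \<mu>. B \<subseteq> fst c \<longrightarrow>
        emeasure \<mu> B = (\<integral>\<^sup>+x\<in>snd c ` B. ennreal \<bar>\<omega> c [1, 2] x\<bar> \<partial>lborel))"

definition symplectic_measure ::
  "'a topology \<Rightarrow> ('a, 2) chart set \<Rightarrow> ('a, 2) tensor \<Rightarrow> 'a measure" where
  "symplectic_measure X A \<omega> = (THE \<mu>. is_symplectic_measure X A \<omega> \<mu>)"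

definition energy ::
  "'a topology \<Rightarrow> ('a, 2) chart set \<Rightarrow> ('a, 2) tensor \<Rightarrow> ('a, 2) conn \<Rightarrow> real" where
  "energy X A \<omega> \<Gamma> = (LINT p|symplectic_measure X A \<omega>. (K_fun A \<omega> \<Gamma> p)\<^sup>2)"

(* On a noncompact surface the energy itself may diverge; there only the difference, whose
   integrand has compact support, is differentiated. *)
definition critical ::
  "'a topology \<Rightarrow> ('a, 2) chart set \<Rightarrow> ('a, 2) tensor \<Rightarrow> ('a, 2) conn \<Rightarrow> bool" where
  "critical X A \<omega> \<Gamma> \<longleftrightarrow>
     (\<forall>P. sym_cubic A P \<and> compactly_supported X A 3 P \<longrightarrow>
        (if compact_space X
         then ((\<lambda>t. energy X A \<omega> (vary \<omega> \<Gamma> t P)) has_real_derivative 0) (at 0)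
         else ((\<lambda>t. LINT p|symplectic_measure X A \<omega>.
                 (K_fun A \<omega> (vary \<omega> \<Gamma> t P) p)\<^sup>2 - (K_fun A \<omega> \<Gamma> p)\<^sup>2)
               has_real_derivative 0) (at 0)))"

end

theory Submission
  imports Defs
begin

text \<open>
  In dimension 2 the quadratic terms of \<^term>\<open>K_coord\<close> cancel, and with $w = \omega_{12}$ one has
  $w\rho_i = \nabla_2 R_{1i} - \nabla_1 R_{2i}$ and $w K = \partial_2\rho_1 - \partial_1\rho_2$, which makes the
  invariance of $K$ under changes of charts a computation with exterior derivatives.
  For a preferred connection, $\nabla_k R_{ij} = -\frac13(\omega_{ki}\rho_j + \omega_{kj}\rho_i)$.
  Commuting derivatives twice gives $\nabla_i\rho_j = -\frac12 K\omega_{ij}$ and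
  $w\,\partial_i K = 2(R_{i1}\rho_2 - R_{i2}\rho_1)$, a closed system for $R$, $\rho$, $K$, from which
  the field $H^i = -\Omega^{ip}\partial_p K$ satisfies $\nabla_l\nabla_k H^j = \partial_l K\,\Omega^{jp} R_{kp}$.
  Consequently $K$ times the first variation of $K$ is the divergence of a field that is linear in
  the variation and its derivatives. Cutting the variation into pieces supported in charts, the
  integral of this divergence vanishes.
\<close>

section \<open>Partial derivatives\<close>

text \<open>Once surface curvature is written through Ricci, the identity for the second covariant
  derivative of H says that the Hamiltonian field of K is an infinitesimal affine symmetry of the
  connection. This is why preferredness suffices: when all derivatives have been moved off the
  variation, exactly this expression is left as its coefficient. Two obstacles shape the argument.
  \<open>K_fun\<close> evaluates K in an arbitrarily chosen chart, so invariance has to be known for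
  every varied connection before anything global can be said. K is a polynomial of degree 3 in t;
  comparing coefficients transfers invariance and vanishing from K to each coefficient without
  separate transformation laws, and makes the energy difference a polynomial in t, so nothing is
  differentiated under an integral. Secondly, cutoffs of finite regularity lead to variations of
  class C^4. The number is 4 because K takes three derivatives of the Christoffel symbols and the
  closed system differentiates K once more; one regularity parameter serves connection and variation
  alike.\<close>

lemma frechet_derivative_worksD:
  "f differentiable net \<Longrightarrow> (f has_derivative frechet_derivative f net) net"
  by (simp add: frechet_derivative_works)

lemma pd_eq:
  assumes "(f has_derivative f') (at x)"
  shows "pd i f x = f' (axis i 1)"
  using frechet_derivative_at[OF assms] by (simp add: pd_def)

lemma has_derivative_pd:
  assumes "f differentiable (at x)"
  shows "(f has_derivative (\<lambda>h. \<Sum>i\<in>UNIV. h $ i * pd i f x)) (at x)"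
proof -
  have D: "(f has_derivative frechet_derivative f (at x)) (at x)"
    by (rule frechet_derivative_worksD[OF assms])
  then have "linear (frechet_derivative f (at x))"
    using has_derivative_linear by blast
  then have "frechet_derivative f (at x) h = (\<Sum>i\<in>UNIV. h $ i * pd i f x)" for h
    by (subst basis_expansion[of h, symmetric])
      (simp add: linear_sum linear_cmul pd_def scalar_mult_eq_scaleR)
  then show ?thesis using D by (metis (no_types, lifting) ext)
qed

lemma pd_cong:
  assumes "open S" "x \<in> S" "\<And>y. y \<in> S \<Longrightarrow> f y = g y"
  shows "pd i f x = pd i g x"
proof -
  have "(f has_derivative D) (at x) \<longleftrightarrow> (g has_derivative D) (at x)" for D
    using has_derivative_transform_within_open[OF _ assms(1,2)] assms(3) by metis
  then show ?thesis by (simp add: pd_def frechet_derivative_def)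
qed

lemma differentiable_cong_open:
  assumes "open S" "x \<in> S" "\<And>y. y \<in> S \<Longrightarrow> f y = g y" "f differentiable (at x)"
  shows "g differentiable (at x)"
  using has_derivative_transform_within_open[OF frechet_derivative_worksD[OF assms(4)] assms(1,2,3)]
  by (rule differentiableI)

named_theorems pd_simps

lemma pd_const [pd_simps]: "pd i (\<lambda>x. c) x = 0"
  by (simp add: pd_def)

lemma pd_add [pd_simps]:
  assumes "f differentiable (at x)" "g differentiable (at x)"
  shows "pd i (\<lambda>x. f x + g x) x = pd i f x + pd i g x"
  using pd_eq[OF has_derivative_add[OF frechet_derivative_worksD[OF assms(1)] frechet_derivative_worksD[OF assms(2)]]]
  by (simp add: pd_def)

lemma pd_diff [pd_simps]:
  assumes "f differentiable (at x)" "g differentiable (at x)"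
  shows "pd i (\<lambda>x. f x - g x) x = pd i f x - pd i g x"
  using pd_eq[OF has_derivative_diff[OF frechet_derivative_worksD[OF assms(1)] frechet_derivative_worksD[OF assms(2)]]]
  by (simp add: pd_def)

lemma pd_minus [pd_simps]:
  assumes "f differentiable (at x)"
  shows "pd i (\<lambda>x. - f x) x = - pd i f x"
  using pd_eq[OF has_derivative_minus[OF frechet_derivative_worksD[OF assms]]]
  by (simp add: pd_def)

lemma pd_mult [pd_simps]:
  assumes "f differentiable (at x)" "g differentiable (at x)"
  shows "pd i (\<lambda>x. f x * g x) x = pd i f x * g x + f x * pd i g x"
  using pd_eq[OF has_derivative_mult[OF frechet_derivative_worksD[OF assms(1)] frechet_derivative_worksD[OF assms(2)]]]
  by (simp add: pd_def)

lemma pd_inverse [pd_simps]: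
  assumes "f differentiable (at x)" "f x \<noteq> 0"
  shows "pd i (\<lambda>x. inverse (f x)) x = - (pd i f x * (inverse (f x))\<^sup>2)"
  using pd_eq[OF Deriv.has_derivative_inverse[OF assms(2) frechet_derivative_worksD[OF assms(1)]]]
  by (simp add: pd_def power2_eq_square)

lemma pd_divide [pd_simps]:
  assumes "f differentiable (at x)" "g differentiable (at x)" "g x \<noteq> 0"
  shows "pd i (\<lambda>x. f x / g x) x = (pd i f x * g x - f x * pd i g x) / (g x)\<^sup>2"
proof -
  have "(\<lambda>x. inverse (g x)) differentiable (at x)"
    using assms by (simp add: differentiable_inverse)
  then show ?thesis
    using assms by (simp add: divide_inverse pd_mult pd_inverse)
      (simp add: field_simps power2_eq_square)
qed

lemma pd_chain:
  fixes T :: "real^'n::finite \<Rightarrow> real^'m::finite"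
  assumes f: "f differentiable (at (T x))"
    and T: "\<And>a. (\<lambda>x. T x $ a) differentiable (at x)"
  shows "pd i (\<lambda>x. f (T x)) x = (\<Sum>a\<in>UNIV. pd a f (T x) * pd i (\<lambda>x. T x $ a) x)"
    and "(\<lambda>x. f (T x)) differentiable (at x)"
proof -
  have "((\<lambda>x. T x $ a) has_derivative frechet_derivative (\<lambda>x. T x $ a) (at x)) (at x)" for a
    by (rule frechet_derivative_worksD[OF T])
  then have "(T has_derivative (\<lambda>h. \<chi> a. frechet_derivative (\<lambda>x. T x $ a) (at x) h)) (at x)"
    by (subst has_derivative_componentwise_within)
      (auto simp: Basis_vec_def inner_axis)
  then have *: "((\<lambda>x. f (T x)) has_derivative
      (\<lambda>h. \<Sum>a\<in>UNIV. frechet_derivative (\<lambda>x. T x $ a) (at x) h * pd a f (T x))) (at x)"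
    using has_derivative_compose[where g = f and f = T and x = x, OF _ has_derivative_pd[OF f]] by fastforce
  then show "(\<lambda>x. f (T x)) differentiable (at x)"
    by (auto simp: differentiable_def)
  show "pd i (\<lambda>x. f (T x)) x = (\<Sum>a\<in>UNIV. pd a f (T x) * pd i (\<lambda>x. T x $ a) x)"
    by (subst pd_eq[OF *]) (simp add: pd_def mult.commute)
qed

lemma has_field_derivative_along_axis:
  assumes "f differentiable (at (x + s *\<^sub>R axis i 1))"
  shows "((\<lambda>s. f (x + s *\<^sub>R axis i 1)) has_field_derivative pd i f (x + s *\<^sub>R axis i 1)) (at s)"
proof -
  have "(f has_derivative frechet_derivative f (at (x + s *\<^sub>R axis i 1))) (at (x + s *\<^sub>R axis i 1))"
    by (rule frechet_derivative_worksD[OF assms])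
  then have "((\<lambda>s. f (x + s *\<^sub>R axis i 1)) has_derivative
      (\<lambda>h. frechet_derivative f (at (x + s *\<^sub>R axis i 1)) (h *\<^sub>R axis i 1))) (at s)"
    by (rule has_derivative_compose[rotated]) (auto intro!: derivative_eq_intros)
  moreover have "frechet_derivative f (at y) (h *\<^sub>R axis i 1) = pd i f y * h"
    if "f differentiable (at y)" for y h
    using linear_cmul[OF linear_frechet_derivative[OF that]] by (simp add: pd_def)
  ultimately show ?thesis
    using assms by (simp add: has_field_derivative_def)
qed

section \<open>Functions of class C^k\<close>

lemma Ck_on_differentiable:
  "Ck_on (Suc k) S f \<Longrightarrow> open S \<Longrightarrow> x \<in> S \<Longrightarrow> f differentiable (at x)"
  by (auto simp: differentiable_on_eq_differentiable_at)

lemma Ck_on_imp_continuous_on: "Ck_on k S f \<Longrightarrow> continuous_on S f"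
  by (cases k) (auto intro: differentiable_imp_continuous_on)

lemma Ck_on_Suc_D: "Ck_on (Suc k) S f \<Longrightarrow> Ck_on k S f"
  by (induction k arbitrary: f) (auto intro: differentiable_imp_continuous_on)

lemma Ck_on_mono: "Ck_on m S f \<Longrightarrow> n \<le> m \<Longrightarrow> Ck_on n S f"
proof (induction m)
  case (Suc m)
  then show ?case using Ck_on_Suc_D[of m S f] by (cases "n = Suc m") auto
qed auto

lemma Ck_on_pd: "Ck_on (Suc k) S f \<Longrightarrow> Ck_on k S (pd i f)"
  by simp

lemma Ck_on_subset: "Ck_on k S f \<Longrightarrow> T \<subseteq> S \<Longrightarrow> Ck_on k T f"
  by (induction k arbitrary: f) (auto intro: continuous_on_subset differentiable_on_subset)

lemma Ck_on_cong:
  assumes "open S" "\<And>x. x \<in> S \<Longrightarrow> f x = g x" "Ck_on k S f"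
  shows "Ck_on k S g"
  using assms(2,3)
proof (induction k arbitrary: f g)
  case 0
  then show ?case by (simp cong: continuous_on_cong)
next
  case (Suc k)
  have "g differentiable_on S"
    using Suc.prems assms(1) differentiable_cong_open[of S _ f g]
    by (auto simp: differentiable_on_eq_differentiable_at)
  moreover have "Ck_on k S (pd i g)" for i
    using Suc.IH[of "pd i f" "pd i g"] Suc.prems pd_cong[OF assms(1), of _ f g] by auto
  ultimately show ?case by simp
qed

lemma Ck_on_const: "Ck_on k S (\<lambda>x. c)"
proof (induction k arbitrary: c)
  case (Suc k)
  moreover have "pd i (\<lambda>x. c) = (\<lambda>x. 0)" for i :: 'a by (simp add: pd_const fun_eq_iff)
  ultimately show ?case by simp
qed simp

lemma Ck_on_add:
  assumes "open S" "Ck_on k S f" "Ck_on k S g"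
  shows "Ck_on k S (\<lambda>x. f x + g x)"
  using assms(2,3)
proof (induction k arbitrary: f g)
  case 0
  then show ?case by (auto intro: continuous_intros)
next
  case (Suc k)
  have "Ck_on k S (pd i (\<lambda>x. f x + g x))" for i
    by (rule Ck_on_cong[OF assms(1) _ Suc.IH[of "pd i f" "pd i g"]])
      (use Suc.prems Ck_on_differentiable[OF Suc.prems(1) assms(1)]
        Ck_on_differentiable[OF Suc.prems(2) assms(1)] in \<open>auto simp: pd_add\<close>)
  then show ?case using Suc.prems by (simp add: differentiable_on_add)
qed

lemma Ck_on_mult:
  assumes "open S" "Ck_on k S f" "Ck_on k S g"
  shows "Ck_on k S (\<lambda>x. f x * g x)"
  using assms(2,3)
proof (induction k arbitrary: f g)
  case 0
  then show ?case by (auto intro: continuous_intros)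
next
  case (Suc k)
  have "Ck_on k S (pd i (\<lambda>x. f x * g x))" for i
  proof (rule Ck_on_cong[OF assms(1)])
    show "pd i f x * g x + f x * pd i g x = pd i (\<lambda>x. f x * g x) x" if "x \<in> S" for x
      using Ck_on_differentiable[OF Suc.prems(1) assms(1) that]
        Ck_on_differentiable[OF Suc.prems(2) assms(1) that] by (simp add: pd_mult)
    show "Ck_on k S (\<lambda>x. pd i f x * g x + f x * pd i g x)"
      by (intro Ck_on_add assms(1) Suc.IH)
        (use Suc.prems Ck_on_Suc_D[of k S f] Ck_on_Suc_D[of k S g] in simp_all)
  qed
  then show ?case using Suc.prems by (simp add: differentiable_on_mult)
qed

lemma Ck_on_minus: "open S \<Longrightarrow> Ck_on k S f \<Longrightarrow> Ck_on k S (\<lambda>x. - f x)"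
  using Ck_on_mult[of S k "\<lambda>x. -1" f] by (simp add: Ck_on_const)

lemma Ck_on_diff:
  "open S \<Longrightarrow> Ck_on k S f \<Longrightarrow> Ck_on k S g \<Longrightarrow> Ck_on k S (\<lambda>x. f x - g x)"
  using Ck_on_add[of S k f "\<lambda>x. - g x"] by (simp add: Ck_on_minus)

lemma Ck_on_sum:
  "open S \<Longrightarrow> (\<And>j. j \<in> I \<Longrightarrow> Ck_on k S (f j)) \<Longrightarrow> Ck_on k S (\<lambda>x. \<Sum>j\<in>I. f j x)"
  by (induction I rule: infinite_finite_induct) (auto simp: Ck_on_const Ck_on_add)

lemma Ck_on_power: "open S \<Longrightarrow> Ck_on k S f \<Longrightarrow> Ck_on k S (\<lambda>x. f x ^ n)"
  by (induction n) (auto simp: Ck_on_const Ck_on_mult)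

lemma Ck_on_inverse:
  assumes "open S" "Ck_on k S f" "\<And>x. x \<in> S \<Longrightarrow> f x \<noteq> 0"
  shows "Ck_on k S (\<lambda>x. inverse (f x))"
  using assms(2,3)
proof (induction k arbitrary: f)
  case 0
  then show ?case by (auto intro!: continuous_intros)
next
  case (Suc k)
  have "Ck_on k S (pd i (\<lambda>x. inverse (f x)))" for i
  proof (rule Ck_on_cong[OF assms(1)])
    show "- (pd i f x * (inverse (f x))\<^sup>2) = pd i (\<lambda>x. inverse (f x)) x" if "x \<in> S" for x
      using Ck_on_differentiable[OF Suc.prems(1) assms(1) that] Suc.prems(2)[OF that]
      by (simp add: pd_inverse)
    show "Ck_on k S (\<lambda>x. - (pd i f x * (inverse (f x))\<^sup>2))"
      by (intro Ck_on_minus Ck_on_mult Ck_on_power assms(1) Suc.IH)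
        (use Suc.prems Ck_on_Suc_D[of k S f] in simp_all)
  qed
  moreover have "(\<lambda>x. inverse (f x)) differentiable_on S"
    using Suc.prems Ck_on_differentiable[OF _ assms(1)] assms(1)
    by (auto simp: differentiable_on_eq_differentiable_at intro!: differentiable_inverse)
  ultimately show ?case by simp
qed

lemma Ck_on_divide:
  assumes "open S" "Ck_on k S f" "Ck_on k S g" "\<And>x. x \<in> S \<Longrightarrow> g x \<noteq> 0"
  shows "Ck_on k S (\<lambda>x. f x / g x)"
  using Ck_on_mult[OF assms(1,2) Ck_on_inverse[OF assms(1,3,4)]]
  by (simp only: divide_inverse)

text \<open>A derivative of the composite is a sum of products of \<open>pd a f\<close> after
  \<open>T\<close> with derivatives of \<open>T\<close>, so \<open>f\<close> varies in the induction
  while \<open>T\<close> stays fixed.\<close>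

lemma Ck_on_compose:
  fixes T :: "real^'n::finite \<Rightarrow> real^'m::finite"
  assumes "open S" "open S'" "\<And>x. x \<in> S \<Longrightarrow> T x \<in> S'"
    and T: "\<And>a. Ck_on k S (\<lambda>x. T x $ a)" and f: "Ck_on k S' f"
  shows "Ck_on k S (\<lambda>x. f (T x))"
proof -
  have "(\<forall>a. Ck_on k S (\<lambda>x. T x $ a)) \<Longrightarrow> Ck_on k S' f \<Longrightarrow> Ck_on k S (\<lambda>x. f (T x))"
  proof (induction k arbitrary: f)
    case 0
    have "continuous_on S T"
      using 0(1) by (subst continuous_on_componentwise) (auto simp: Basis_vec_def inner_axis)
    moreover have "continuous_on S' f" using 0 by simp
    ultimately have "continuous_on S (\<lambda>x. f (T x))"
      using assms(3) by (intro continuous_on_compose2[of S' f S T]) auto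
    then show ?case by simp
  next
    case (Suc k)
    have d: "f differentiable (at (T x))" "(\<lambda>x. T x $ a) differentiable (at x)" if "x \<in> S" for x a
      by (rule Ck_on_differentiable[OF Suc.prems(2) assms(2) assms(3)[OF that]])
        (rule Ck_on_differentiable[OF spec[OF Suc.prems(1)] assms(1) that])
    have "Ck_on k S (pd i (\<lambda>x. f (T x)))" for i
    proof (rule Ck_on_cong[OF assms(1)])
      show "(\<Sum>a\<in>UNIV. pd a f (T x) * pd i (\<lambda>x. T x $ a) x) = pd i (\<lambda>x. f (T x)) x" if "x \<in> S" for x
        using pd_chain(1)[OF d[OF that]] by simp
      show "Ck_on k S (\<lambda>x. \<Sum>a\<in>UNIV. pd a f (T x) * pd i (\<lambda>x. T x $ a) x)"
      proof (intro Ck_on_sum Ck_on_mult assms(1))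
        fix a
        have "Ck_on k S (\<lambda>x. T x $ b)" for b
          using Ck_on_Suc_D[OF spec[OF Suc.prems(1)]] .
        then show "Ck_on k S (\<lambda>x. pd a f (T x))"
          using Suc.IH[of "pd a f"] Ck_on_pd[OF Suc.prems(2)] by blast
        show "Ck_on k S (pd i (\<lambda>x. T x $ a))"
          using Ck_on_pd[OF spec[OF Suc.prems(1)]] .
      qed
    qed
    moreover have "(\<lambda>x. f (T x)) differentiable_on S"
      using pd_chain(2)[of f T, OF d] assms(1) by (auto simp: differentiable_on_eq_differentiable_at)
    ultimately show ?case by simp
  qed
  then show ?thesis using T f by blast
qed

lemma Ck_on_component: "Ck_on k S (\<lambda>x. x $ i)"
proof (cases k)
  case (Suc m)
  have h: "((\<lambda>x. x $ i) has_derivative (\<lambda>h. h $ i)) (at x)" for x :: "real^'a"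
    by (rule bounded_linear_imp_has_derivative[OF bounded_linear_vec_nth])
  then have "pd j (\<lambda>x. x $ i) = (\<lambda>x. axis j 1 $ i)" for j :: 'a
    using pd_eq[OF h] by (simp add: fun_eq_iff)
  moreover have "(\<lambda>x. x $ i) differentiable_on S"
    using h by (auto simp: differentiable_on_def intro: differentiableI has_derivative_at_withinI)
  ultimately show ?thesis using Suc by (simp add: Ck_on_const)
qed (auto intro: continuous_intros)

text \<open>Schwarz's theorem. The second difference over a small square is symmetric in the two
  directions, and two mean value steps write it as \<open>h * h\<close> times either mixed
  derivative at a nearby point; continuity then brings both points to \<open>x\<close>.\<close>

lemma pd_commute:
  assumes S: "open S" "x \<in> S" and f: "Ck_on 2 S f"
  shows "pd i (pd j f) x = pd j (pd i f) x"
proof -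
  have f2: "f differentiable (at y)" "pd i f differentiable (at y)"
    "pd j f differentiable (at y)" if "y \<in> S" for y i j
    using f that S by (auto simp: numeral_2_eq_2 differentiable_on_eq_differentiable_at)
  have cont: "continuous_on S (pd i (pd j f))" "continuous_on S (pd j (pd i f))"
    using f by (auto simp: numeral_2_eq_2)
  have mvt: "\<exists>y. dist y x \<le> 2 * h \<and>
      f (x + h *\<^sub>R axis i 1 + h *\<^sub>R axis j 1) - f (x + h *\<^sub>R axis i 1) - f (x + h *\<^sub>R axis j 1) + f x
      = h * h * pd j (pd i f) y"
    if h: "0 < h" "cball x (2 * h) \<subseteq> S" for i j h
  proof -
    have n: "norm (axis k (1::real)) = 1" for k :: 'a by simp
    have inS: "x + s *\<^sub>R axis i 1 + t *\<^sub>R axis j 1 \<in> cball x (2 * h)"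
      if "0 \<le> s" "s \<le> h" "0 \<le> t" "t \<le> h" for s t
    proof -
      have "norm (s *\<^sub>R axis i 1 + t *\<^sub>R axis j (1::real)) \<le> s + t"
        using norm_triangle_ineq[of "s *\<^sub>R axis i 1" "t *\<^sub>R axis j (1::real)"] that by simp
      then have "norm (s *\<^sub>R axis i 1 + t *\<^sub>R axis j (1::real)) \<le> 2 * h" using that by linarith
      then show ?thesis by (metis add.assoc add_diff_cancel_left' dist_norm mem_cball norm_minus_commute)
    qed
    \<comment> \<open>Mean value theorem in direction i for the difference of \<open>f\<close>
      between the two sides of the square parallel to that axis; the second application runs in
      direction j.\<close>
    have "\<exists>z>0. z < h \<and> (f (x + h *\<^sub>R axis j 1 + h *\<^sub>R axis i 1) - f (x + h *\<^sub>R axis i 1)) -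
        (f (x + h *\<^sub>R axis j 1 + 0 *\<^sub>R axis i 1) - f (x + 0 *\<^sub>R axis i 1)) =
        (h - 0) * (pd i f (x + h *\<^sub>R axis j 1 + z *\<^sub>R axis i 1) - pd i f (x + z *\<^sub>R axis i 1))"
      using h(1)
    proof (rule MVT2)
      fix s assume s: "0 \<le> s" "s \<le> h"
      have "x + h *\<^sub>R axis j 1 + s *\<^sub>R axis i 1 \<in> S" "x + s *\<^sub>R axis i 1 \<in> S"
        using inS[of s h] inS[of s 0] s h by (auto simp: algebra_simps)
      then show "((\<lambda>s. f (x + h *\<^sub>R axis j 1 + s *\<^sub>R axis i 1) - f (x + s *\<^sub>R axis i 1)) has_real_derivative
          pd i f (x + h *\<^sub>R axis j 1 + s *\<^sub>R axis i 1) - pd i f (x + s *\<^sub>R axis i 1)) (at s)"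
        by (intro DERIV_diff has_field_derivative_along_axis f2)
    qed
    then obtain z where z: "0 < z" "z < h" and
      1: "f (x + h *\<^sub>R axis j 1 + h *\<^sub>R axis i 1) - f (x + h *\<^sub>R axis i 1) - f (x + h *\<^sub>R axis j 1) + f x
        = h * (pd i f (x + h *\<^sub>R axis j 1 + z *\<^sub>R axis i 1) - pd i f (x + z *\<^sub>R axis i 1))"
      by auto
    have "\<exists>v>0. v < h \<and> pd i f (x + z *\<^sub>R axis i 1 + h *\<^sub>R axis j 1) - pd i f (x + z *\<^sub>R axis i 1 + 0 *\<^sub>R axis j 1) =
        (h - 0) * pd j (pd i f) (x + z *\<^sub>R axis i 1 + v *\<^sub>R axis j 1)"
      using h(1)
    proof (rule MVT2)
      fix s assume s: "0 \<le> s" "s \<le> h"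
      have "x + z *\<^sub>R axis i 1 + s *\<^sub>R axis j 1 \<in> S"
        using inS[of z s] s z h by auto
      then show "((\<lambda>s. pd i f (x + z *\<^sub>R axis i 1 + s *\<^sub>R axis j 1)) has_real_derivative
          pd j (pd i f) (x + z *\<^sub>R axis i 1 + s *\<^sub>R axis j 1)) (at s)"
        by (intro has_field_derivative_along_axis f2)
    qed
    then obtain v where v: "0 < v" "v < h" and
      2: "pd i f (x + z *\<^sub>R axis i 1 + h *\<^sub>R axis j 1) - pd i f (x + z *\<^sub>R axis i 1)
        = h * pd j (pd i f) (x + z *\<^sub>R axis i 1 + v *\<^sub>R axis j 1)" by auto
    have "dist (x + z *\<^sub>R axis i 1 + v *\<^sub>R axis j 1) x \<le> 2 * h"
      using inS[of z v] z v by (simp add: dist_commute)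
    moreover have "x + h *\<^sub>R axis j 1 + z *\<^sub>R axis i 1 = x + z *\<^sub>R axis i 1 + h *\<^sub>R axis j (1::real)"
      "x + h *\<^sub>R axis j 1 + h *\<^sub>R axis i 1 = x + h *\<^sub>R axis i 1 + h *\<^sub>R axis j (1::real)"
      by (simp_all add: algebra_simps)
    ultimately show ?thesis using 1 2 by (metis (no_types, lifting) mult.assoc)
  qed
  have "\<bar>pd i (pd j f) x - pd j (pd i f) x\<bar> < e" if "e > 0" for e
  proof -
    obtain d1 where d1: "d1 > 0" "\<And>y. y \<in> S \<Longrightarrow> dist y x < d1 \<Longrightarrow> dist (pd i (pd j f) y) (pd i (pd j f) x) < e/2"
      using cont(1) S(2) \<open>e > 0\<close> unfolding continuous_on_iff by (metis half_gt_zero)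
    obtain d2 where d2: "d2 > 0" "\<And>y. y \<in> S \<Longrightarrow> dist y x < d2 \<Longrightarrow> dist (pd j (pd i f) y) (pd j (pd i f) x) < e/2"
      using cont(2) S(2) \<open>e > 0\<close> unfolding continuous_on_iff by (metis half_gt_zero)
    obtain d where d: "d > 0" "cball x d \<subseteq> S"
      using S open_contains_cball by blast
    define h where "h = min d (min d1 d2) / 4"
    have h: "0 < h" "2 * h \<le> d" "2 * h < d1" "2 * h < d2" using d d1 d2 by (auto simp: h_def)
    have sub: "cball x (2 * h) \<subseteq> S" using h d by (meson order_trans subset_cball)
    obtain y where y: "dist y x \<le> 2 * h" "f (x + h *\<^sub>R axis i 1 + h *\<^sub>R axis j 1) - f (x + h *\<^sub>R axis i 1) - f (x + h *\<^sub>R axis j 1) + f x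
      = h * h * pd j (pd i f) y" using mvt[OF h(1) sub] by blast
    obtain z where z: "dist z x \<le> 2 * h" "f (x + h *\<^sub>R axis j 1 + h *\<^sub>R axis i 1) - f (x + h *\<^sub>R axis j 1) - f (x + h *\<^sub>R axis i 1) + f x
      = h * h * pd i (pd j f) z" using mvt[OF h(1) sub] by blast
    have sw: "x + h *\<^sub>R axis j 1 + h *\<^sub>R axis i 1 = x + h *\<^sub>R axis i 1 + h *\<^sub>R axis j (1::real)"
      by (simp add: algebra_simps)
    have "h * h * pd i (pd j f) z = h * h * pd j (pd i f) y"
      using y(2) z(2)[unfolded sw] by linarith
    then have eq: "pd i (pd j f) z = pd j (pd i f) y" using h by simp
    have "y \<in> S" "z \<in> S" using y z sub by (auto simp: dist_commute)
    then have "dist (pd i (pd j f) z) (pd i (pd j f) x) < e/2" "dist (pd j (pd i f) y) (pd j (pd i f) x) < e/2"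
      using d1 d2 y z h by auto
    then show ?thesis unfolding dist_real_def eq by linarith
  qed
  \<comment> \<open>With the discrepancy itself as e, a nonzero value would be smaller than
    itself.\<close>
  from this[of "\<bar>pd i (pd j f) x - pd j (pd i f) x\<bar>"] show ?thesis by fastforce
qed

section \<open>Symplectic connections in a chart of a surface\<close>

lemma sum_lists_Suc:
  fixes f :: "'n::finite list \<Rightarrow> 'b::comm_monoid_add"
  shows "(\<Sum>is | length is = Suc k. f is) = (\<Sum>i\<in>UNIV. \<Sum>is | length is = k. f (i # is))"
proof -
  have "{is :: 'n list. length is = Suc k} = (\<lambda>(i, is). i # is) ` (UNIV \<times> {is. length is = k})"
    by (auto simp: image_iff length_Suc_conv)
  moreover have "inj_on (\<lambda>(i, is). i # is) (UNIV \<times> {is :: 'n list. length is = k})"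
    by (auto simp: inj_on_def)
  ultimately show ?thesis
    by (simp add: sum.reindex sum.cartesian_product case_prod_unfold)
qed

lemma sum_lists_2:
  fixes f :: "'n::finite list \<Rightarrow> 'b::comm_monoid_add"
  shows "(\<Sum>is | length is = 2. f is) = (\<Sum>i\<in>UNIV. \<Sum>j\<in>UNIV. f [i, j])"
  by (simp add: numeral_2_eq_2 sum_lists_Suc)

lemma sum_lists_3:
  fixes f :: "'n::finite list \<Rightarrow> 'b::comm_monoid_add"
  shows "(\<Sum>is | length is = 3. f is) = (\<Sum>i\<in>UNIV. \<Sum>j\<in>UNIV. \<Sum>k\<in>UNIV. f [i, j, k])"
  by (simp add: numeral_3_eq_3 sum_lists_Suc)

lemma sum_lists_4:
  fixes f :: "'n::finite list \<Rightarrow> 'b::comm_monoid_add"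
  shows "(\<Sum>is | length is = 4. f is) = (\<Sum>i\<in>UNIV. \<Sum>j\<in>UNIV. \<Sum>k\<in>UNIV. \<Sum>l\<in>UNIV. f [i, j, k, l])"
  by (simp add: eval_nat_numeral sum_lists_Suc)

lemma raise_all_2:
  "raise_all w T [i, j] x = (\<Sum>a\<in>UNIV. \<Sum>b\<in>UNIV. bivec w i a x * bivec w j b x * T [a, b] x)"
  by (simp add: raise_all_def sum_lists_2[unfolded numeral_2_eq_2] lessThan_Suc mult_ac)

lemma raise_all_4:
  "raise_all w T [i, j, k, l] x = (\<Sum>a\<in>UNIV. \<Sum>b\<in>UNIV. \<Sum>c\<in>UNIV. \<Sum>d\<in>UNIV.
    bivec w i a x * bivec w j b x * bivec w k c x * bivec w l d x * T [a, b, c, d] x)"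
  by (simp add: raise_all_def sum_lists_Suc lessThan_Suc mult_ac)

lemma bivec_2:
  assumes "w [1, 2] x \<noteq> 0" and "\<And>i j :: 2. w [i, j] x = - w [j, i] x"
  shows "bivec w 1 1 x = 0" "bivec w 2 2 x = 0"
    "bivec w 1 2 x = 1 / w [1, 2] x" "bivec w 2 1 x = - 1 / w [1, 2] x"
proof -
  let ?A = "(\<chi> i j. w [i, j] x) :: real^2^2"
  let ?B = "(\<chi> i j. if i = 1 \<and> j = 2 then - 1 / w [1, 2] x else if i = 2 \<and> j = 1 then 1 / w [1, 2] x else 0) :: real^2^2"
  have [simp]: "w [1, 1] x = 0" "w [2, 2] x = 0" "w [2, 1] x = - w [1, 2] x"
    using assms(2)[of 1 1] assms(2)[of 2 2] assms(2)[of 2 1] by simp_all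
  have AB: "?A ** ?B = mat 1" "?B ** ?A = mat 1"
    using assms(1) by (simp_all add: vec_eq_iff forall_2 matrix_matrix_mult_def sum_2 mat_def)
  \<comment> \<open>\<open>matrix_inv\<close> is a choice; it is identified with the explicit matrix
    by uniqueness of two-sided inverses.\<close>
  have "?A ** matrix_inv ?A = mat 1 \<and> matrix_inv ?A ** ?A = mat 1"
    unfolding matrix_inv_def by (rule someI_ex) (use AB in blast)
  then have "?B ** (?A ** matrix_inv ?A) = ?B" by simp
  then have "matrix_inv ?A = ?B" by (simp only: matrix_mul_assoc AB(2) matrix_mul_lid)
  then show "bivec w 1 1 x = 0" "bivec w 2 2 x = 0"
    "bivec w 1 2 x = 1 / w [1, 2] x" "bivec w 2 1 x = - 1 / w [1, 2] x"
    by (simp_all add: bivec_def)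
qed

lemma covd_2:
  "covd \<Gamma> T [i, j, k] x = pd i (T [j, k]) x
    - (\<Sum>p\<in>UNIV. \<Gamma> i j p x * T [p, k] x) - (\<Sum>p\<in>UNIV. \<Gamma> i k p x * T [j, p] x)"
  by (simp add: numeral_2_eq_2 lessThan_Suc)

lemma covd_3:
  "covd \<Gamma> T [i, j, k, l] x = pd i (T [j, k, l]) x
    - (\<Sum>p\<in>UNIV. \<Gamma> i j p x * T [p, k, l] x) - (\<Sum>p\<in>UNIV. \<Gamma> i k p x * T [j, p, l] x)
    - (\<Sum>p\<in>UNIV. \<Gamma> i l p x * T [j, k, p] x)"
  by (simp add: numeral_3_eq_3 lessThan_Suc)

section \<open>Curvature of a surface\<close>

lemma curv_antisym: "curv \<Gamma> i j k l x = - curv \<Gamma> j i k l x"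
  by (simp add: curv_def sum_subtractf)

text \<open>Antisymmetry in the first index pair leaves one surviving term in the trace that defines
  \<open>ric\<close>. Hence Ricci carries the whole curvature of a surface, and later identities are
  phrased with it alone.\<close>

lemma curv_2:
  fixes \<Gamma> :: "2 \<Rightarrow> 2 \<Rightarrow> 2 \<Rightarrow> real^2 \<Rightarrow> real"
  shows "curv \<Gamma> 1 1 j k x = 0" "curv \<Gamma> 2 2 j k x = 0"
    "curv \<Gamma> 1 2 j 1 x = ric \<Gamma> [2, j] x" "curv \<Gamma> 1 2 j 2 x = - ric \<Gamma> [1, j] x"
    "curv \<Gamma> 2 1 j 1 x = - ric \<Gamma> [2, j] x" "curv \<Gamma> 2 1 j 2 x = ric \<Gamma> [1, j] x"
  using curv_antisym[of \<Gamma> 1 1 j k x] curv_antisym[of \<Gamma> 2 2 j k x] curv_antisym[of \<Gamma> 2 1 j _ x]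
    curv_antisym[of \<Gamma> 2 2 j _ x] curv_antisym[of \<Gamma> 1 1 j _ x]
  by (simp_all add: sum_2)

text \<open>
  These are $\nabla_1 R_{2j} - \nabla_2 R_{1j}$ for torsion-free $\nabla$, the covector
  $\rho_j = \nabla^q R_{jq}$, and $K = \nabla^i\rho_i$.
\<close>

definition curl_ric :: "(2 \<Rightarrow> 2 \<Rightarrow> 2 \<Rightarrow> real^2 \<Rightarrow> real) \<Rightarrow> 2 \<Rightarrow> real^2 \<Rightarrow> real" where
  "curl_ric \<Gamma> j x = pd 1 (ric \<Gamma> [2, j]) x - pd 2 (ric \<Gamma> [1, j]) x
    - (\<Sum>p\<in>UNIV. \<Gamma> 1 j p x * ric \<Gamma> [2, p] x) + (\<Sum>p\<in>UNIV. \<Gamma> 2 j p x * ric \<Gamma> [1, p] x)"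

definition rho :: "(real^2 \<Rightarrow> real) \<Rightarrow> (2 \<Rightarrow> 2 \<Rightarrow> 2 \<Rightarrow> real^2 \<Rightarrow> real) \<Rightarrow> 2 \<Rightarrow> real^2 \<Rightarrow> real" where
  "rho w \<Gamma> j x = - curl_ric \<Gamma> j x / w x"

definition K_scal :: "(real^2 \<Rightarrow> real) \<Rightarrow> (2 \<Rightarrow> 2 \<Rightarrow> 2 \<Rightarrow> real^2 \<Rightarrow> real) \<Rightarrow> real^2 \<Rightarrow> real" where
  "K_scal w \<Gamma> x = - (pd 1 (rho w \<Gamma> 2) x - pd 2 (rho w \<Gamma> 1) x) / w x"

text \<open>\<open>pd_w\<close> is the only independent component of the condition that the form is
  parallel. The number \<open>n\<close> counts the derivatives left on K: curvature,
  \<open>curl_ric\<close> and K each consume one of the \<open>n + 3\<close> of the Christoffel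
  symbols. Finite regularity is allowed because varied connections are instances too.\<close>

locale chart_geometry =
  fixes n :: nat and S :: "(real^2) set" and w :: "real^2 \<Rightarrow> real"
    and \<Gamma> :: "2 \<Rightarrow> 2 \<Rightarrow> 2 \<Rightarrow> real^2 \<Rightarrow> real"
  assumes open_S: "open S"
    and w_nz: "\<And>x. x \<in> S \<Longrightarrow> w x \<noteq> 0"
    and \<Gamma>_sym: "\<And>x i j k. x \<in> S \<Longrightarrow> \<Gamma> i j k x = \<Gamma> j i k x"
    and pd_w: "\<And>x i. x \<in> S \<Longrightarrow> pd i w x = (\<Gamma> i 1 1 x + \<Gamma> i 2 2 x) * w x"
    and Ck_w: "\<And>k. Ck_on k S w"
    and Ck_\<Gamma>: "\<And>i j k. Ck_on (n + 3) S (\<Gamma> i j k)"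
begin

section \<open>Regularity of curvature, its curl, and K\<close>

lemmas Ck_intros = open_S Ck_on_add Ck_on_mult Ck_on_diff Ck_on_minus Ck_on_sum Ck_on_const Ck_w

lemma Ck_curv: "Ck_on (n + 2) S (curv \<Gamma> i j k l)"
proof -
  have "Ck_on (n + 2) S (pd i (\<Gamma> j k l))" "Ck_on (n + 2) S (\<Gamma> j k l)" for i j k l
    using Ck_\<Gamma>[of j k l] Ck_on_mono[OF Ck_\<Gamma>, of "n + 2" j k l]
    by (simp_all add: numeral_3_eq_3)
  then show ?thesis
    unfolding curv_def[abs_def] by (intro Ck_intros)
qed

lemma Ck_ric: "Ck_on (n + 2) S (ric \<Gamma> [i, j])"
proof -
  have "ric \<Gamma> [i, j] = (\<lambda>x. \<Sum>p\<in>UNIV. curv \<Gamma> p i j p x)" by auto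
  then show ?thesis by (simp only:) (intro Ck_intros Ck_curv)
qed

lemma Ck_curl_ric: "Ck_on (n + 1) S (curl_ric \<Gamma> j)"
proof -
  have "Ck_on (n + 1) S (pd i (ric \<Gamma> [j, k]))" "Ck_on (n + 1) S (ric \<Gamma> [j, k])"
    "Ck_on (n + 1) S (\<Gamma> i j k)" for i j k
    using Ck_ric[of j k] Ck_on_mono[OF Ck_ric, of "n + 1" j k] Ck_on_mono[OF Ck_\<Gamma>, of "n + 1"]
    by (simp_all add: numeral_2_eq_2)
  then show ?thesis
    unfolding curl_ric_def[abs_def] by (intro Ck_intros)
qed

lemma Ck_rho: "Ck_on (n + 1) S (rho w \<Gamma> j)"
  unfolding rho_def[abs_def] by (intro Ck_intros Ck_on_divide Ck_curl_ric w_nz)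

lemma Ck_K_scal: "Ck_on n S (K_scal w \<Gamma>)"
proof -
  have "Ck_on n S (pd i (rho w \<Gamma> j))" for i j
    using Ck_rho[of j] by simp
  then show ?thesis
    unfolding K_scal_def[abs_def] by (intro Ck_intros Ck_on_divide w_nz)
qed

context fixes x assumes x: "x \<in> S" begin

lemma diff_w: "w differentiable (at x)"
  using Ck_on_differentiable[OF Ck_w open_S x] .

lemma diff_\<Gamma>: "\<Gamma> i j k differentiable (at x)"
  using Ck_on_differentiable[of "n + 2" S "\<Gamma> i j k"] Ck_\<Gamma>[of i j k] open_S x by (simp add: numeral_eq_Suc)

lemma diff_ric: "ric \<Gamma> [i, j] differentiable (at x)"
  using Ck_on_differentiable[of "n + 1" S "ric \<Gamma> [i, j]"] Ck_ric[of i j] open_S x by (simp add: numeral_eq_Suc)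

lemma diff_rho: "rho w \<Gamma> i differentiable (at x)"
  using Ck_on_differentiable[of n S "rho w \<Gamma> i"] Ck_rho[of i] open_S x by simp

text \<open>By \<open>pd_w\<close> the trace of the connection is the logarithmic derivative of
  \<open>w\<close>, hence closed by equality of mixed partials of \<open>w\<close>. The
  antisymmetric part of Ricci is the curl of that trace.\<close>

lemma ric_sym: "ric \<Gamma> [i, j] x = ric \<Gamma> [j, i] x"
proof -
  define h where "h = (\<lambda>i y. \<Gamma> i 1 1 y + \<Gamma> i 2 2 y)"
  have dh: "h i differentiable (at x)" for i
    unfolding h_def by (intro differentiable_add diff_\<Gamma>)
  have "pd i (pd j w) x = pd i (h j) x * w x + h j x * (h i x * w x)" for i j
  proof -
    have "pd i (pd j w) x = pd i (\<lambda>y. h j y * w y) x"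
      by (rule pd_cong[OF open_S x]) (simp add: pd_w h_def)
    then show ?thesis
      using pd_w[OF x] by (simp add: pd_mult diff_w dh) (simp add: h_def)
  qed
  moreover have "pd 1 (pd 2 w) x = pd 2 (pd 1 w) x"
    by (rule pd_commute[OF open_S x Ck_w])
  ultimately have "pd 1 (h 2) x = pd 2 (h 1) x"
    using w_nz[OF x] by simp
  moreover have "pd i (h j) x = pd i (\<Gamma> j 1 1) x + pd i (\<Gamma> j 2 2) x" for i j
    unfolding h_def by (simp add: pd_add diff_\<Gamma>)
  ultimately have "ric \<Gamma> [1, 2] x = ric \<Gamma> [2, 1] x"
    by (simp add: sum_2 curv_def)
  then show ?thesis using exhaust_2[of i] exhaust_2[of j] by auto
qed

end

text \<open>Both quadratic terms are multiples of the determinant of Ricci over the square of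
  \<open>w\<close>, with factors 2 and 4, so they contribute \<open>- 1/2 * 2 + 1/4 * 4 = 0\<close>.
  In the remaining double divergence, each contraction with the bivector is an antisymmetrised
  derivative divided by \<open>w\<close>, where the torsion-free Christoffel terms cancel.\<close>

lemma K_coord_eq_K_scal:
  assumes x: "x \<in> S"
    and W: "\<And>y i j. y \<in> S \<Longrightarrow> W [i, j] y = - W [j, i] y" "\<And>y. y \<in> S \<Longrightarrow> W [1, 2] y = w y"
  shows "K_coord W \<Gamma> x = K_scal w \<Gamma> x"
proof -
  define D where "D = (\<lambda>i j k. covd \<Gamma> (ric \<Gamma>) [i, j, k])"
  have D: "D i j k = (\<lambda>y. pd i (ric \<Gamma> [j, k]) y - (\<Sum>p\<in>UNIV. \<Gamma> i j p y * ric \<Gamma> [p, k] y)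
      - (\<Sum>p\<in>UNIV. \<Gamma> i k p y * ric \<Gamma> [j, p] y))" for i j k
    by (simp add: D_def fun_eq_iff covd_2 del: covd.simps ric.simps)
  have "Ck_on (n + 1) S (D i j k)" for i j k
  proof -
    have "Ck_on (n + 1) S (pd i (ric \<Gamma> [j, k]))" "Ck_on (n + 1) S (ric \<Gamma> [j, k])"
      "Ck_on (n + 1) S (\<Gamma> i j k)" for i j k
      using Ck_ric[of j k] Ck_on_mono[OF Ck_ric, of "n + 1" j k] Ck_on_mono[OF Ck_\<Gamma>, of "n + 1"]
      by (simp_all add: numeral_2_eq_2)
    then show ?thesis unfolding D by (intro Ck_intros)
  qed
  then have dD: "D i j k differentiable (at x)" for i j k
    using Ck_on_differentiable[of n S "D i j k"] open_S x by simp
  have Dsym: "D i j k y = D i k j y" if "y \<in> S" for i j k y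
  proof -
    have "pd i (ric \<Gamma> [j, k]) y = pd i (ric \<Gamma> [k, j]) y"
      by (rule pd_cong[OF open_S that], erule ric_sym)
    then show ?thesis using ric_sym[OF that] by (simp add: D sum_2 del: ric.simps)
  qed
  have rho: "rho w \<Gamma> j y = (D 2 j 1 y - D 1 j 2 y) / w y" if "y \<in> S" for j y
    unfolding Dsym[OF that, of _ j] using \<Gamma>_sym[OF that, of 1 2]
    by (simp add: D rho_def curl_ric_def sum_2 del: ric.simps)
  have pdrho: "pd i (rho w \<Gamma> j) x = (pd i (D 2 j 1) x - pd i (D 1 j 2) x) / w x
      - (\<Gamma> i 1 1 x + \<Gamma> i 2 2 x) * (D 2 j 1 x - D 1 j 2 x) / w x" for i j
  proof -
    have "pd i (rho w \<Gamma> j) x = pd i (\<lambda>y. (D 2 j 1 y - D 1 j 2 y) / w y) x"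
      by (rule pd_cong[OF open_S x], erule rho)
    also have "\<dots> = ((pd i (D 2 j 1) x - pd i (D 1 j 2) x) * w x - (D 2 j 1 x - D 1 j 2 x) * pd i w x) / (w x)\<^sup>2"
      by (simp add: pd_divide pd_diff dD diff_w[OF x] w_nz[OF x])
    finally show ?thesis
      using w_nz[OF x] by (simp add: pd_w[OF x] power2_eq_square field_simps)
  qed
  have pdDsym: "pd i (D 1 2 1) x = pd i (D 1 1 2) x" "pd i (D 2 2 1) x = pd i (D 2 1 2) x" for i
    by (rule pd_cong[OF open_S x], erule Dsym)+
  have W': "W [1, 2] x \<noteq> 0" "\<And>i j. W [i, j] x = - W [j, i] x" "W [1, 2] x = w x"
    by (simp add: W(2)[OF x] w_nz[OF x], rule W(1)[OF x], rule W(2)[OF x])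
  have Wd: "W [1, 1] x = 0" "W [2, 2] x = 0" "W [2, 1] x = - w x"
    using W'(2)[of 1 1] W'(2)[of 2 2] W'(2)[of 2 1] W'(3) by linarith+
  note b = bivec_2[of W x, OF W'(1,2), unfolded W'(3)]
  have covdD: "covd \<Gamma> (covd \<Gamma> (ric \<Gamma>)) [p, q, i, j] x = pd p (D q i j) x
    - (\<Sum>a\<in>UNIV. \<Gamma> p q a x * D a i j x) - (\<Sum>a\<in>UNIV. \<Gamma> p i a x * D q a j x)
    - (\<Sum>a\<in>UNIV. \<Gamma> p j a x * D q i a x)" for p q i j
    by (simp add: covd_3 D_def del: covd.simps ric.simps)
  have R: "(\<Sum>is | length is = 2. raise_all W (ric \<Gamma>) is x * ric \<Gamma> is x)
      = 2 * (ric \<Gamma> [1, 1] x * ric \<Gamma> [2, 2] x - (ric \<Gamma> [1, 2] x)\<^sup>2) / (w x)\<^sup>2"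
    using ric_sym[OF x, of 2 1] w_nz[OF x]
    by (simp add: sum_lists_2 raise_all_2 sum_2 b power2_eq_square field_simps del: ric.simps)
  have low: "curv_low W \<Gamma> [1, 2, k, l] x = w x * ric \<Gamma> [k, l] x"
    "curv_low W \<Gamma> [2, 1, k, l] x = - w x * ric \<Gamma> [k, l] x"
    "curv_low W \<Gamma> [1, 1, k, l] x = 0" "curv_low W \<Gamma> [2, 2, k, l] x = 0" for k l
    using exhaust_2[of l] ric_sym[OF x, of k l]
    by (auto simp: sum_2 curv_2 Wd W'(3) simp del: ric.simps)
  have up: "raise_all W (curv_low W \<Gamma>) [1, 2, k, l] x = (\<Sum>c\<in>UNIV. \<Sum>d\<in>UNIV. bivec W k c x * bivec W l d x * ric \<Gamma> [c, d] x) / w x"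
    "raise_all W (curv_low W \<Gamma>) [2, 1, k, l] x = - (\<Sum>c\<in>UNIV. \<Sum>d\<in>UNIV. bivec W k c x * bivec W l d x * ric \<Gamma> [c, d] x) / w x" for k l
    using w_nz[OF x]
    by (simp_all add: raise_all_4 sum_2 b(1-4) low field_simps del: ric.simps curv_low.simps)
  have C: "(\<Sum>is | length is = 4. raise_all W (curv_low W \<Gamma>) is x * curv_low W \<Gamma> is x)
      = 4 * (ric \<Gamma> [1, 1] x * ric \<Gamma> [2, 2] x - (ric \<Gamma> [1, 2] x)\<^sup>2) / (w x)\<^sup>2"
    using ric_sym[OF x, of 2 1] w_nz[OF x]
    by (simp add: sum_lists_4 sum_2 low up b power2_eq_square field_simps del: ric.simps curv_low.simps)
  show ?thesis
    unfolding K_coord_def R C covdD K_scal_def pdrho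
    using w_nz[OF x] Dsym[OF x, of _ 2 1] pdDsym \<Gamma>_sym[OF x, of 2 1]
    by (simp add: sum_2 b power2_eq_square field_simps)
qed

end

section \<open>Behaviour under a change of coordinates\<close>

text \<open>\<open>V\<close> is the overlap in coordinates of the first chart and
  \<open>\<tau>\<close> the transition map. A 2-form on a surface has one component, so its law is
  the Jacobian determinant. Both sides are arbitrary chart geometries, which lets the locale serve
  for varied connections.\<close>

locale chart_change =
  A: chart_geometry n S w \<Gamma> + B: chart_geometry n S' w' \<Gamma>'
  for n S w \<Gamma> S' w' \<Gamma>' +
  fixes V :: "(real^2) set" and \<tau> :: "real^2 \<Rightarrow> real^2"
  assumes open_V: "open V" and VS: "V \<subseteq> S" and \<tau>S': "\<And>x. x \<in> V \<Longrightarrow> \<tau> x \<in> S'"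
    and Ck_\<tau>: "\<And>k a. Ck_on k V (\<lambda>x. \<tau> x $ a)"
    and w_law: "\<And>x. x \<in> V \<Longrightarrow> w x =
      (pd 1 (\<lambda>z. \<tau> z $ 1) x * pd 2 (\<lambda>z. \<tau> z $ 2) x - pd 1 (\<lambda>z. \<tau> z $ 2) x * pd 2 (\<lambda>z. \<tau> z $ 1) x) * w' (\<tau> x)"
    and \<Gamma>_law: "\<And>x i j m. x \<in> V \<Longrightarrow> (\<Sum>k\<in>UNIV. \<Gamma> i j k x * pd k (\<lambda>z. \<tau> z $ m) x) =
      (\<Sum>a\<in>UNIV. \<Sum>b\<in>UNIV. pd i (\<lambda>z. \<tau> z $ a) x * pd j (\<lambda>z. \<tau> z $ b) x * \<Gamma>' a b m (\<tau> x))
        + pd i (pd j (\<lambda>z. \<tau> z $ m)) x"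
begin

section \<open>The Jacobian of the transition map and its derivatives\<close>

definition J where "J i a = pd i (\<lambda>z. \<tau> z $ a)"

definition detJ where "detJ x = J 1 1 x * J 2 2 x - J 1 2 x * J 2 1 x"

lemma Ck_J: "Ck_on k V (J i a)"
  using Ck_\<tau>[of "Suc k" a] by (simp add: J_def)

context fixes x assumes x: "x \<in> V" begin

lemma xS: "x \<in> S" using x VS by blast

lemma diff_J: "J i a differentiable (at x)"
  by (rule Ck_on_differentiable[OF Ck_J open_V x])

lemma diff_\<tau>: "(\<lambda>x. \<tau> x $ a) differentiable (at x)"
  by (rule Ck_on_differentiable[OF Ck_\<tau> open_V x])

lemma w_eq: "w x = detJ x * w' (\<tau> x)"
  using w_law[OF x] by (simp add: detJ_def J_def)

lemma detJ_nz: "detJ x \<noteq> 0"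
  using w_law[OF x] A.w_nz[OF xS] by (auto simp: detJ_def J_def)

lemma pd_J_sym: "pd i (J j a) x = pd j (J i a) x"
  unfolding J_def by (rule pd_commute[OF open_V x Ck_\<tau>])

lemma pd_J: "pd i (J j m) x = \<Gamma> i j 1 x * J 1 m x + \<Gamma> i j 2 x * J 2 m x
    - (J i 1 x * J j 1 x * \<Gamma>' 1 1 m (\<tau> x) + J i 1 x * J j 2 x * \<Gamma>' 1 2 m (\<tau> x)
      + J i 2 x * J j 1 x * \<Gamma>' 2 1 m (\<tau> x) + J i 2 x * J j 2 x * \<Gamma>' 2 2 m (\<tau> x))"
  using \<Gamma>_law[OF x, of i j m] by (simp add: sum_2 J_def)

lemma pd_compose:
  assumes "f differentiable (at (\<tau> x))"
  shows "pd i (\<lambda>x. f (\<tau> x)) x = J i 1 x * pd 1 f (\<tau> x) + J i 2 x * pd 2 f (\<tau> x)"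
    "(\<lambda>x. f (\<tau> x)) differentiable (at x)"
  using pd_chain[OF assms diff_\<tau>] by (simp_all add: sum_2 J_def)

end

text \<open>Differentiate the Christoffel law in the other direction and antisymmetrise: third
  derivatives of \<open>\<tau>\<close> cancel by \<open>sw\<close>, second derivatives are
  eliminated by \<open>pd_J\<close>. Keeping \<open>J\<close> on both sides avoids the inverse
  Jacobian.\<close>

lemma curv_law:
  assumes x: "x \<in> V"
  shows "curv \<Gamma> 1 2 j 1 x * J 1 m x + curv \<Gamma> 1 2 j 2 x * J 2 m x =
    detJ x * (J j 1 x * curv \<Gamma>' 1 2 1 m (\<tau> x) + J j 2 x * curv \<Gamma>' 1 2 2 m (\<tau> x))"
proof -
  note xS = xS[OF x] and yS = \<tau>S'[OF x]
  note d = diff_J[OF x] pd_compose(2)[OF x B.diff_\<Gamma>[OF yS]] A.diff_\<Gamma>[OF xS]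
  have L: "(\<lambda>x. \<Gamma> i j 1 x * J 1 m x + \<Gamma> i j 2 x * J 2 m x) y =
    (\<lambda>x. J i 1 x * J j 1 x * \<Gamma>' 1 1 m (\<tau> x) + J i 1 x * J j 2 x * \<Gamma>' 1 2 m (\<tau> x)
      + J i 2 x * J j 1 x * \<Gamma>' 2 1 m (\<tau> x) + J i 2 x * J j 2 x * \<Gamma>' 2 2 m (\<tau> x) + pd i (J j m) x) y" if "y \<in> V" for i y
    using pd_J[OF that, of i j m] by simp
  have dd: "pd i (J j m) differentiable (at x)" for i j
    by (rule Ck_on_differentiable[OF Ck_on_pd[OF Ck_J] open_V x])
  have sw: "pd 1 (pd 2 (J j m)) x = pd 2 (pd 1 (J j m)) x"
    by (rule pd_commute[OF open_V x Ck_J])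
  have L': "pd l (\<lambda>x. \<Gamma> i j 1 x * J 1 m x + \<Gamma> i j 2 x * J 2 m x) x =
    pd l (\<lambda>x. J i 1 x * J j 1 x * \<Gamma>' 1 1 m (\<tau> x) + J i 1 x * J j 2 x * \<Gamma>' 1 2 m (\<tau> x)
      + J i 2 x * J j 1 x * \<Gamma>' 2 1 m (\<tau> x) + J i 2 x * J j 2 x * \<Gamma>' 2 2 m (\<tau> x) + pd i (J j m) x) x" for i l
    by (rule pd_cong[OF open_V x L])
  have eq: "pd l (\<Gamma> i j 1) x * J 1 m x + \<Gamma> i j 1 x * pd l (J 1 m) x + pd l (\<Gamma> i j 2) x * J 2 m x + \<Gamma> i j 2 x * pd l (J 2 m) x
    = (\<Sum>a\<in>UNIV. \<Sum>b\<in>UNIV. (pd l (J i a) x * J j b x + J i a x * pd l (J j b) x) * \<Gamma>' a b m (\<tau> x)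
        + J i a x * J j b x * (J l 1 x * pd 1 (\<Gamma>' a b m) (\<tau> x) + J l 2 x * pd 2 (\<Gamma>' a b m) (\<tau> x))) + pd l (pd i (J j m)) x" for i l
    using L'[of l i]
    by (simp add: pd_simps d dd differentiable_mult differentiable_add pd_compose(1)[OF x B.diff_\<Gamma>[OF yS]] sum_2)
  have s: "\<Gamma> 2 1 k x = \<Gamma> 1 2 k x" "\<Gamma>' 2 1 k (\<tau> x) = \<Gamma>' 1 2 k (\<tau> x)" for k
    using A.\<Gamma>_sym[OF xS] B.\<Gamma>_sym[OF yS] by blast+
  have s': "pd l (\<Gamma>' 2 1 k) (\<tau> x) = pd l (\<Gamma>' 1 2 k) (\<tau> x)" for l k
    by (rule pd_cong[OF B.open_S yS], rule B.\<Gamma>_sym)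
  show ?thesis
    using eq[of 1 2] eq[of 2 1] sw
    unfolding pd_J[OF x] sum_2 curv_def detJ_def s s'
    by (simp only: algebra_simps)
qed

lemma ric_law:
  assumes x: "x \<in> V"
  shows "ric \<Gamma> [i, j] x = J i 1 x * J j 1 x * ric \<Gamma>' [1, 1] (\<tau> x) + J i 1 x * J j 2 x * ric \<Gamma>' [1, 2] (\<tau> x)
    + J i 2 x * J j 1 x * ric \<Gamma>' [2, 1] (\<tau> x) + J i 2 x * J j 2 x * ric \<Gamma>' [2, 2] (\<tau> x)"
proof -
  note law = curv_law[OF x, of j 1, unfolded curv_2] curv_law[OF x, of j 2, unfolded curv_2]
  have "detJ x * ric \<Gamma> [i, j] x = detJ x * (J i 1 x * J j 1 x * ric \<Gamma>' [1, 1] (\<tau> x) + J i 1 x * J j 2 x * ric \<Gamma>' [1, 2] (\<tau> x)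
    + J i 2 x * J j 1 x * ric \<Gamma>' [2, 1] (\<tau> x) + J i 2 x * J j 2 x * ric \<Gamma>' [2, 2] (\<tau> x))"
  proof -
    \<comment> \<open>Cramer's rule: this combination of the laws for m = 2 and m = 1 isolates one
      Ricci component and frees it from the contravariant index.\<close>
    have "detJ x * ric \<Gamma> [i, j] x = J i 2 x * (ric \<Gamma> [2, j] x * J 1 1 x + - ric \<Gamma> [1, j] x * J 2 1 x)
      - J i 1 x * (ric \<Gamma> [2, j] x * J 1 2 x + - ric \<Gamma> [1, j] x * J 2 2 x)"
      using exhaust_2[of i] by (auto simp: detJ_def algebra_simps simp del: ric.simps)
    then show ?thesis
      unfolding law by (simp add: algebra_simps del: ric.simps)
  qed
  then show ?thesis using detJ_nz[OF x] by simp
qed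

text \<open>\<open>curl_ric\<close> is the covariant exterior derivative of Ricci, read as a
  covector-valued 1-form: the 2-form part contributes \<open>detJ\<close>, the index
  \<open>j\<close> transforms as a covector.\<close>

lemma curl_ric_law:
  assumes x: "x \<in> V"
  shows "curl_ric \<Gamma> j x = detJ x * (J j 1 x * curl_ric \<Gamma>' 1 (\<tau> x) + J j 2 x * curl_ric \<Gamma>' 2 (\<tau> x))"
proof -
  note xS = xS[OF x] and yS = \<tau>S'[OF x]
  note d = diff_J[OF x] pd_compose(2)[OF x B.diff_ric[OF yS]] A.diff_ric[OF xS]
  have eq: "pd l (ric \<Gamma> [i, j]) x
    = (\<Sum>a\<in>UNIV. \<Sum>b\<in>UNIV. (pd l (J i a) x * J j b x + J i a x * pd l (J j b) x) * ric \<Gamma>' [a, b] (\<tau> x)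
        + J i a x * J j b x * (J l 1 x * pd 1 (ric \<Gamma>' [a, b]) (\<tau> x) + J l 2 x * pd 2 (ric \<Gamma>' [a, b]) (\<tau> x)))" for i l
  proof -
    have "pd l (ric \<Gamma> [i, j]) x = pd l (\<lambda>x. J i 1 x * J j 1 x * ric \<Gamma>' [1, 1] (\<tau> x) + J i 1 x * J j 2 x * ric \<Gamma>' [1, 2] (\<tau> x)
      + J i 2 x * J j 1 x * ric \<Gamma>' [2, 1] (\<tau> x) + J i 2 x * J j 2 x * ric \<Gamma>' [2, 2] (\<tau> x)) x"
      by (rule pd_cong[OF open_V x], erule ric_law)
    then show ?thesis
      by (simp add: pd_simps d differentiable_mult differentiable_add pd_compose(1)[OF x B.diff_ric[OF yS]] sum_2 del: ric.simps)
  qed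
  have s: "\<Gamma> 2 1 k x = \<Gamma> 1 2 k x" "\<Gamma>' 2 1 k (\<tau> x) = \<Gamma>' 1 2 k (\<tau> x)" for k
    using A.\<Gamma>_sym[OF xS] B.\<Gamma>_sym[OF yS] by blast+
  show ?thesis
    using exhaust_2[of j]
    unfolding curl_ric_def sum_2 eq ric_law[OF x] pd_J[OF x] detJ_def s
    by (auto simp only: s algebra_simps)
qed

lemma rho_law:
  assumes x: "x \<in> V"
  shows "rho w \<Gamma> j x = J j 1 x * rho w' \<Gamma>' 1 (\<tau> x) + J j 2 x * rho w' \<Gamma>' 2 (\<tau> x)"
  using detJ_nz[OF x] B.w_nz[OF \<tau>S'[OF x]]
  unfolding rho_def curl_ric_law[OF x] w_eq[OF x] by (simp add: field_simps)

text \<open>The exterior derivative of the covector \<open>rho\<close> gains the factor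
  \<open>detJ\<close>, since \<open>pd_J_sym\<close> removes the second derivatives of
  \<open>\<tau>\<close>; the same factor in \<open>w\<close> cancels it.\<close>

lemma K_scal_law:
  assumes x: "x \<in> V"
  shows "K_scal w \<Gamma> x = K_scal w' \<Gamma>' (\<tau> x)"
proof -
  note xS = xS[OF x] and yS = \<tau>S'[OF x]
  note d = diff_J[OF x] pd_compose(2)[OF x B.diff_rho[OF yS]] A.diff_rho[OF xS]
  have eq: "pd l (rho w \<Gamma> j) x = pd l (J j 1) x * rho w' \<Gamma>' 1 (\<tau> x) + pd l (J j 2) x * rho w' \<Gamma>' 2 (\<tau> x)
      + J j 1 x * (J l 1 x * pd 1 (rho w' \<Gamma>' 1) (\<tau> x) + J l 2 x * pd 2 (rho w' \<Gamma>' 1) (\<tau> x))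
      + J j 2 x * (J l 1 x * pd 1 (rho w' \<Gamma>' 2) (\<tau> x) + J l 2 x * pd 2 (rho w' \<Gamma>' 2) (\<tau> x))" for l j
  proof -
    have "pd l (rho w \<Gamma> j) x = pd l (\<lambda>x. J j 1 x * rho w' \<Gamma>' 1 (\<tau> x) + J j 2 x * rho w' \<Gamma>' 2 (\<tau> x)) x"
      by (rule pd_cong[OF open_V x], erule rho_law)
    then show ?thesis
      by (simp add: pd_simps d differentiable_mult pd_compose(1)[OF x B.diff_rho[OF yS]])
  qed
  have "pd 1 (rho w \<Gamma> 2) x - pd 2 (rho w \<Gamma> 1) x
      = detJ x * (pd 1 (rho w' \<Gamma>' 2) (\<tau> x) - pd 2 (rho w' \<Gamma>' 1) (\<tau> x))"
    unfolding eq pd_J_sym[OF x, of 2 1] detJ_def by (simp add: algebra_simps)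
  then show ?thesis
    using detJ_nz[OF x] unfolding K_scal_def w_eq[OF x] by (simp, simp add: diff_divide_distrib)
qed

end

section \<open>Variations of a symplectic connection in a chart\<close>

text \<open>The coefficient of t in the curvature of \<open>\<Gamma> + t \<Psi>\<close>, i.e. the
  covariant exterior derivative of \<open>\<Psi>\<close> as an endomorphism-valued 1-form. The first
  index pair is fixed to 1, 2, which loses nothing by \<open>curv_2\<close>.\<close>

definition lin_curv where
  "lin_curv \<Gamma> \<Psi> j k x = pd 1 (\<Psi> 2 j k) x - pd 2 (\<Psi> 1 j k) x
    + (\<Sum>q\<in>UNIV. \<Gamma> 1 q k x * \<Psi> 2 j q x + \<Psi> 1 q k x * \<Gamma> 2 j q x
        - \<Gamma> 2 q k x * \<Psi> 1 j q x - \<Psi> 2 q k x * \<Gamma> 1 j (q::2) x)"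

definition quad_curv where
  "quad_curv \<Psi> j k x = (\<Sum>q\<in>UNIV. \<Psi> (1::2) q k x * \<Psi> 2 j q x - \<Psi> 2 q k x * \<Psi> 1 j (q::2) x :: real)"

text \<open>Rebuilds Ricci from the curvature with first indices 1, 2, following the signs and upper
  indices in \<open>curv_2\<close>.\<close>

definition ric_of_curv :: "(2 \<Rightarrow> 2 \<Rightarrow> real^2 \<Rightarrow> real) \<Rightarrow> 2 \<Rightarrow> 2 \<Rightarrow> real^2 \<Rightarrow> real" where
  "ric_of_curv F i j x = (if i = 1 then - F j 2 x else F j 1 x)"

text \<open>The Christoffel terms of \<open>curl_ric\<close>, made bilinear in connection and Ricci.
  With \<open>\<Psi>\<close> in the place of the connection it yields the mixed terms of the
  expansion in t.\<close>

definition curl_alg where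
  "curl_alg \<Psi> R j x = (\<Sum>p\<in>UNIV. \<Psi> (2::2) j p x * R 1 p x) - (\<Sum>p\<in>UNIV. \<Psi> 1 j p x * R 2 (p::2) x :: real)"

definition cov_curl where
  "cov_curl \<Gamma> R j x = pd 1 (R 2 j) x - pd 2 (R (1::2) j) x + curl_alg \<Gamma> R j x"

text \<open>K as a function of \<open>curl_ric\<close>. It is linear in \<open>N\<close>, as
  \<open>w\<close> stays fixed along a variation, so the expansion of \<open>curl_ric\<close> in t
  passes directly to K.\<close>

definition K_of_curl_ric :: "(real^2 \<Rightarrow> real) \<Rightarrow> (2 \<Rightarrow> real^2 \<Rightarrow> real) \<Rightarrow> real^2 \<Rightarrow> real" where
  "K_of_curl_ric w N x = - (pd 1 (\<lambda>y. - N 2 y / w y) x - pd 2 (\<lambda>y. - N 1 y / w y) x) / w x"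

definition curl_ric_var1 where
  "curl_ric_var1 \<Gamma> \<Psi> j x = cov_curl \<Gamma> (ric_of_curv (lin_curv \<Gamma> \<Psi>)) j x + curl_alg \<Psi> (\<lambda>i j. ric \<Gamma> [i, j]) j x"

definition curl_ric_var2 where
  "curl_ric_var2 \<Gamma> \<Psi> j x = cov_curl \<Gamma> (ric_of_curv (quad_curv \<Psi>)) j x + curl_alg \<Psi> (ric_of_curv (lin_curv \<Gamma> \<Psi>)) j x"

definition curl_ric_var3 where
  "curl_ric_var3 \<Psi> = curl_alg \<Psi> (ric_of_curv (quad_curv \<Psi>))"

lemma K_of_curl_ric_add_cmult:
  assumes "\<And>j. a j differentiable (at x)" "\<And>j. b j differentiable (at x)"
    "w differentiable (at x)" "w x \<noteq> 0"
  shows "K_of_curl_ric w (\<lambda>j y. a j y + c * b j y) x = K_of_curl_ric w a x + c * K_of_curl_ric w b x"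
  using assms by (simp add: K_of_curl_ric_def pd_simps differentiable_mult field_simps)

lemma K_of_curl_ric_cong:
  assumes "open S" "x \<in> S" "\<And>j y. y \<in> S \<Longrightarrow> a j y = b j y"
  shows "K_of_curl_ric w a x = K_of_curl_ric w b x"
proof -
  have "pd i (\<lambda>y. - a j y / w y) x = pd i (\<lambda>y. - b j y / w y) x" for i j
    by (rule pd_cong[OF assms(1,2)]) (simp add: assms(3))
  then show ?thesis by (simp add: K_of_curl_ric_def)
qed

lemma K_scal_eq_K_of_curl_ric: "K_scal w \<Gamma> = K_of_curl_ric w (curl_ric \<Gamma>)"
  by (simp add: fun_eq_iff K_scal_def K_of_curl_ric_def rho_def[abs_def])

lemma Ck_ric_of_curv:
  "open S \<Longrightarrow> (\<And>j k. Ck_on m S (F j k)) \<Longrightarrow> Ck_on m S (ric_of_curv F i j)"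
  by (cases "i = 1") (auto simp: ric_of_curv_def[abs_def] intro: Ck_on_minus)

text \<open>A totally symmetric \<open>\<Pi>\<close> with its last index raised by the bivector is
  trace-free; this is what keeps the form parallel along the variation.\<close>

locale chart_variation = chart_geometry n S w \<Gamma> for n S w \<Gamma> +
  fixes \<Psi> :: "2 \<Rightarrow> 2 \<Rightarrow> 2 \<Rightarrow> real^2 \<Rightarrow> real"
  assumes \<Psi>_sym: "\<And>x i j k. x \<in> S \<Longrightarrow> \<Psi> i j k x = \<Psi> j i k x"
    and \<Psi>_trace: "\<And>x i. x \<in> S \<Longrightarrow> \<Psi> i 1 1 x + \<Psi> i 2 2 x = 0"
    and Ck_\<Psi>: "\<And>i j k. Ck_on (n + 3) S (\<Psi> i j k)"
begin

lemma chart_geometry_vary: "chart_geometry n S w (\<lambda>i j k x. \<Gamma> i j k x + t * \<Psi> i j k x)"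
proof
  show "pd i w x = (\<Gamma> i 1 1 x + t * \<Psi> i 1 1 x + (\<Gamma> i 2 2 x + t * \<Psi> i 2 2 x)) * w x" if "x \<in> S" for x i
  proof -
    have "\<Psi> i 2 2 x = - \<Psi> i 1 1 x" using \<Psi>_trace[OF that, of i] by simp
    then show ?thesis by (simp add: pd_w[OF that])
  qed
qed (auto simp: open_S w_nz \<Gamma>_sym \<Psi>_sym Ck_w intro!: Ck_intros Ck_\<Gamma> Ck_\<Psi> simp del: Ck_on.simps)

lemma Ck_lower:
  "m \<le> n + 3 \<Longrightarrow> Ck_on m S (\<Gamma> i j k)" "m \<le> n + 3 \<Longrightarrow> Ck_on m S (\<Psi> i j k)"
  "m \<le> n + 2 \<Longrightarrow> Ck_on m S (pd l (\<Gamma> i j k))" "m \<le> n + 2 \<Longrightarrow> Ck_on m S (pd l (\<Psi> i j k))"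
  "m \<le> n + 2 \<Longrightarrow> Ck_on m S (ric \<Gamma> [i, j])"
proof -
  have "n + 3 = Suc (n + 2)" by simp
  then have "Ck_on (n + 2) S (pd l (\<Gamma> i j k))" "Ck_on (n + 2) S (pd l (\<Psi> i j k))"
    using Ck_\<Gamma>[of i j k] Ck_\<Psi>[of i j k] Ck_on_pd by metis+
  then show "m \<le> n + 2 \<Longrightarrow> Ck_on m S (pd l (\<Gamma> i j k))" "m \<le> n + 2 \<Longrightarrow> Ck_on m S (pd l (\<Psi> i j k))"
    using Ck_on_mono by blast+
qed (rule Ck_on_mono, rule Ck_\<Gamma> Ck_\<Psi> Ck_ric, assumption)+

lemma Ck_lin_curv: "m \<le> n + 2 \<Longrightarrow> Ck_on m S (lin_curv \<Gamma> \<Psi> j k)"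
  unfolding lin_curv_def[abs_def] by (intro Ck_intros Ck_lower) auto

lemma Ck_quad_curv: "m \<le> n + 3 \<Longrightarrow> Ck_on m S (quad_curv \<Psi> j k)"
  unfolding quad_curv_def[abs_def] by (intro Ck_intros Ck_lower) auto

lemma Ck_curl_alg:
  assumes "\<And>i j k. Ck_on m S (\<Phi> i j k)" "\<And>i j. Ck_on m S (R i j)"
  shows "Ck_on m S (curl_alg \<Phi> R j)"
  unfolding curl_alg_def[abs_def] by (intro Ck_intros assms)

lemma Ck_cov_curl:
  assumes "m \<le> n + 2" "\<And>i j. Ck_on (Suc m) S (R i j)"
  shows "Ck_on m S (cov_curl \<Gamma> R j)"
  unfolding cov_curl_def[abs_def]
  by (intro Ck_intros Ck_curl_alg Ck_on_pd assms Ck_on_Suc_D[OF assms(2)] Ck_lower) (use assms in auto)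

lemma Ck_curl_ric_var: "Ck_on (n + 1) S (curl_ric_var1 \<Gamma> \<Psi> j)" "Ck_on (n + 1) S (curl_ric_var2 \<Gamma> \<Psi> j)" "Ck_on (n + 1) S (curl_ric_var3 \<Psi> j)"
  unfolding curl_ric_var1_def[abs_def] curl_ric_var2_def[abs_def] curl_ric_var3_def
  by (intro Ck_intros Ck_cov_curl Ck_curl_alg Ck_ric_of_curv Ck_lin_curv Ck_quad_curv Ck_lower; simp)+

lemma curv_vary:
  assumes x: "x \<in> S"
  shows "curv (\<lambda>i j k x. \<Gamma> i j k x + t * \<Psi> i j k x) 1 2 j k x
    = curv \<Gamma> 1 2 j k x + t * lin_curv \<Gamma> \<Psi> j k x + t\<^sup>2 * quad_curv \<Psi> j k x"
proof -
  have "\<Gamma> i j k differentiable (at x)" "\<Psi> i j k differentiable (at x)" for i j k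
    by (rule Ck_on_differentiable[where k = n, OF Ck_lower(1) open_S x]
      Ck_on_differentiable[where k = n, OF Ck_lower(2) open_S x], simp)+
  then show ?thesis
    by (simp add: curv_def lin_curv_def quad_curv_def pd_simps differentiable_mult sum_2 algebra_simps power2_eq_square)
qed

lemma ric_vary:
  assumes x: "x \<in> S"
  shows "ric (\<lambda>i j k x. \<Gamma> i j k x + t * \<Psi> i j k x) [i, j] x
    = ric \<Gamma> [i, j] x + t * ric_of_curv (lin_curv \<Gamma> \<Psi>) i j x + t\<^sup>2 * ric_of_curv (quad_curv \<Psi>) i j x"
  using curv_vary[OF x, unfolded curv_2, of t j 1] curv_vary[OF x, of t j 2] exhaust_2[of i]
  by (auto simp: ric_of_curv_def curv_2 simp del: ric.simps)

lemma curl_ric_vary: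
  assumes x: "x \<in> S"
  shows "curl_ric (\<lambda>i j k x. \<Gamma> i j k x + t * \<Psi> i j k x) j x
    = curl_ric \<Gamma> j x + t * curl_ric_var1 \<Gamma> \<Psi> j x + t\<^sup>2 * curl_ric_var2 \<Gamma> \<Psi> j x + t ^ 3 * curl_ric_var3 \<Psi> j x"
proof -
  let ?\<Gamma> = "\<lambda>i j k x. \<Gamma> i j k x + t * \<Psi> i j k x"
  have d: "ric \<Gamma> [i, j] differentiable (at x)" "ric_of_curv (lin_curv \<Gamma> \<Psi>) i j differentiable (at x)"
    "ric_of_curv (quad_curv \<Psi>) i j differentiable (at x)" for i j
    by (rule diff_ric[OF x],
      (rule Ck_on_differentiable[where k = n, OF Ck_ric_of_curv[OF open_S Ck_lin_curv] open_S x]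
        Ck_on_differentiable[where k = n, OF Ck_ric_of_curv[OF open_S Ck_quad_curv] open_S x], simp)+)
  have "pd l (ric ?\<Gamma> [i, j]) x = pd l (ric \<Gamma> [i, j]) x + t * pd l (ric_of_curv (lin_curv \<Gamma> \<Psi>) i j) x
      + t\<^sup>2 * pd l (ric_of_curv (quad_curv \<Psi>) i j) x" for l i j
  proof -
    have "pd l (ric ?\<Gamma> [i, j]) x = pd l (\<lambda>x. ric \<Gamma> [i, j] x + t * ric_of_curv (lin_curv \<Gamma> \<Psi>) i j x
      + t\<^sup>2 * ric_of_curv (quad_curv \<Psi>) i j x) x"
      by (rule pd_cong[OF open_S x], erule ric_vary)
    then show ?thesis by (simp add: pd_simps d differentiable_mult differentiable_add del: ric.simps)
  qed
  then show ?thesis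
    by (simp add: curl_ric_def curl_ric_var1_def curl_ric_var2_def curl_ric_var3_def cov_curl_def curl_alg_def ric_vary[OF x] sum_2
      algebra_simps power2_eq_square power3_eq_cube del: ric.simps)
qed

text \<open>Degree 3 arises because curvature is quadratic in the connection,
  \<open>curl_ric\<close> multiplies it once more by the connection, and the final step to K is
  linear.\<close>

lemma K_scal_vary:
  assumes x: "x \<in> S"
  shows "K_scal w (\<lambda>i j k x. \<Gamma> i j k x + t * \<Psi> i j k x) x
    = K_scal w \<Gamma> x + t * K_of_curl_ric w (curl_ric_var1 \<Gamma> \<Psi>) x + t\<^sup>2 * K_of_curl_ric w (curl_ric_var2 \<Gamma> \<Psi>) x + t ^ 3 * K_of_curl_ric w (curl_ric_var3 \<Psi>) x"
proof -
  have d: "curl_ric \<Gamma> j differentiable (at x)" "curl_ric_var1 \<Gamma> \<Psi> j differentiable (at x)"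
    "curl_ric_var2 \<Gamma> \<Psi> j differentiable (at x)" "curl_ric_var3 \<Psi> j differentiable (at x)" for j
    using Ck_curl_ric[of j] Ck_curl_ric_var[of j] Ck_on_differentiable[OF _ open_S x, of n] by (simp_all del: Ck_on.simps)
  show ?thesis
    unfolding K_scal_eq_K_of_curl_ric
    by (subst K_of_curl_ric_cong[OF open_S x curl_ric_vary], assumption)
      (simp add: K_of_curl_ric_add_cmult d diff_w[OF x] w_nz[OF x] differentiable_mult differentiable_add)
qed

end

section \<open>Preferred connections in a chart\<close>

text \<open>The constant alternating symbol: the form has the components
  \<open>w x * eps i j\<close>.\<close>

definition eps :: "2 \<Rightarrow> 2 \<Rightarrow> real" where
  "eps i j = (if i = j then 0 else if i = 1 then 1 else - 1)"

lemma eps_simps [simp]: "eps 1 1 = 0" "eps 2 2 = 0" "eps 1 2 = 1" "eps 2 1 = - 1"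
  by (simp_all add: eps_def)

text \<open>The parameter 1 is the regularity at which K can still be differentiated. The factor 1/6
  of the symmetrisation is dropped.\<close>

locale preferred_chart = chart_geometry 1 S w \<Gamma> for S w \<Gamma> +
  assumes preferred: "\<And>x i j k. x \<in> S \<Longrightarrow>
    covd \<Gamma> (ric \<Gamma>) [i, j, k] x + covd \<Gamma> (ric \<Gamma>) [i, k, j] x + covd \<Gamma> (ric \<Gamma>) [j, i, k] x
    + covd \<Gamma> (ric \<Gamma>) [j, k, i] x + covd \<Gamma> (ric \<Gamma>) [k, i, j] x + covd \<Gamma> (ric \<Gamma>) [k, j, i] x = 0"
begin

context fixes x assumes x: "x \<in> S" begin

text \<open>By symmetry of Ricci its covariant derivative has six components. Preferredness removes
  the totally symmetric part, of dimension four, and the two that remain are those of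
  \<open>rho\<close>. The constant comes from
  \<open>w x * rho w \<Gamma> 1 x = - 3 * D 1 1 2\<close> and
  \<open>w x * rho w \<Gamma> 2 x = 3 * D 2 1 2\<close>, where D is the covariant
  derivative.\<close>

lemma pd_ric:
  "pd k (ric \<Gamma> [i, j]) x = (\<Sum>p\<in>UNIV. \<Gamma> k i p x * ric \<Gamma> [p, j] x) + (\<Sum>p\<in>UNIV. \<Gamma> k j p x * ric \<Gamma> [i, p] x)
    - w x / 3 * (eps k i * rho w \<Gamma> j x + eps k j * rho w \<Gamma> i x)"
proof -
  let ?D = "\<lambda>i j k. covd \<Gamma> (ric \<Gamma>) [i, j, k] x"
  have sym: "?D i j k = ?D i k j" for i j k
  proof -
    have "pd i (ric \<Gamma> [j, k]) x = pd i (ric \<Gamma> [k, j]) x"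
      by (rule pd_cong[OF open_S x], erule ric_sym)
    then show ?thesis
      by (simp add: covd_2 ric_sym[OF x, of 2 1] ric_sym[OF x, of _ j] ric_sym[OF x, of _ k] del: covd.simps ric.simps)
  qed
  have rho: "w x * rho w \<Gamma> j x = ?D 2 1 j - ?D 1 2 j" for j
    using w_nz[OF x] \<Gamma>_sym[OF x, of 1 2]
    by (simp add: rho_def curl_ric_def covd_2 sum_2 del: covd.simps ric.simps)
  have p: "?D 1 1 1 = 0" "?D 2 2 2 = 0" "?D 2 1 1 = - 2 * ?D 1 1 2" "?D 1 2 2 = - 2 * ?D 2 1 2"
    using preferred[OF x, of 1 1 1] preferred[OF x, of 2 2 2] preferred[OF x, of 1 1 2] preferred[OF x, of 2 1 2]
      sym[of 1 2 1] sym[of 2 2 1] by linarith+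
  have "?D k i j = - (1/3) * (eps k i * (w x * rho w \<Gamma> j x) + eps k j * (w x * rho w \<Gamma> i x))"
    unfolding rho using exhaust_2[of i] exhaust_2[of j] exhaust_2[of k]
    by (elim disjE; simp only: p sym[of 1 2 1] sym[of 2 2 1] eps_simps; simp del: covd.simps ric.simps)
  then show ?thesis by (simp add: covd_2 algebra_simps del: covd.simps ric.simps)
qed

lemma Ck_lower_geometry:
  "m \<le> 4 \<Longrightarrow> Ck_on m S (\<Gamma> i j k)" "m \<le> 3 \<Longrightarrow> Ck_on m S (ric \<Gamma> [i, j])"
  "m \<le> 2 \<Longrightarrow> Ck_on m S (rho w \<Gamma> i)" "m \<le> 1 \<Longrightarrow> Ck_on m S (K_scal w \<Gamma>)"
  by (rule Ck_on_mono, (rule Ck_\<Gamma> Ck_ric Ck_rho Ck_K_scal), simp)+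

lemma diff_K_scal: "K_scal w \<Gamma> differentiable (at x)"
  by (rule Ck_on_differentiable[where k = 0, OF Ck_lower_geometry(4) open_S x]) simp

lemmas diffs = diff_w[OF x] diff_\<Gamma>[OF x] diff_ric[OF x] diff_rho[OF x] diff_K_scal

text \<open>The definition of curvature, solved for one derivative. As rewrite rules these put
  derivatives of the Christoffel symbols into a normal form in which they cancel when second
  derivatives are commuted.\<close>

lemma pd_\<Gamma>:
  "pd 1 (\<Gamma> 1 2 k) x = pd 2 (\<Gamma> 1 1 k) x + curv \<Gamma> 1 2 1 k x
    - (\<Gamma> 1 1 k x * \<Gamma> 1 2 1 x + \<Gamma> 1 2 k x * \<Gamma> 1 2 2 x - \<Gamma> 1 2 k x * \<Gamma> 1 1 1 x - \<Gamma> 2 2 k x * \<Gamma> 1 1 2 x)"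
  "pd 1 (\<Gamma> 2 2 k) x = pd 2 (\<Gamma> 1 2 k) x + curv \<Gamma> 1 2 2 k x
    - (\<Gamma> 1 1 k x * \<Gamma> 2 2 1 x + \<Gamma> 1 2 k x * \<Gamma> 2 2 2 x - \<Gamma> 1 2 k x * \<Gamma> 1 2 1 x - \<Gamma> 2 2 k x * \<Gamma> 1 2 2 x)"
proof -
  have "pd 1 (\<Gamma> 2 1 k) x = pd 1 (\<Gamma> 1 2 k) x" by (rule pd_cong[OF open_S x], erule \<Gamma>_sym)
  then show "pd 1 (\<Gamma> 1 2 k) x = pd 2 (\<Gamma> 1 1 k) x + curv \<Gamma> 1 2 1 k x
      - (\<Gamma> 1 1 k x * \<Gamma> 1 2 1 x + \<Gamma> 1 2 k x * \<Gamma> 1 2 2 x - \<Gamma> 1 2 k x * \<Gamma> 1 1 1 x - \<Gamma> 2 2 k x * \<Gamma> 1 1 2 x)"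
    "pd 1 (\<Gamma> 2 2 k) x = pd 2 (\<Gamma> 1 2 k) x + curv \<Gamma> 1 2 2 k x
    - (\<Gamma> 1 1 k x * \<Gamma> 2 2 1 x + \<Gamma> 1 2 k x * \<Gamma> 2 2 2 x - \<Gamma> 1 2 k x * \<Gamma> 1 2 1 x - \<Gamma> 2 2 k x * \<Gamma> 1 2 2 x)"
    by (simp_all add: curv_def sum_2 \<Gamma>_sym[OF x, of 2 1])
qed

end

text \<open>Equality of mixed partials of the three Ricci components, with first derivatives
  replaced by \<open>pd_ric\<close>, kills the three components of the symmetrised covariant
  derivative of \<open>rho\<close>. The antisymmetric part is K by definition.\<close>

lemma pd_rho:
  assumes x: "x \<in> S"
  shows "pd i (rho w \<Gamma> j) x = (\<Sum>p\<in>UNIV. \<Gamma> i j p x * rho w \<Gamma> p x) - K_scal w \<Gamma> x / 2 * w x * eps i j"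
proof -
  have s: "\<Gamma> 2 1 k y = \<Gamma> 1 2 k y" "ric \<Gamma> [2, 1] y = ric \<Gamma> [1, 2] y" if "y \<in> S" for y k
    using \<Gamma>_sym[OF that] ric_sym[OF that] by blast+
  have sw: "pd 1 (pd 2 (ric \<Gamma> [i, j])) x = pd 2 (pd 1 (ric \<Gamma> [i, j])) x" for i j
    by (rule pd_commute[OF open_S x Ck_lower_geometry(2)[OF x]]) simp
  \<comment> \<open>The closed forms of the first derivatives hold on \<open>S\<close> only, so they
    enter under the second derivative by locality.\<close>
  have 11: "pd l (pd 2 (ric \<Gamma> [1, 1])) x = pd l (\<lambda>y. (\<Gamma> 1 2 1 y * ric \<Gamma> [1, 1] y + \<Gamma> 1 2 2 y * ric \<Gamma> [1, 2] y) * 2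
      + 2 / 3 * (w y * rho w \<Gamma> 1 y)) x"
    "pd l (pd 1 (ric \<Gamma> [1, 1])) x = pd l (\<lambda>y. (\<Gamma> 1 1 1 y * ric \<Gamma> [1, 1] y + \<Gamma> 1 1 2 y * ric \<Gamma> [1, 2] y) * 2) x" for l
    by (rule pd_cong[OF open_S x], simp add: pd_ric sum_2 s del: ric.simps)+
  have 22: "pd l (pd 2 (ric \<Gamma> [2, 2])) x = pd l (\<lambda>y. (\<Gamma> 2 2 1 y * ric \<Gamma> [1, 2] y + \<Gamma> 2 2 2 y * ric \<Gamma> [2, 2] y) * 2) x"
    "pd l (pd 1 (ric \<Gamma> [2, 2])) x = pd l (\<lambda>y. (\<Gamma> 1 2 1 y * ric \<Gamma> [1, 2] y + \<Gamma> 1 2 2 y * ric \<Gamma> [2, 2] y) * 2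
      - 2 / 3 * (w y * rho w \<Gamma> 2 y)) x" for l
    by (rule pd_cong[OF open_S x], simp add: pd_ric sum_2 s del: ric.simps)+
  have 12: "pd l (pd 2 (ric \<Gamma> [1, 2])) x = pd l (\<lambda>y. \<Gamma> 1 2 1 y * ric \<Gamma> [1, 2] y + \<Gamma> 1 2 2 y * ric \<Gamma> [2, 2] y
      + \<Gamma> 2 2 1 y * ric \<Gamma> [1, 1] y + \<Gamma> 2 2 2 y * ric \<Gamma> [1, 2] y + 1 / 3 * (w y * rho w \<Gamma> 2 y)) x"
    "pd l (pd 1 (ric \<Gamma> [1, 2])) x = pd l (\<lambda>y. \<Gamma> 1 1 1 y * ric \<Gamma> [1, 2] y + \<Gamma> 1 1 2 y * ric \<Gamma> [2, 2] y
      + \<Gamma> 1 2 1 y * ric \<Gamma> [1, 1] y + \<Gamma> 1 2 2 y * ric \<Gamma> [1, 2] y - 1 / 3 * (w y * rho w \<Gamma> 1 y)) x" for l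
    by (rule pd_cong[OF open_S x], simp add: pd_ric sum_2 s del: ric.simps)+
  note d = diffs[OF x] differentiable_mult differentiable_add differentiable_diff
  note t = pd_simps pd_\<Gamma>[OF x] pd_w[OF x] pd_ric[OF x] sum_2 curv_2 s[OF x]
  have "w x * pd 1 (rho w \<Gamma> 1) x - (w x * \<Gamma> 1 1 1 x * rho w \<Gamma> 1 x + w x * \<Gamma> 1 1 2 x * rho w \<Gamma> 2 x) = 0"
    using sw[of 1 1] unfolding 11 by (simp add: t d del: ric.simps) (simp add: algebra_simps del: ric.simps, linarith?)
  then have r11: "pd 1 (rho w \<Gamma> 1) x = \<Gamma> 1 1 1 x * rho w \<Gamma> 1 x + \<Gamma> 1 1 2 x * rho w \<Gamma> 2 x"
    using w_nz[OF x] by (simp add: mult.assoc flip: distrib_left)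
  have "w x * pd 2 (rho w \<Gamma> 2) x - (w x * \<Gamma> 2 2 1 x * rho w \<Gamma> 1 x + w x * \<Gamma> 2 2 2 x * rho w \<Gamma> 2 x) = 0"
    using sw[of 2 2] unfolding 22 by (simp add: t d del: ric.simps) (simp add: algebra_simps del: ric.simps, linarith?)
  then have r22: "pd 2 (rho w \<Gamma> 2) x = \<Gamma> 2 2 1 x * rho w \<Gamma> 1 x + \<Gamma> 2 2 2 x * rho w \<Gamma> 2 x"
    using w_nz[OF x] by (simp add: mult.assoc flip: distrib_left)
  have "w x * pd 1 (rho w \<Gamma> 2) x + w x * pd 2 (rho w \<Gamma> 1) x
      - 2 * (w x * \<Gamma> 1 2 1 x * rho w \<Gamma> 1 x + w x * \<Gamma> 1 2 2 x * rho w \<Gamma> 2 x) = 0"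
    using sw[of 1 2] unfolding 12 by (simp add: t d del: ric.simps) (simp add: field_simps del: ric.simps, linarith?)
  then have "pd 1 (rho w \<Gamma> 2) x + pd 2 (rho w \<Gamma> 1) x = 2 * (\<Gamma> 1 2 1 x * rho w \<Gamma> 1 x + \<Gamma> 1 2 2 x * rho w \<Gamma> 2 x)"
    using w_nz[OF x] by (simp add: mult.assoc mult.left_commute[of 2] flip: distrib_left)
  moreover have "pd 1 (rho w \<Gamma> 2) x - pd 2 (rho w \<Gamma> 1) x = - (K_scal w \<Gamma> x * w x)"
    using w_nz[OF x] by (simp add: K_scal_def)
  ultimately show ?thesis
    using exhaust_2[of i] exhaust_2[of j] r11 r22 s[OF x]
    by (auto simp: sum_2)
qed

text \<open>Commuting second derivatives of \<open>rho\<close> leaves the derivative of K on one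
  side and curvature applied to \<open>rho\<close> on the other; curvature is Ricci by
  \<open>curv_2\<close>.\<close>

lemma pd_K_scal:
  assumes x: "x \<in> S"
  shows "pd i (K_scal w \<Gamma>) x = 2 / w x * (ric \<Gamma> [i, 1] x * rho w \<Gamma> 2 x - ric \<Gamma> [i, 2] x * rho w \<Gamma> 1 x)"
proof -
  have s: "\<Gamma> 2 1 k y = \<Gamma> 1 2 k y" "ric \<Gamma> [2, 1] y = ric \<Gamma> [1, 2] y" if "y \<in> S" for y k
    using \<Gamma>_sym[OF that] ric_sym[OF that] by blast+
  have sw: "pd 1 (pd 2 (rho w \<Gamma> j)) x = pd 2 (pd 1 (rho w \<Gamma> j)) x" for j
    by (rule pd_commute[OF open_S x Ck_lower_geometry(3)[OF x]]) simp
  have 1: "pd l (pd 2 (rho w \<Gamma> 1)) x = pd l (\<lambda>y. \<Gamma> 1 2 1 y * rho w \<Gamma> 1 y + \<Gamma> 1 2 2 y * rho w \<Gamma> 2 y + K_scal w \<Gamma> y * w y / 2) x"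
    "pd l (pd 1 (rho w \<Gamma> 1)) x = pd l (\<lambda>y. \<Gamma> 1 1 1 y * rho w \<Gamma> 1 y + \<Gamma> 1 1 2 y * rho w \<Gamma> 2 y) x" for l
    by (rule pd_cong[OF open_S x], simp add: pd_rho sum_2 s)+
  have 2: "pd l (pd 2 (rho w \<Gamma> 2)) x = pd l (\<lambda>y. \<Gamma> 2 2 1 y * rho w \<Gamma> 1 y + \<Gamma> 2 2 2 y * rho w \<Gamma> 2 y) x"
    "pd l (pd 1 (rho w \<Gamma> 2)) x = pd l (\<lambda>y. \<Gamma> 1 2 1 y * rho w \<Gamma> 1 y + \<Gamma> 1 2 2 y * rho w \<Gamma> 2 y - K_scal w \<Gamma> y * w y / 2) x" for l
    by (rule pd_cong[OF open_S x], simp add: pd_rho sum_2 s)+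
  note d = diffs[OF x] differentiable_mult differentiable_add differentiable_diff
  note t = pd_simps pd_\<Gamma>[OF x] pd_w[OF x] pd_rho[OF x] sum_2 curv_2 s[OF x]
  have "w x * pd 1 (K_scal w \<Gamma>) x = 2 * (ric \<Gamma> [1, 1] x * rho w \<Gamma> 2 x - ric \<Gamma> [1, 2] x * rho w \<Gamma> 1 x)"
    using sw[of 1] unfolding 1 by (simp add: t d del: ric.simps) (simp add: field_simps del: ric.simps)
  moreover have "w x * pd 2 (K_scal w \<Gamma>) x = 2 * (ric \<Gamma> [1, 2] x * rho w \<Gamma> 2 x - ric \<Gamma> [2, 2] x * rho w \<Gamma> 1 x)"
    using sw[of 2] unfolding 2 by (simp add: t d del: ric.simps) (simp add: field_simps del: ric.simps)
  ultimately show ?thesis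
    using exhaust_2[of i] s[OF x] w_nz[OF x] by (auto simp: field_simps simp del: ric.simps)
qed

text \<open>
  The Hamiltonian field is $H^i = -\Omega^{ip}\partial_p K$. Preferredness enters through the
  closed forms of $dK$ and of the Hessian of $K$ that are taken as definitions here.
\<close>

definition dK :: "2 \<Rightarrow> real^2 \<Rightarrow> real" where
  "dK i y = 2 * (ric \<Gamma> [i, 1] y * rho w \<Gamma> 2 y - ric \<Gamma> [i, 2] y * rho w \<Gamma> 1 y) / w y"

definition hess :: "2 \<Rightarrow> 2 \<Rightarrow> real^2 \<Rightarrow> real" where
  "hess i j y = 2 / 3 * (rho w \<Gamma> i y * rho w \<Gamma> j y) - K_scal w \<Gamma> y * ric \<Gamma> [i, j] y"

definition ham :: "2 \<Rightarrow> real^2 \<Rightarrow> real" where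
  "ham j y = (if j = 1 then - dK 2 y else dK 1 y) / w y"

definition nabla_ham :: "2 \<Rightarrow> 2 \<Rightarrow> real^2 \<Rightarrow> real" where
  "nabla_ham k j y = (if j = 1 then - hess k 2 y else hess k 1 y) / w y"

lemma Ck_ham: "Ck_on 1 S (dK i)" "Ck_on 1 S (hess i j)" "Ck_on 1 S (ham i)" "Ck_on 1 S (nabla_ham i j)"
proof -
  have 1: "Ck_on 1 S (\<lambda>y. rho w \<Gamma> i y)" "Ck_on 1 S (\<lambda>y. K_scal w \<Gamma> y)" "Ck_on 1 S (\<lambda>y. ric \<Gamma> [i, j] y)" for i j
    by (rule Ck_on_mono[OF Ck_rho] Ck_on_mono[OF Ck_K_scal] Ck_on_mono[OF Ck_ric], simp)+
  show 2: "Ck_on 1 S (dK i)" "Ck_on 1 S (hess i j)" for i j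
    unfolding dK_def[abs_def] hess_def[abs_def] by (intro Ck_intros Ck_on_divide 1 w_nz; assumption)+
  show "Ck_on 1 S (ham i)"
    unfolding ham_def[abs_def] by (cases "i = 1"; simp only: if_True if_False simp_thms; intro Ck_intros Ck_on_divide 2 w_nz; assumption)
  show "Ck_on 1 S (nabla_ham i j)"
    unfolding nabla_ham_def[abs_def] by (cases "j = 1"; simp only: if_True if_False simp_thms; intro Ck_intros Ck_on_divide 2 w_nz; assumption)
qed

context fixes x assumes x: "x \<in> S" begin

lemma diff_ham: "dK i differentiable (at x)" "hess i j differentiable (at x)"
  "ham i differentiable (at x)" "nabla_ham i j differentiable (at x)"
  using Ck_on_differentiable[OF _ open_S x, of 0] Ck_ham by (simp_all del: Ck_on.simps)

text \<open>In \<open>dK\<close>, the derivative of Ricci contributes the square of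
  \<open>rho\<close> with coefficient 2 times 1/3, and the derivative of \<open>rho\<close>
  contributes \<open>- K * ric\<close>; together they are \<open>hess\<close>.\<close>

lemma pd_dK: "pd i (dK j) x = \<Gamma> i j 1 x * dK 1 x + \<Gamma> i j 2 x * dK 2 x + hess i j x"
proof -
  note d = diffs[OF x] differentiable_mult differentiable_add differentiable_diff
  have s: "\<Gamma> 2 1 k x = \<Gamma> 1 2 k x" "ric \<Gamma> [2, 1] x = ric \<Gamma> [1, 2] x" for k
    using \<Gamma>_sym[OF x] ric_sym[OF x] by blast+
  show ?thesis
    unfolding dK_def[abs_def] hess_def
    using exhaust_2[of i] exhaust_2[of j] w_nz[OF x]
    by (auto simp: pd_simps d pd_ric[OF x] pd_rho[OF x] pd_w[OF x] sum_2 s power2_eq_square simp del: ric.simps)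
      (auto simp: field_simps simp del: ric.simps)
qed

text \<open>The terms with K times \<open>rho\<close> from the two summands of \<open>hess\<close>
  cancel, as 2/3 times 1/2 equals 1/3. Only the derivative of the factor K in front of Ricci
  survives.\<close>

lemma pd_hess: "pd l (hess i j) x = \<Gamma> l i 1 x * hess 1 j x + \<Gamma> l i 2 x * hess 2 j x
    + \<Gamma> l j 1 x * hess i 1 x + \<Gamma> l j 2 x * hess i 2 x - dK l x * ric \<Gamma> [i, j] x"
proof -
  note d = diffs[OF x] differentiable_mult differentiable_add differentiable_diff
  have "pd l (K_scal w \<Gamma>) x = dK l x" by (simp add: pd_K_scal[OF x] dK_def del: ric.simps)
  then show ?thesis
    unfolding hess_def[abs_def]
    by (simp add: pd_simps d pd_ric[OF x] pd_rho[OF x] sum_2 del: ric.simps)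
      (simp add: field_simps del: ric.simps)
qed

lemma pd_ham: "pd k (ham j) x = nabla_ham k j x - \<Gamma> k 1 j x * ham 1 x - \<Gamma> k 2 j x * ham 2 x"
  using exhaust_2[of j] w_nz[OF x]
  unfolding ham_def[abs_def] nabla_ham_def
  by (auto simp: pd_simps diff_ham diff_w[OF x] pd_dK pd_w[OF x] power2_eq_square) (auto simp: field_simps)

text \<open>Via \<open>curv_2\<close> the last term is the curvature contracted with H, so this is
  the equation of an infinitesimal affine symmetry. It inherits its shape from
  \<open>pd_hess\<close>, raising an index being parallel.\<close>

lemma pd_nabla_ham: "pd l (nabla_ham k j) x = \<Gamma> l k 1 x * nabla_ham 1 j x + \<Gamma> l k 2 x * nabla_ham 2 j x
    - \<Gamma> l 1 j x * nabla_ham k 1 x - \<Gamma> l 2 j x * nabla_ham k 2 x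
    - dK l x * (if j = 1 then - ric \<Gamma> [k, 2] x else ric \<Gamma> [k, 1] x) / w x"
  using exhaust_2[of j] w_nz[OF x]
  unfolding nabla_ham_def[abs_def]
  by (auto simp: pd_simps diff_ham diff_w[OF x] pd_hess pd_w[OF x] power2_eq_square simp del: ric.simps)
    (auto simp: field_simps simp del: ric.simps)

end

end

locale preferred_variation = preferred_chart S w \<Gamma> + chart_variation 1 S w \<Gamma> \<Psi> for S w \<Gamma> \<Psi>
begin

abbreviation "F \<equiv> lin_curv \<Gamma> \<Psi>"

text \<open>
  The flux arises by moving the derivatives off the variation: first the exterior derivative in $K$
  (leaving $H$), then the one in \<^const>\<open>cov_curl\<close> (leaving $\nabla H$), then the one in
  \<^const>\<open>lin_curv\<close>.
\<close>

definition flux1 :: "real^2 \<Rightarrow> real" where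
  "flux1 y = K_scal w \<Gamma> y * (curl_ric_var1 \<Gamma> \<Psi> 2 y / w y) - (ham 1 y * ric_of_curv F 2 1 y + ham 2 y * ric_of_curv F 2 2 y)
    + (\<Sum>k\<in>UNIV. \<Sum>p\<in>UNIV. nabla_ham k p y * \<Psi> 2 p k y)"

definition flux2 :: "real^2 \<Rightarrow> real" where
  "flux2 y = ham 1 y * ric_of_curv F 1 1 y + ham 2 y * ric_of_curv F 1 2 y - K_scal w \<Gamma> y * (curl_ric_var1 \<Gamma> \<Psi> 1 y / w y)
    - (\<Sum>k\<in>UNIV. \<Sum>p\<in>UNIV. nabla_ham k p y * \<Psi> 1 p k y)"

lemma Ck_flux: "Ck_on 1 S flux1" "Ck_on 1 S flux2"
proof -
  have 1: "Ck_on 1 S (\<lambda>y. curl_ric_var1 \<Gamma> \<Psi> i y)" "Ck_on 1 S (\<lambda>y. ric_of_curv F i j y)" for i j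
    by (rule Ck_on_mono[OF Ck_curl_ric_var(1)] Ck_ric_of_curv[OF open_S Ck_lin_curv], simp)+
  have "(1::nat) \<le> 1 + 3" by simp
  note 2 = Ck_K_scal Ck_ham(3,4) Ck_lower(2)[OF this]
  show "Ck_on 1 S flux1" "Ck_on 1 S flux2"
    unfolding flux1_def[abs_def] flux2_def[abs_def]
    by (intro Ck_intros Ck_on_divide 1 2 w_nz; assumption)+
qed

text \<open>Each of the three integrations by parts produces one summand of the flux. The remaining
  zero-order term in \<open>\<Psi>\<close> has the affine symmetry equation of H as its coefficient,
  hence vanishes.\<close>

lemma divergence_flux:
  assumes x: "x \<in> S"
  shows "pd 1 flux1 x + pd 2 flux2 x = w x * (K_scal w \<Gamma> x * K_of_curl_ric w (curl_ric_var1 \<Gamma> \<Psi>) x)"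
proof -
  have dN: "curl_ric_var1 \<Gamma> \<Psi> j differentiable (at x)" "ric_of_curv F i j differentiable (at x)"
    "\<Psi> i j k differentiable (at x)" for i j k
    by (rule Ck_on_differentiable[where k = 1, OF _ open_S x],
      (rule Ck_on_mono[OF Ck_curl_ric_var(1)] Ck_ric_of_curv[OF open_S Ck_lin_curv] Ck_on_mono[OF Ck_\<Psi>], simp?)+)+
  \<comment> \<open>The quotient is kept opaque: its derivatives cancel as a whole against those in
    \<open>K_of_curl_ric\<close>.\<close>
  define M where "M j y = curl_ric_var1 \<Gamma> \<Psi> j y / w y" for j y
  have dNw: "M j differentiable (at x)" for j
    unfolding M_def[abs_def] using dN(1) diff_w[OF x] w_nz[OF x] by (simp add: differentiable_divide)
  note d = diff_K_scal[OF x] dN(2,3) dNw diff_ham[OF x] differentiable_mult differentiable_add differentiable_diff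
  have K: "pd l (K_scal w \<Gamma>) x = dK l x" for l by (simp add: pd_K_scal[OF x] dK_def del: ric.simps)
  have k: "w x * (K_scal w \<Gamma> x * K_of_curl_ric w (curl_ric_var1 \<Gamma> \<Psi>) x)
      = K_scal w \<Gamma> x * (pd 1 (M 2) x - pd 2 (M 1) x)"
    using w_nz[OF x] pd_minus[OF dNw] by (simp add: K_of_curl_ric_def M_def[abs_def])
  have h: "dK 1 x * M 2 x = ham 2 x * curl_ric_var1 \<Gamma> \<Psi> 2 x" "dK 2 x * M 1 x = - (ham 1 x * curl_ric_var1 \<Gamma> \<Psi> 1 x)"
    by (simp_all add: ham_def M_def)
  have s: "\<Psi> 2 1 k x = \<Psi> 1 2 k x" "\<Psi> 1 2 2 x = - \<Psi> 1 1 1 x" "\<Psi> 2 2 2 x = - \<Psi> 1 2 1 x"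
     "\<Gamma> 2 1 k x = \<Gamma> 1 2 k x" "ric \<Gamma> [2, 1] x = ric \<Gamma> [1, 2] x" for k
    using \<Psi>_sym[OF x, of 2 1] \<Psi>_trace[OF x, of 1] \<Psi>_trace[OF x, of 2] \<Gamma>_sym[OF x] ric_sym[OF x] by (auto simp: add_eq_0_iff simp del: ric.simps)
  have "pd 1 flux1 x + pd 2 flux2 x - w x * (K_scal w \<Gamma> x * K_of_curl_ric w (curl_ric_var1 \<Gamma> \<Psi>) x)
    = (ham 1 x * curl_ric_var1 \<Gamma> \<Psi> 1 x + ham 2 x * curl_ric_var1 \<Gamma> \<Psi> 2 x)
      - (pd 1 (ham 1) x * ric_of_curv F 2 1 x + ham 1 x * pd 1 (ric_of_curv F 2 1) x + pd 1 (ham 2) x * ric_of_curv F 2 2 x + ham 2 x * pd 1 (ric_of_curv F 2 2) x)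
      + (pd 2 (ham 1) x * ric_of_curv F 1 1 x + ham 1 x * pd 2 (ric_of_curv F 1 1) x + pd 2 (ham 2) x * ric_of_curv F 1 2 x + ham 2 x * pd 2 (ric_of_curv F 1 2) x)
      + (\<Sum>k\<in>UNIV. \<Sum>p\<in>UNIV. pd 1 (nabla_ham k p) x * \<Psi> 2 p k x + nabla_ham k p x * pd 1 (\<Psi> 2 p k) x
          - pd 2 (nabla_ham k p) x * \<Psi> 1 p k x - nabla_ham k p x * pd 2 (\<Psi> 1 p k) x)"
    unfolding k flux1_def[abs_def] flux2_def[abs_def] M_def[symmetric]
    by (simp add: pd_simps d K sum_2 h) (simp add: algebra_simps)
  \<comment> \<open>Derivatives of the linearised Ricci cancel between H and
    \<open>cov_curl\<close>; the Christoffel terms of \<open>pd_ham\<close> absorb those of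
    \<open>cov_curl\<close>, and the covariant derivative of H remains, paired with
    \<open>F\<close>.\<close>
  also have "\<dots> = (ham 1 x * curl_alg \<Psi> (\<lambda>i j. ric \<Gamma> [i, j]) 1 x + ham 2 x * curl_alg \<Psi> (\<lambda>i j. ric \<Gamma> [i, j]) 2 x)
      - (nabla_ham 1 1 x * F 1 1 x + nabla_ham 1 2 x * F 2 1 x + nabla_ham 2 1 x * F 1 2 x + nabla_ham 2 2 x * F 2 2 x)
      + (\<Sum>k\<in>UNIV. \<Sum>p\<in>UNIV. pd 1 (nabla_ham k p) x * \<Psi> 2 p k x + nabla_ham k p x * pd 1 (\<Psi> 2 p k) x
          - pd 2 (nabla_ham k p) x * \<Psi> 1 p k x - nabla_ham k p x * pd 2 (\<Psi> 1 p k) x)"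
    unfolding curl_ric_var1_def cov_curl_def pd_ham[OF x]
    by (simp add: curl_alg_def sum_2 ric_of_curv_def del: ric.simps) (simp add: algebra_simps del: ric.simps)
  \<comment> \<open>Derivatives of \<open>\<Psi>\<close> cancel those in \<open>lin_curv\<close>.
    The rest is algebraic in \<open>\<Psi>\<close>: by \<open>pd_nabla_ham\<close> the Ricci terms
    cancel \<open>curl_alg\<close>, using symmetry and trace-freeness from \<open>s\<close>.\<close>
  also have "\<dots> = 0"
    unfolding lin_curv_def curl_alg_def sum_2 pd_nabla_ham[OF x] s
    using w_nz[OF x] by (simp add: ham_def s del: ric.simps) (simp add: field_simps del: ric.simps)
  finally show ?thesis by simp
qed

end

section \<open>Integration of divergences\<close>

text \<open>The difference quotients in direction i integrate to zero by translation invariance of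
  the measure and converge dominatedly to the partial derivative.\<close>

lemma integral_pd_UNIV:
  fixes g :: "real^'n::finite \<Rightarrow> real"
  assumes g: "Ck_on 1 UNIV g" and K: "compact K" "\<And>x. x \<notin> K \<Longrightarrow> g x = 0"
  shows "integrable lborel (pd i g)" "integral\<^sup>L lborel (pd i g) = 0"
proof -
  let ?e = "axis i 1 :: real^'n"
  have dg: "g differentiable (at x)" for x
    using Ck_on_differentiable[of 0 UNIV g x] g by simp
  have cg: "continuous_on UNIV g" and cp: "continuous_on UNIV (pd i g)"
    using g by (auto intro: differentiable_imp_continuous_on)
  obtain r where "r > 0" "\<forall>x\<in>K. norm x \<le> r"
    using compact_imp_bounded[OF K(1)] unfolding bounded_pos by blast
  then have r: "r > 0" "K \<subseteq> cball 0 r" by auto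
  have g0: "g x = 0" if "norm x > r" for x
    using K(2) r(2) that by (force simp: mem_cball)
  have p0: "pd i g x = 0" if "norm x > r" for x
  proof -
    have "open {x :: real^'n. r < norm x}" by (intro open_Collect_less continuous_intros)
    then have "pd i g x = pd i (\<lambda>x. 0) x"
      by (rule pd_cong) (use that g0 in auto)
    then show ?thesis by (simp add: pd_const)
  qed
  \<comment> \<open>The margin 1 holds the supports of all difference quotients, whose steps
    \<open>h n\<close> are at most 1.\<close>
  let ?B = "cball (0::real^'n) (r + 1)"
  have "bounded (pd i g ` ?B)"
    by (intro compact_imp_bounded compact_continuous_image continuous_on_subset[OF cp]) auto
  then obtain M where M: "\<And>x. x \<in> ?B \<Longrightarrow> norm (pd i g x) \<le> M"
    unfolding bounded_iff by blast
  have M': "norm (pd i g x) \<le> M" for x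
  proof (cases "x \<in> ?B")
    case False
    have "0 \<le> M" using M[of 0] r norm_ge_zero order_trans by fastforce
    then show ?thesis using False p0[of x] r by (simp add: dist_norm)
  qed (rule M)
  have int_ball: "integrable lborel (\<lambda>x. indicator ?B x *\<^sub>R h x)" if "continuous_on UNIV h" for h :: "real^'n \<Rightarrow> real"
    by (rule borel_integrable_compact[OF compact_cball continuous_on_subset[OF that]]) simp
  have "(\<lambda>x. indicator ?B x *\<^sub>R pd i g x) = pd i g"
    using p0 by (auto simp: fun_eq_iff indicator_def dist_norm not_le)
  then show "integrable lborel (pd i g)" using int_ball[OF cp] by simp
  have "(\<lambda>x. indicator ?B x *\<^sub>R g x) = g"
    using g0 by (auto simp: fun_eq_iff indicator_def dist_norm not_le)
  then have ig: "integrable lborel g" using int_ball[OF cg] by simp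
  have tr: "integrable lborel (\<lambda>x. g (a + x))" "integral\<^sup>L lborel (\<lambda>x. g (a + x)) = integral\<^sup>L lborel g" for a
  proof -
    have m: "(+) a \<in> measurable lborel borel" "g \<in> borel_measurable borel"
      using cg by (auto intro: borel_measurable_continuous_onI)
    show "integrable lborel (\<lambda>x. g (a + x))"
      using integrable_distr_eq[OF m] ig by (simp add: lborel_distr_plus)
    show "integral\<^sup>L lborel (\<lambda>x. g (a + x)) = integral\<^sup>L lborel g"
      using integral_distr[OF m] by (simp add: lborel_distr_plus)
  qed
  define h where "h n = 1 / real (Suc n)" for n
  have h: "h n > 0" "h n \<le> 1" for n by (auto simp: h_def)
  define q where "q n x = (g (h n *\<^sub>R ?e + x) - g x) / h n" for n x
  have q0: "integral\<^sup>L lborel (q n) = 0" for n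
    unfolding q_def[abs_def] using tr ig by simp
  have "(\<lambda>n. integral\<^sup>L lborel (q n)) \<longlonglongrightarrow> integral\<^sup>L lborel (pd i g)"
  proof (rule integral_dominated_convergence[where w = "\<lambda>x. indicator ?B x *\<^sub>R M"])
    show "pd i g \<in> borel_measurable lborel"
      using borel_measurable_continuous_onI[OF cp] by simp
    show "q n \<in> borel_measurable lborel" for n
    proof -
      have "continuous_on UNIV (q n)"
        unfolding q_def[abs_def] using h[of n]
        by (intro continuous_intros continuous_on_compose2[OF cg]) auto
      then show ?thesis using borel_measurable_continuous_onI by simp
    qed
    show "integrable lborel (\<lambda>x. indicator ?B x *\<^sub>R M)"
      by (rule int_ball) (rule continuous_on_const)
    show "AE x in lborel. (\<lambda>n. q n x) \<longlonglongrightarrow> pd i g x"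
    proof (rule AE_I2)
      fix x
      have "((\<lambda>s. g (x + s *\<^sub>R ?e)) has_field_derivative pd i g x) (at 0)"
        using has_field_derivative_along_axis[of g x 0 i] dg by simp
      then have 1: "((\<lambda>s. (g (x + s *\<^sub>R ?e) - g x) / s) \<longlongrightarrow> pd i g x) (at 0)"
        by (simp add: DERIV_def)
      have "h \<longlonglongrightarrow> 0" unfolding h_def[abs_def] using LIMSEQ_Suc[OF lim_1_over_n] by simp
      moreover have "\<forall>n. h n \<noteq> 0" using h(1) less_irrefl by metis
      ultimately have "filterlim h (at 0) sequentially" by (simp add: filterlim_at)
      from filterlim_compose[OF 1 this] show "(\<lambda>n. q n x) \<longlonglongrightarrow> pd i g x"
        by (simp add: q_def add.commute)
    qed
    show "AE x in lborel. norm (q n x) \<le> indicator ?B x *\<^sub>R M" for n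
    proof (rule AE_I2)
      fix x
      have "\<exists>z>0. z < h n \<and> g (x + h n *\<^sub>R ?e) - g (x + 0 *\<^sub>R ?e) = (h n - 0) * pd i g (x + z *\<^sub>R ?e)"
        by (rule MVT2[OF h(1)]) (rule has_field_derivative_along_axis, rule dg)
      then obtain z where z: "q n x = pd i g (x + z *\<^sub>R ?e)"
        using h(1)[of n] by (auto simp: q_def add.commute)
      show "norm (q n x) \<le> indicator ?B x *\<^sub>R M"
      proof (cases "x \<in> ?B")
        case False
        have "norm x \<le> norm (h n *\<^sub>R ?e + x) + norm (h n *\<^sub>R ?e)"
          using norm_triangle_ineq4[of "h n *\<^sub>R ?e + x" "h n *\<^sub>R ?e"] by simp
        then have "norm x > r" "norm (h n *\<^sub>R ?e + x) > r"
          using False h[of n] by (auto simp: dist_norm)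
        then have "q n x = 0" using g0 by (simp add: q_def)
        then show ?thesis using False by simp
      qed (use z M' in simp)
    qed
  qed
  then show "integral\<^sup>L lborel (pd i g) = 0"
    by (simp add: q0 LIMSEQ_const_iff)
qed

text \<open>Extension by zero is C^1 on \<open>S\<close> and on the complement of \<open>K\<close>,
  two open sets that cover the space.\<close>

lemma integral_pd_compact_support:
  fixes f :: "real^'n::finite \<Rightarrow> real"
  assumes S: "open S" and f: "Ck_on 1 S f" and K: "compact K" "K \<subseteq> S" "\<And>x. x \<in> S - K \<Longrightarrow> f x = 0"
  shows "integrable lborel (\<lambda>x. indicator S x * pd i f x)"
    "integral\<^sup>L lborel (\<lambda>x. indicator S x * pd i f x) = 0"
proof -
  define g where "g x = (if x \<in> S then f x else 0)" for x
  have oK: "open (- K)" using K(1) by (simp add: compact_imp_closed open_Compl)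
  have pg: "pd j g x = indicator S x * pd j f x" for j x
  proof (cases "x \<in> S")
    case True
    have "pd j g x = pd j f x" by (rule pd_cong[OF S True]) (simp add: g_def)
    then show ?thesis using True by simp
  next
    case False
    have "pd j g x = pd j (\<lambda>x. 0) x"
      by (rule pd_cong[OF oK]) (use False K in \<open>auto simp: g_def\<close>)
    then show ?thesis using False by (simp add: pd_const)
  qed
  have 1: "Ck_on 1 S g" by (rule Ck_on_cong[OF S _ f]) (simp add: g_def)
  have 2: "Ck_on 1 (- K) g"
    by (rule Ck_on_cong[OF oK _ Ck_on_const[of _ _ 0]]) (use K in \<open>auto simp: g_def\<close>)
  have "UNIV = S \<union> - K" using K by auto
  then have "Ck_on 1 UNIV g"
    using 1 2 continuous_on_open_Un[OF S oK, of "pd _ g"] S oK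
    by (auto simp: differentiable_on_eq_differentiable_at)
  from integral_pd_UNIV[OF this K(1), of i] K(2)
  show "integrable lborel (\<lambda>x. indicator S x * pd i f x)"
    "integral\<^sup>L lborel (\<lambda>x. indicator S x * pd i f x) = 0"
    unfolding pg by (auto simp: g_def K)
qed

section \<open>Cutoff functions\<close>

text \<open>
  Only finitely many derivatives of a variation enter, so truncated powers give sufficiently
  regular cutoffs.
\<close>

lemma has_field_derivative_truncated_power:
  "((\<lambda>s::real. max 0 s ^ (m + 2)) has_field_derivative real (m + 2) * max 0 s ^ (m + 1)) (at s)"
proof -
  consider "s > 0" | "s < 0" | "s = 0" by linarith
  then show ?thesis
  proof cases
    case 1
    have "((\<lambda>s. s ^ (m + 2)) has_field_derivative real (m + 2) * s ^ (m + 1)) (at s)"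
      using DERIV_pow[of "m + 2" s] by simp
    moreover have "((\<lambda>s. s ^ (m + 2)) has_field_derivative D) (at s) \<longleftrightarrow>
        ((\<lambda>s. max 0 s ^ (m + 2)) has_field_derivative D) (at s)" for D
      by (rule has_field_derivative_cong_ev[OF refl _ refl])
        (use 1 in \<open>auto simp: eventually_nhds intro!: exI[of _ "{0<..}"]\<close>)
    ultimately show ?thesis using 1 by simp
  next
    case 2
    have "((\<lambda>s. 0) has_field_derivative 0) (at s)" by simp
    moreover have "((\<lambda>s. 0) has_field_derivative D) (at s) \<longleftrightarrow>
        ((\<lambda>s. max 0 s ^ (m + 2)) has_field_derivative D) (at s)" for D
      by (rule has_field_derivative_cong_ev[OF refl _ refl])
        (use 2 in \<open>auto simp: eventually_nhds intro!: exI[of _ "{..<0}"]\<close>)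
    ultimately show ?thesis using 2 by simp
  next
    case 3
    \<comment> \<open>At the corner the difference quotient is this power, and its exponent is
      positive; this is the reason for \<open>m + 2\<close> in the statement.\<close>
    have "((\<lambda>h. max 0 h ^ (m + 1)) \<longlongrightarrow> max 0 0 ^ (m + 1)) (at (0::real))"
      by (intro tendsto_intros)
    then have "((\<lambda>h. (max 0 (s + h) ^ (m + 2) - max 0 s ^ (m + 2)) / h) \<longlongrightarrow> 0) (at (0::real))"
      by (rule Lim_transform_eventually[OF tendsto_eq_rhs])
        (auto simp: 3 eventually_at_filter max_def)
    then show ?thesis by (simp add: DERIV_def 3)
  qed
qed

lemma Ck_on_truncated_power:
  assumes "open S" "Ck_on k S g"
  shows "Ck_on k S (\<lambda>x. max 0 (g x) ^ (k + 1))"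
  using assms(2)
proof (induction k)
  case 0
  then show ?case by (auto intro!: continuous_intros)
next
  case (Suc k)
  have D: "((\<lambda>x. max 0 (g x) ^ (k + 2)) has_derivative
      (\<lambda>h. real (k + 2) * max 0 (g x) ^ (k + 1) * frechet_derivative g (at x) h)) (at x)" if "x \<in> S" for x
    using has_derivative_compose[OF frechet_derivative_worksD[OF Ck_on_differentiable[OF Suc.prems assms(1) that]]
        has_field_derivative_truncated_power[unfolded has_field_derivative_def]] by simp
  have "Ck_on k S (pd i (\<lambda>x. max 0 (g x) ^ (k + 2)))" for i
  proof (rule Ck_on_cong[OF assms(1)])
    show "real (k + 2) * max 0 (g x) ^ (k + 1) * pd i g x = pd i (\<lambda>x. max 0 (g x) ^ (k + 2)) x" if "x \<in> S" for x
      using pd_eq[OF D[OF that], of i] by (simp add: pd_def)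
    show "Ck_on k S (\<lambda>x. real (k + 2) * max 0 (g x) ^ (k + 1) * pd i g x)"
      by (intro Ck_on_mult Ck_on_const assms(1) Suc.IH Ck_on_Suc_D[OF Suc.prems] Ck_on_pd[OF Suc.prems])
  qed
  moreover have "(\<lambda>x. max 0 (g x) ^ (k + 2)) differentiable_on S"
    using differentiableI[OF D] assms(1) by (simp add: differentiable_on_eq_differentiable_at)
  ultimately show ?case by simp
qed

lemma cutoff_exists:
  fixes a :: "real^'n::finite"
  assumes "r > 0"
  obtains b where "\<And>S. open S \<Longrightarrow> Ck_on k S b" "\<And>x. x \<in> ball a r \<Longrightarrow> b x = 1" "\<And>x. x \<notin> cball a (2 * r) \<Longrightarrow> b x = 0"
proof -
  \<comment> \<open>At least 1 on the ball of radius \<open>r\<close>, and at most 0 from radius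
    \<open>sqrt 2 * r\<close> on, hence outside the ball of radius \<open>2 * r\<close>.\<close>
  define u where "u x = 2 - (norm (x - a))\<^sup>2 / r\<^sup>2" for x :: "real^'n"
  have u: "Ck_on k S u" if "open S" for S
  proof -
    have "u = (\<lambda>x. 2 - (\<Sum>i\<in>UNIV. (x $ i - a $ i) * (x $ i - a $ i)) * (1 / r\<^sup>2))"
      by (simp add: u_def fun_eq_iff power2_norm_eq_inner inner_vec_def)
    moreover have "Ck_on k S (\<lambda>x. 2 - (\<Sum>i\<in>UNIV. (x $ i - a $ i) * (x $ i - a $ i)) * (1 / r\<^sup>2))"
      by (intro Ck_on_diff Ck_on_mult Ck_on_sum Ck_on_const Ck_on_component that)
    ultimately show ?thesis by simp
  qed
  \<comment> \<open>Two truncations: the inner one makes \<open>b\<close> vanish exactly where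
    \<open>u\<close> is nonpositive, the outer one makes it constantly 1 where \<open>u\<close> is
    at least 1.\<close>
  define b where "b x = 1 - max 0 (1 - max 0 (u x) ^ (k + 1)) ^ (k + 1)" for x
  show thesis
  proof
    show "Ck_on k S b" if "open S" for S
      unfolding b_def[abs_def]
      by (intro Ck_on_diff Ck_on_const Ck_on_truncated_power u that)
    show "b x = 1" if "x \<in> ball a r" for x
    proof -
      have "(norm (x - a))\<^sup>2 \<le> r\<^sup>2"
        using that by (intro power_mono) (auto simp: dist_norm norm_minus_commute)
      then have "1 \<le> u x" using assms by (simp add: u_def divide_le_eq)
      then have "1 \<le> max 0 (u x) ^ (k + 1)" by (intro one_le_power) simp
      then show ?thesis by (simp add: b_def)
    qed
    show "b x = 0" if "x \<notin> cball a (2 * r)" for x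
    proof -
      have "(2 * r)\<^sup>2 \<le> (norm (x - a))\<^sup>2"
        using that assms by (intro power_mono) (auto simp: dist_norm norm_minus_commute)
      moreover have "(2 * r)\<^sup>2 = 4 * r\<^sup>2" by (simp add: power_mult_distrib)
      ultimately have "2 * r\<^sup>2 \<le> (norm (x - a))\<^sup>2"
        using zero_le_power2[of r] by linarith
      then have "u x \<le> 0" using assms by (simp add: u_def le_divide_eq)
      then have "max 0 (u x) = 0" by simp
      then show ?thesis by (simp add: b_def)
    qed
  qed
qed

section \<open>Change of variables\<close>

text \<open>The change of variables for absolutely integrable functions is carried over to
  nonnegative integrals: integrability transfers in both directions, so the two sides are either
  finite and equal or both infinite.\<close>

lemma nn_integral_change_of_variables:
  fixes \<tau> :: "real^2 \<Rightarrow> real^2" and g :: "real^2 \<Rightarrow> real"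
  assumes B: "B \<in> sets borel" "\<tau> ` B \<in> sets borel"
    and d: "\<And>x a. x \<in> B \<Longrightarrow> (\<lambda>x. \<tau> x $ a) differentiable (at x)"
    and inj: "inj_on \<tau> B" and g: "\<And>x. g x \<ge> 0"
    and det: "\<And>x. x \<in> B \<Longrightarrow> \<bar>pd 1 (\<lambda>z. \<tau> z $ 1) x * pd 2 (\<lambda>z. \<tau> z $ 2) x
        - pd 1 (\<lambda>z. \<tau> z $ 2) x * pd 2 (\<lambda>z. \<tau> z $ 1) x\<bar> * g (\<tau> x) = h x"
    and h: "\<And>x. h x \<ge> 0"
    and meas: "(\<lambda>x. indicator (\<tau> ` B) x * g x) \<in> borel_measurable borel"
      "(\<lambda>x. indicator B x * h x) \<in> borel_measurable borel"
  shows "(\<integral>\<^sup>+x\<in>\<tau> ` B. ennreal (g x) \<partial>lborel) = (\<integral>\<^sup>+x\<in>B. ennreal (h x) \<partial>lborel)"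
proof -
  define D where "D x = (\<lambda>h :: real^2. \<chi> a. frechet_derivative (\<lambda>x. \<tau> x $ a) (at x) h)" for x
  have D: "(\<tau> has_derivative D x) (at x within B)" if "x \<in> B" for x
  proof -
    have "((\<lambda>x. \<tau> x $ a) has_derivative frechet_derivative (\<lambda>x. \<tau> x $ a) (at x)) (at x)" for a
      by (rule frechet_derivative_worksD[OF d[OF that]])
    then have "(\<tau> has_derivative D x) (at x)"
      unfolding D_def by (subst has_derivative_componentwise_within) (auto simp: Basis_vec_def inner_axis)
    then show ?thesis by (rule has_derivative_at_withinI)
  qed
  have det': "\<bar>det (matrix (D x))\<bar> * g (\<tau> x) = h x" if "x \<in> B" for x
    using det[OF that] by (simp add: det_2 matrix_def D_def pd_def mult.commute)
  have cv: "h absolutely_integrable_on B \<and> integral B h = b \<longleftrightarrow>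
      g absolutely_integrable_on \<tau> ` B \<and> integral (\<tau> ` B) g = b" for b
  proof -
    have "(\<lambda>x. \<bar>det (matrix (D x))\<bar> * g (\<tau> x)) absolutely_integrable_on B \<and> integral B (\<lambda>x. \<bar>det (matrix (D x))\<bar> * g (\<tau> x)) = b
      \<longleftrightarrow> g absolutely_integrable_on \<tau> ` B \<and> integral (\<tau> ` B) g = b"
      \<comment> \<open>The theorem speaks of vector-valued functions; scalars enter as
        \<open>real^1\<close>.\<close>
      using has_absolute_integral_change_of_variables[of B \<tau> D "\<lambda>x. vec (g x) :: real^1" "vec b"] B(1) D inj
      by (simp add: absolutely_integrable_on_1_iff integral_on_1_eq)
    moreover have "(\<lambda>x. \<bar>det (matrix (D x))\<bar> * g (\<tau> x)) absolutely_integrable_on B \<longleftrightarrow> h absolutely_integrable_on B"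
      by (rule set_integrable_cong) (simp_all add: det')
    moreover have "integral B (\<lambda>x. \<bar>det (matrix (D x))\<bar> * g (\<tau> x)) = integral B h"
      by (rule integral_cong) (simp add: det')
    ultimately show ?thesis by simp
  qed
  have val: "(\<integral>\<^sup>+x\<in>A. ennreal (f x) \<partial>lborel) = (if f absolutely_integrable_on A then ennreal (integral A f) else \<infinity>)"
    if f: "\<And>x. f x \<ge> 0" and m: "(\<lambda>x. indicator A x * f x) \<in> borel_measurable borel" for f :: "real^2 \<Rightarrow> real" and A
  proof -
    have eq: "(\<integral>\<^sup>+x\<in>A. ennreal (f x) \<partial>lborel) = (\<integral>\<^sup>+x. ennreal (indicator A x * f x) \<partial>lborel)"
      by (rule nn_integral_cong) (auto simp: indicator_def)
    show ?thesis
    proof (cases "f absolutely_integrable_on A")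
      case True
      then have "(f has_integral integral A f) A"
        using set_lebesgue_integral_eq_integral(1) by blast
      then show ?thesis
        using nn_integral_has_integral_lebesgue[of A f] f eq True by simp
    next
      case False
      have "\<not> (\<integral>\<^sup>+x. ennreal (indicator A x * f x) \<partial>lborel) < \<infinity>"
      proof
        assume "(\<integral>\<^sup>+x. ennreal (indicator A x * f x) \<partial>lborel) < \<infinity>"
        then have "(\<lambda>x. indicator A x * f x) integrable_on UNIV"
          using m f by (intro nn_integral_integrable_on) auto
        moreover have "(\<lambda>x. indicator A x * f x) = (\<lambda>x. if x \<in> A then f x else 0)"
          by (auto simp: fun_eq_iff)
        ultimately have "f integrable_on A" by (simp add: integrable_restrict_UNIV)
        then show False using False absolutely_integrable_on_iff_nonneg[of A f] f by blast
      qed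
      then show ?thesis using False eq by (simp add: not_less top_unique)
    qed
  qed
  show ?thesis
    unfolding val[OF g meas(1)] val[OF h meas(2)] using cv by metis
qed

section \<open>The symplectic measure\<close>

text \<open>Tonelli for sums, with the outer sum read as an integral over counting measure.\<close>

lemma suminf_commute_ennreal:
  fixes f :: "nat \<Rightarrow> nat \<Rightarrow> ennreal"
  shows "(\<Sum>i. \<Sum>j. f i j) = (\<Sum>j. \<Sum>i. f i j)"
proof -
  have "(\<integral>\<^sup>+i. (\<Sum>j. f i j) \<partial>count_space UNIV) = (\<Sum>j. \<integral>\<^sup>+i. f i j \<partial>count_space UNIV)"
    by (rule nn_integral_suminf) simp
  then show ?thesis by (simp add: nn_integral_count_space_nat)
qed

lemma sum_measure_exists:
  fixes M :: "nat \<Rightarrow> 'a measure"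
  assumes "\<And>n. sets (M n) = sets N"
  obtains \<mu> where "sets \<mu> = sets N" "\<And>B. B \<in> sets N \<Longrightarrow> emeasure \<mu> B = (\<Sum>n. emeasure (M n) B)"
proof -
  define m where "m B = (\<Sum>n. emeasure (M n) B)" for B
  define \<mu> where "\<mu> = measure_of (space N) (sets N) m"
  have s: "sets \<mu> = sets N" by (simp add: \<mu>_def)
  have "emeasure \<mu> B = m B" if "B \<in> sets N" for B
  proof (rule emeasure_measure_of[OF \<mu>_def sets.space_closed])
    show "positive (sets \<mu>) m" by (simp add: positive_def m_def)
    show "countably_additive (sets \<mu>) m"
    proof (rule countably_additiveI)
      fix B :: "nat \<Rightarrow> 'a set"
      assume B: "range B \<subseteq> sets \<mu>" "disjoint_family B"
      have "(\<Sum>i. emeasure (M n) (B i)) = emeasure (M n) (\<Union> (range B))" for n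
        by (rule suminf_emeasure) (use B s assms in auto)
      then show "(\<Sum>i. m (B i)) = m (\<Union> (range B))"
        unfolding m_def by (subst suminf_commute_ennreal) simp
    qed
    show "B \<in> sets \<mu>" using that s by simp
  qed
  then show ?thesis using that s m_def by auto
qed

locale surface =
  fixes X :: "'a topology" and A :: "('a, 2) chart set" and \<omega> :: "('a, 2) tensor"
  assumes symp: "symplectic_manifold X A \<omega>"
begin

section \<open>Charts as homeomorphisms and the Borel structure of the surface\<close>

abbreviation img :: "('a, 2) chart \<Rightarrow> (real^2) set" where "img c \<equiv> snd c ` fst c"

abbreviation par :: "('a, 2) chart \<Rightarrow> real^2 \<Rightarrow> 'a" where "par c \<equiv> inv_into (fst c) (snd c)"

abbreviation borelX :: "'a measure" where "borelX \<equiv> sigma (topspace X) {U. openin X U}"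

lemma Hausdorff: "Hausdorff_space X" and second_countable: "second_countable X"
  and cover: "(\<Union>c\<in>A. fst c) = topspace X"
  using symp by (auto simp: symplectic_manifold_def smooth_manifold_def)

lemma sets_borelX: "sets borelX = sigma_sets (topspace X) {U. openin X U}"
  and space_borelX: "space borelX = topspace X"
  by (auto intro!: sets_measure_of space_measure_of dest: openin_subset)

lemma openin_borelX: "openin X U \<Longrightarrow> U \<in> sets borelX"
  by (simp add: sets_borelX)

lemma closedin_borelX: "closedin X U \<Longrightarrow> U \<in> sets borelX"
proof -
  assume U: "closedin X U"
  then have "topspace X - (topspace X - U) \<in> sets borelX"
    using openin_borelX[of "topspace X - U"] sets.compl_sets[of "topspace X - U" borelX] by (simp add: space_borelX openin_diff)
  moreover have "topspace X - (topspace X - U) = U" using closedin_subset[OF U] by blast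
  ultimately show ?thesis by simp
qed

context fixes c assumes c: "c \<in> A" begin

lemma chart: "openin X (fst c)" "open (img c)"
  "homeomorphic_map (subtopology X (fst c)) (top_of_set (img c)) (snd c)"
  using symp c by (auto simp: symplectic_manifold_def smooth_manifold_def is_chart_def)

lemma top_sub: "topspace (subtopology X (fst c)) = fst c"
  using openin_subset[OF chart(1)] by (simp add: topspace_subtopology Int_absorb1)

lemma inj_chart: "inj_on (snd c) (fst c)"
  using homeomorphic_imp_injective_map[OF chart(3)] unfolding top_sub .

lemma par_chart: "p \<in> fst c \<Longrightarrow> par c (snd c p) = p"
  using inj_chart by simp

lemma chart_par: "x \<in> img c \<Longrightarrow> snd c (par c x) = x"
  by (rule f_inv_into_f)

lemma par_in: "x \<in> img c \<Longrightarrow> par c x \<in> fst c"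
  by (rule inv_into_into)

lemma open_chart_image:
  assumes "V \<subseteq> fst c"
  shows "open (snd c ` V) \<longleftrightarrow> openin X V"
proof -
  have "openin (top_of_set (img c)) (snd c ` V) \<longleftrightarrow> openin (subtopology X (fst c)) V"
    by (rule homeomorphic_map_openness[OF chart(3)], unfold top_sub, rule assms)
  moreover have "openin (top_of_set (img c)) (snd c ` V) \<longleftrightarrow> open (snd c ` V)"
    using assms chart(2) by (auto simp: openin_open_eq)
  moreover have "openin (subtopology X (fst c)) V \<longleftrightarrow> openin X V"
    using assms chart(1) by (simp add: openin_open_subtopology)
  ultimately show ?thesis by simp
qed

lemma chart_image_eq: "B \<subseteq> fst c \<Longrightarrow> snd c ` B = par c -` B \<inter> img c"
  using par_chart by (auto simp: image_iff)

lemma measurable_par: "par c \<in> measurable (restrict_space lborel (img c)) borelX"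
proof (rule measurable_measure_of)
  show "{U. openin X U} \<subseteq> Pow (topspace X)" by (auto dest: openin_subset)
  show "par c \<in> space (restrict_space lborel (img c)) \<rightarrow> topspace X"
    using par_in openin_subset[OF chart(1)] by (auto simp: space_restrict_space)
  fix U assume "U \<in> {U. openin X U}"
  then have "openin X (U \<inter> fst c)" using chart(1) by (simp add: openin_Int)
  then have "open (snd c ` (U \<inter> fst c))" by (subst open_chart_image) auto
  moreover have "par c -` U \<inter> img c = snd c ` (U \<inter> fst c)"
    using par_in by (subst chart_image_eq) auto
  ultimately show "par c -` U \<inter> space (restrict_space lborel (img c)) \<in> sets (restrict_space lborel (img c))"
    using chart(2) by (auto simp: space_restrict_space sets_restrict_space_iff)
qed

lemma borel_chart_image:
  assumes "B \<in> sets borelX" "B \<subseteq> fst c"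
  shows "snd c ` B \<in> sets borel"
  using measurable_sets[OF measurable_par assms(1)] chart(2)
  by (simp add: chart_image_eq[OF assms(2)] space_restrict_space sets_restrict_space_iff)

lemma smooth_\<omega>: "Ck_on k (img c) (\<omega> c [i, j])"
  using symp c by (auto simp: symplectic_manifold_def tensor_field_def smooth_on_def)

lemma \<omega>_antisym: "x \<in> img c \<Longrightarrow> \<omega> c [i, j] x = - \<omega> c [j, i] x"
  using symp c unfolding symplectic_manifold_def by blast

lemma \<omega>_diag: "x \<in> img c \<Longrightarrow> \<omega> c [i, i] x = 0"
  using \<omega>_antisym[of x i i] by simp

lemma \<omega>_nz: "x \<in> img c \<Longrightarrow> \<omega> c [1, 2] x \<noteq> 0"
proof
  assume x: "x \<in> img c" and z: "\<omega> c [1, 2] x = 0"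
  then have "\<omega> c [2, 1] x = 0" using \<omega>_antisym[OF x, of 2 1] by simp
  then have "\<omega> c [i, j] x = 0" for i j
    using z \<omega>_diag[OF x] exhaust_2[of i] exhaust_2[of j] by auto
  then have "(\<chi> i j. \<omega> c [i, j] x) = (0 :: real^2^2)" by (simp add: vec_eq_iff)
  moreover have "invertible (\<chi> i j. \<omega> c [i, j] x)"
    using symp c x unfolding symplectic_manifold_def by blast
  ultimately show False by (simp add: invertible_det_nz det_2)
qed

lemma borel_w: "B \<in> sets borel \<Longrightarrow> B \<subseteq> img c \<Longrightarrow> (\<lambda>x. indicator B x * \<bar>\<omega> c [1, 2] x\<bar>) \<in> borel_measurable borel"
proof -
  assume B: "B \<in> sets borel" "B \<subseteq> img c"
  have "continuous_on B (\<lambda>x. \<bar>\<omega> c [1, 2] x\<bar>)"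
    by (intro continuous_on_rabs continuous_on_subset[OF Ck_on_imp_continuous_on[OF smooth_\<omega>[of 0]]] B)
  then show ?thesis using borel_measurable_continuous_on_indicator[OF B(1)] by fastforce
qed

lemma borel_w_restrict: "(\<lambda>x. \<bar>\<omega> c [1, 2] x\<bar>) \<in> borel_measurable (restrict_space lborel (img c))"
  using borel_w[of "img c"] chart(2)
  by (subst borel_measurable_restrict_space_iff) auto

text \<open>The density of the form, pushed forward to the surface. Restricting to
  \<open>img c\<close> first is essential, as \<open>par c\<close> is an arbitrary choice outside
  it.\<close>

definition chart_measure :: "'a measure" where
  "chart_measure = distr (density (restrict_space lborel (img c)) (\<lambda>x. ennreal \<bar>\<omega> c [1, 2] x\<bar>)) borelX (par c)"

lemma sets_chart_measure: "sets chart_measure = sets borelX"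
  by (simp add: chart_measure_def)

lemma emeasure_chart_measure:
  assumes B: "B \<in> sets borelX"
  shows "emeasure chart_measure B = (\<integral>\<^sup>+x\<in>snd c ` (B \<inter> fst c). ennreal \<bar>\<omega> c [1, 2] x\<bar> \<partial>lborel)"
proof -
  let ?R = "restrict_space lborel (img c)"
  have R: "space ?R = img c" by (simp add: space_restrict_space)
  have m: "par c -` B \<inter> img c \<in> sets ?R"
    using measurable_sets[OF measurable_par B] by (simp add: R)
  have eq: "par c -` B \<inter> img c = snd c ` (B \<inter> fst c)"
    using par_in by (subst chart_image_eq) auto
  have "emeasure chart_measure B = emeasure (density ?R (\<lambda>x. ennreal \<bar>\<omega> c [1, 2] x\<bar>)) (par c -` B \<inter> img c)"
    unfolding chart_measure_def using measurable_par B by (subst emeasure_distr) (simp_all add: R)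
  also have "\<dots> = (\<integral>\<^sup>+x. ennreal \<bar>\<omega> c [1, 2] x\<bar> * indicator (par c -` B \<inter> img c) x \<partial>?R)"
    using borel_w_restrict m by (intro emeasure_density) auto
  also have "\<dots> = (\<integral>\<^sup>+x\<in>snd c ` (B \<inter> fst c). ennreal \<bar>\<omega> c [1, 2] x\<bar> \<partial>lborel)"
    using chart(2) unfolding eq[symmetric]
    by (subst nn_integral_restrict_space) (auto intro!: nn_integral_cong simp: indicator_def)
  finally show ?thesis .
qed

end

section \<open>Compatibility of the chart measures and their gluing\<close>

lemma trans_map_eq:
  assumes "c \<in> A" "p \<in> fst c"
  shows "trans_map c d (snd c p) = snd d p"
  using par_chart[OF assms] by (simp add: trans_map_def)

lemma open_overlap: "c \<in> A \<Longrightarrow> d \<in> A \<Longrightarrow> open (overlap c d)"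
  unfolding overlap_def by (subst open_chart_image) (auto intro: openin_Int chart(1))

lemma Ck_trans_map: "c \<in> A \<Longrightarrow> d \<in> A \<Longrightarrow> Ck_on k (overlap c d) (\<lambda>x. trans_map c d x $ a)"
  using symp by (auto simp: symplectic_manifold_def smooth_manifold_def smooth_on_def)

lemma \<omega>_law:
  assumes "c \<in> A" "d \<in> A" "x \<in> overlap c d"
  shows "\<omega> c [1, 2] x = (jac c d 1 1 x * jac c d 2 2 x - jac c d 1 2 x * jac c d 2 1 x) * \<omega> d [1, 2] (trans_map c d x)"
proof -
  obtain p where "p \<in> fst c" "p \<in> fst d" "x = snd c p"
    using assms(3) by (auto simp: overlap_def)
  then have y: "trans_map c d x \<in> img d"
    using trans_map_eq[OF assms(1)] by simp
  note z = \<omega>_diag[OF assms(2) y] \<omega>_antisym[OF assms(2) y, of 2 1]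
  have "tensor_field A 2 \<omega>" using symp by (simp add: symplectic_manifold_def)
  then have "\<omega> c js x = (\<Sum>ls | length ls = 2.
          (\<Prod>m<2. jac c d (js ! m) (ls ! m) x) * \<omega> d ls (trans_map c d x))" if "length js = 2" for js
    using assms that unfolding tensor_field_def by blast
  from this[of "[1, 2]"] have "\<omega> c [1, 2] x = (\<Sum>ls | length ls = 2.
          (\<Prod>m<2. jac c d ([1, 2] ! m) (ls ! m) x) * \<omega> d ls (trans_map c d x))"
    by simp
  also have "\<dots> = (\<Sum>a\<in>UNIV. \<Sum>b\<in>UNIV. jac c d 1 a x * jac c d 2 b x * \<omega> d [a, b] (trans_map c d x))"
    by (simp only: sum_lists_2) (simp add: numeral_2_eq_2 lessThan_Suc mult_ac)
  finally show ?thesis by (simp add: sum_2 z algebra_simps)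
qed

text \<open>The Jacobian determinant in \<open>\<omega>_law\<close> is the one of the change of
  variables; absolute values make the orientation of the transition map irrelevant.\<close>

lemma chart_measure_unique:
  assumes c: "c \<in> A" and d: "d \<in> A" and B: "B \<in> sets borelX" "B \<subseteq> fst c" "B \<subseteq> fst d"
  shows "(\<integral>\<^sup>+x\<in>snd d ` B. ennreal \<bar>\<omega> d [1, 2] x\<bar> \<partial>lborel) = (\<integral>\<^sup>+x\<in>snd c ` B. ennreal \<bar>\<omega> c [1, 2] x\<bar> \<partial>lborel)"
proof -
  have im: "trans_map c d ` (snd c ` B) = snd d ` B"
    unfolding image_image by (rule image_cong[OF refl trans_map_eq[OF c]]) (use B in blast)
  have sub: "snd c ` B \<subseteq> overlap c d" using B by (auto simp: overlap_def)
  have "(\<integral>\<^sup>+x\<in>trans_map c d ` (snd c ` B). ennreal \<bar>\<omega> d [1, 2] x\<bar> \<partial>lborel) = (\<integral>\<^sup>+x\<in>snd c ` B. ennreal \<bar>\<omega> c [1, 2] x\<bar> \<partial>lborel)"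
  proof (rule nn_integral_change_of_variables[where \<tau> = "trans_map c d" and B = "snd c ` B"
        and g = "\<lambda>x. \<bar>\<omega> d [1, 2] x\<bar>" and h = "\<lambda>x. \<bar>\<omega> c [1, 2] x\<bar>"])
    show "snd c ` B \<in> sets borel" "trans_map c d ` (snd c ` B) \<in> sets borel"
      using borel_chart_image c d B by (simp_all add: im)
    show "(\<lambda>x. trans_map c d x $ a) differentiable (at x)" if "x \<in> snd c ` B" for x a
      using that sub Ck_on_differentiable[OF Ck_trans_map[OF c d] open_overlap[OF c d]] by blast
    show "inj_on (trans_map c d) (snd c ` B)"
    proof (rule inj_onI, clarify)
      fix p q
      assume "p \<in> B" "q \<in> B" "trans_map c d (snd c p) = trans_map c d (snd c q)"
      moreover from this have "p \<in> fst c" "q \<in> fst c" "p \<in> fst d" "q \<in> fst d" using B by auto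
      ultimately show "snd c p = snd c q"
        using trans_map_eq[OF c] inj_onD[OF inj_chart[OF d]] by metis
    qed
    show "\<bar>pd 1 (\<lambda>z. trans_map c d z $ 1) x * pd 2 (\<lambda>z. trans_map c d z $ 2) x
        - pd 1 (\<lambda>z. trans_map c d z $ 2) x * pd 2 (\<lambda>z. trans_map c d z $ 1) x\<bar> * \<bar>\<omega> d [1, 2] (trans_map c d x)\<bar>
        = \<bar>\<omega> c [1, 2] x\<bar>" if "x \<in> snd c ` B" for x
      using \<omega>_law[OF c d, of x] sub that by (auto simp: jac_def abs_mult)
    show "(\<lambda>x. indicator (trans_map c d ` snd c ` B) x * \<bar>\<omega> d [1, 2] x\<bar>) \<in> borel_measurable borel"
      "(\<lambda>x. indicator (snd c ` B) x * \<bar>\<omega> c [1, 2] x\<bar>) \<in> borel_measurable borel"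
      unfolding im by (rule borel_w[OF d borel_chart_image[OF d B(1,3)]] borel_w[OF c borel_chart_image[OF c B(1,2)]],
        use B in blast)+
  qed simp_all
  then show ?thesis by (simp add: im)
qed

text \<open>A countable subcover by charts exists by the Lindelof property and is made disjoint. The
  charts are constrained only for nonempty pieces, so that an empty surface with an empty atlas is
  covered.\<close>

lemma pieces:
  "\<exists>D :: nat \<Rightarrow> 'a set. \<exists>c. (\<forall>n. D n \<in> sets borelX) \<and> disjoint_family D \<and>
    (\<Union>n. D n) = topspace X \<and> (\<forall>n. D n \<noteq> {} \<longrightarrow> c n \<in> A \<and> D n \<subseteq> fst (c n))"
proof -
  have "\<exists>\<V>. countable \<V> \<and> \<V> \<subseteq> fst ` A \<and> \<Union>\<V> = topspace X"
    by (rule Lindelof_spaceD[OF second_countable_imp_Lindelof_space[OF second_countable] _ cover])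
      (erule imageE, simp only: chart(1))
  then obtain \<V> where V: "countable \<V>" "\<V> \<subseteq> fst ` A" "\<Union>\<V> = topspace X" by (elim exE conjE)
  show ?thesis
  proof (cases "\<V> = {}")
    case True
    then have "topspace X = {}" using V(3) by simp
    then show ?thesis by (intro exI[of _ "\<lambda>n. {}"]) (simp add: disjoint_family_on_def)
  next
    case False
    define e where "e = from_nat_into \<V>"
    have e: "range e = \<V>" unfolding e_def using V(1) False by (rule range_from_nat_into[rotated])
    have "\<forall>n. \<exists>c. c \<in> A \<and> fst c = e n" using e V(2) by (metis imageE rangeI subsetD)
    then obtain c where c: "\<And>n. c n \<in> A" "\<And>n. fst (c n) = e n" by metis
    have m: "range e \<subseteq> sets borelX" using c chart(1) openin_borelX by (metis image_subsetI)
    show ?thesis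
    proof (intro exI[of _ "disjointed e"] exI[of _ c] conjI allI impI)
      show "disjointed e n \<in> sets borelX" for n using sets.range_disjointed_sets[OF m] by blast
      show "disjoint_family (disjointed e)" by (rule disjoint_family_disjointed)
      show "(\<Union>n. disjointed e n) = topspace X" using e V(3) by (simp add: UN_disjointed_eq)
      show "c n \<in> A" "disjointed e n \<subseteq> fst (c n)" for n using c disjointed_subset[of e n] by simp_all
    qed
  qed
qed

lemma emeasure_symplectic:
  assumes "is_symplectic_measure X A \<omega> \<mu>" "c \<in> A" "B \<in> sets borelX" "B \<subseteq> fst c"
  shows "emeasure \<mu> B = (\<integral>\<^sup>+x\<in>snd c ` B. ennreal \<bar>\<omega> c [1, 2] x\<bar> \<partial>lborel)"
  using assms unfolding is_symplectic_measure_def sets_borelX by blast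

lemma symplectic_measure_unique:
  assumes "is_symplectic_measure X A \<omega> \<mu>" "is_symplectic_measure X A \<omega> \<nu>"
  shows "\<mu> = \<nu>"
proof (rule measure_eqI)
  have s: "sets \<mu> = sets borelX" "sets \<nu> = sets borelX"
    using assms by (simp_all add: is_symplectic_measure_def sets_borelX)
  then show "sets \<mu> = sets \<nu>" by simp
  fix B assume "B \<in> sets \<mu>"
  then have B: "B \<in> sets borelX" using s by simp
  obtain D :: "nat \<Rightarrow> 'a set" and c where D': "\<forall>n. D n \<in> sets borelX" "disjoint_family D" "(\<Union>n. D n) = topspace X"
    "\<forall>n. D n \<noteq> {} \<longrightarrow> c n \<in> A \<and> D n \<subseteq> fst (c n)" using pieces by (elim exE conjE)
  note D = D'(1)[rule_format] D'(2,3) D'(4)[rule_format]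
  have eq: "emeasure \<mu> (B \<inter> D n) = emeasure \<nu> (B \<inter> D n)" for n
  proof (cases "D n = {}")
    case False
    have "B \<inter> D n \<in> sets borelX" using B D(1) by auto
    moreover have "B \<inter> D n \<subseteq> fst (c n)" "c n \<in> A" using D(4) False by auto
    ultimately show ?thesis
      by (simp only: emeasure_symplectic[OF assms(1)] emeasure_symplectic[OF assms(2)])
  qed simp
  have Bu: "B = (\<Union>n. B \<inter> D n)" using D(3) sets.sets_into_space[OF B] by (auto simp: space_borelX)
  have "emeasure \<kappa> B = (\<Sum>n. emeasure \<kappa> (B \<inter> D n))" if "sets \<kappa> = sets borelX" for \<kappa>
  proof -
    have "(\<Sum>n. emeasure \<kappa> (B \<inter> D n)) = emeasure \<kappa> (\<Union>n. B \<inter> D n)"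
      by (rule suminf_emeasure) (use B D that in \<open>auto simp: disjoint_family_on_def\<close>)
    then show ?thesis using Bu by simp
  qed
  then show "emeasure \<mu> B = emeasure \<nu> B" using s eq by simp
qed

text \<open>Each piece carries the measure of its own chart. In any other chart \<open>d\<close> the
  sum is right because \<open>chart_measure_unique\<close> compares \<open>d\<close> with the chart
  of every piece.\<close>

lemma symplectic_measure_exists: "\<exists>\<mu>. is_symplectic_measure X A \<omega> \<mu>"
proof -
  obtain D :: "nat \<Rightarrow> 'a set" and c where D': "\<forall>n. D n \<in> sets borelX" "disjoint_family D" "(\<Union>n. D n) = topspace X"
    "\<forall>n. D n \<noteq> {} \<longrightarrow> c n \<in> A \<and> D n \<subseteq> fst (c n)" using pieces by (elim exE conjE)
  note D = D'(1)[rule_format] D'(2,3) D'(4)[rule_format]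
  define M where "M n = (if D n = {} then null_measure borelX else density (chart_measure (c n)) (indicator (D n)))" for n
  have M: "sets (M n) = sets borelX" for n
    using sets_chart_measure D(4) by (auto simp: M_def)
  obtain \<mu> where \<mu>: "sets \<mu> = sets borelX" "\<And>B. B \<in> sets borelX \<Longrightarrow> emeasure \<mu> B = (\<Sum>n. emeasure (M n) B)"
    using sum_measure_exists[of M borelX, OF M] by blast
  have "emeasure \<mu> B = (\<integral>\<^sup>+x\<in>snd d ` B. ennreal \<bar>\<omega> d [1, 2] x\<bar> \<partial>lborel)"
    if d: "d \<in> A" and B: "B \<in> sets borelX" "B \<subseteq> fst d" for d B
  proof -
    have Mn: "emeasure (M n) B = emeasure (chart_measure d) (B \<inter> D n)" for n
    proof (cases "D n = {}")
      case False
      then have c: "c n \<in> A" "D n \<subseteq> fst (c n)" using D(4) by auto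
      have BD: "B \<inter> D n \<in> sets borelX" using B D(1) by auto
      have "emeasure (M n) B = emeasure (chart_measure (c n)) (D n \<inter> B)"
        using False B D(1) sets_chart_measure[OF c(1)] by (simp add: M_def emeasure_restricted)
      also have "\<dots> = emeasure (chart_measure d) (B \<inter> D n)"
      proof -
        have i: "D n \<inter> B = B \<inter> D n" "B \<inter> D n \<inter> fst (c n) = B \<inter> D n" "B \<inter> D n \<inter> fst d = B \<inter> D n"
          using B c by auto
        have "B \<inter> D n \<subseteq> fst (c n)" "B \<inter> D n \<subseteq> fst d" using B c by auto
        from chart_measure_unique[OF c(1) d BD this] show ?thesis
          using emeasure_chart_measure[OF c(1) BD] emeasure_chart_measure[OF d BD] by (simp only: i)
      qed
      finally show ?thesis .
    qed (simp add: M_def)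
    have "(\<Sum>n. emeasure (chart_measure d) (B \<inter> D n)) = emeasure (chart_measure d) (\<Union>n. B \<inter> D n)"
    proof (rule suminf_emeasure)
      show "disjoint_family (\<lambda>n. B \<inter> D n)" using D(2) unfolding disjoint_family_on_def by blast
      show "range (\<lambda>n. B \<inter> D n) \<subseteq> sets (chart_measure d)" using B D(1) by (auto simp: sets_chart_measure[OF d])
    qed
    moreover have "(\<Union>n. B \<inter> D n) = B" using D(3) sets.sets_into_space[OF B(1)] by (auto simp: space_borelX)
    ultimately show ?thesis
      using \<mu>(2)[OF B(1)] Mn emeasure_chart_measure[OF d B(1)] B(2) by (simp add: Int_absorb2)
  qed
  moreover have "space \<mu> = topspace X" using sets_eq_imp_space_eq[OF \<mu>(1)] by (simp add: space_borelX)
  ultimately show ?thesis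
    using \<mu>(1) unfolding is_symplectic_measure_def by (auto simp: sets_borelX)
qed

section \<open>Integration against the symplectic measure\<close>

abbreviation "vol \<equiv> symplectic_measure X A \<omega>"

lemma is_symplectic_vol: "is_symplectic_measure X A \<omega> vol"
  unfolding symplectic_measure_def
  using theI'[of "is_symplectic_measure X A \<omega>"] symplectic_measure_exists symplectic_measure_unique by blast

lemma sets_vol: "sets vol = sets borelX" and space_vol: "space vol = topspace X"
  using is_symplectic_vol by (simp_all add: is_symplectic_measure_def sets_borelX)

lemmas emeasure_vol = emeasure_symplectic[OF is_symplectic_vol]

lemma borel_measurable_continuous_map:
  fixes f :: "'a \<Rightarrow> real"
  assumes "continuous_map X euclideanreal f"
  shows "f \<in> borel_measurable vol"
proof (rule borel_measurableI)
  fix S :: "real set" assume "open S"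
  then have "openin X {x \<in> topspace X. f x \<in> S}"
    using openin_continuous_map_preimage[OF assms, of S] open_openin by blast
  then have "{x \<in> topspace X. f x \<in> S} \<in> sets vol" unfolding sets_vol by (rule openin_borelX)
  moreover have "f -` S \<inter> space vol = {x \<in> topspace X. f x \<in> S}" unfolding space_vol by blast
  ultimately show "f -` S \<inter> space vol \<in> sets vol" by simp
qed

lemma integral_vol_chart:
  fixes f :: "'a \<Rightarrow> real"
  assumes c: "c \<in> A" and f: "f \<in> borel_measurable vol" "\<And>p. p \<in> topspace X - fst c \<Longrightarrow> f p = 0"
  shows "integral\<^sup>L vol f = integral\<^sup>L lborel (\<lambda>x. indicator (img c) x * (\<bar>\<omega> c [1, 2] x\<bar> * f (par c x)))"
proof -
  have Uc: "fst c \<in> sets vol" using chart(1)[OF c] openin_borelX sets_vol by simp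
  have "density vol (indicator (fst c)) = chart_measure c"
  proof (rule measure_eqI)
    show "sets (density vol (indicator (fst c))) = sets (chart_measure c)"
      by (simp add: sets_vol sets_chart_measure[OF c])
    fix B assume "B \<in> sets (density vol (indicator (fst c)))"
    then have B: "B \<in> sets vol" "B \<inter> fst c \<in> sets borelX" using Uc by (auto simp: sets_vol)
    show "emeasure (density vol (indicator (fst c))) B = emeasure (chart_measure c) B"
      using emeasure_restricted[OF Uc B(1)] emeasure_vol[OF c B(2)] emeasure_chart_measure[OF c, of B] B(1)
      by (simp add: Int_commute sets_vol)
  qed
  then have eq: "density vol (\<lambda>p. ennreal (indicator (fst c) p)) = chart_measure c"
    by (simp add: ennreal_indicator)
  have fm: "f \<in> borel_measurable borelX" using f(1) sets_vol measurable_cong_sets by blast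
  have "integral\<^sup>L vol f = integral\<^sup>L vol (\<lambda>p. indicator (fst c) p *\<^sub>R f p)"
    by (rule Bochner_Integration.integral_cong) (use f(2) in \<open>auto simp: indicator_def space_vol\<close>)
  also have "\<dots> = integral\<^sup>L (chart_measure c) f"
    unfolding eq[symmetric] using f(1) Uc by (subst integral_density) auto
  also have "\<dots> = integral\<^sup>L (density (restrict_space lborel (img c)) (\<lambda>x. ennreal \<bar>\<omega> c [1, 2] x\<bar>)) (\<lambda>x. f (par c x))"
    unfolding chart_measure_def[OF c] using measurable_par[OF c] fm by (subst integral_distr) auto
  also have "\<dots> = integral\<^sup>L (restrict_space lborel (img c)) (\<lambda>x. \<bar>\<omega> c [1, 2] x\<bar> *\<^sub>R f (par c x))"
    using borel_w_restrict[OF c] measurable_compose[OF measurable_par[OF c] fm]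
    by (subst integral_density) auto
  also have "\<dots> = integral\<^sup>L lborel (\<lambda>x. indicator (img c) x * (\<bar>\<omega> c [1, 2] x\<bar> * f (par c x)))"
    using chart(2)[OF c] by (subst integral_restrict_space) auto
  finally show ?thesis .
qed

end

section \<open>Locality and linearity of the first variation\<close>

lemma K_scal_cong:
  assumes V: "open V" "x \<in> V" and eq: "\<And>y i j k. y \<in> V \<Longrightarrow> \<Gamma> i j k y = \<Gamma>' i j k y"
  shows "K_scal w \<Gamma> x = K_scal w \<Gamma>' x"
proof -
  have "curv \<Gamma> i j k l y = curv \<Gamma>' i j k l y" if "y \<in> V" for i j k l y
    using pd_cong[OF V(1) that, of "\<Gamma> _ _ _" "\<Gamma>' _ _ _"] eq that by (simp add: curv_def)
  then have R: "ric \<Gamma> [i, j] y = ric \<Gamma>' [i, j] y" if "y \<in> V" for i j y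
    using that by simp
  have "curl_ric \<Gamma> j y = curl_ric \<Gamma>' j y" if "y \<in> V" for j y
    using pd_cong[OF V(1) that R] R[OF that] eq[OF that] by (simp add: curl_ric_def del: ric.simps)
  then show ?thesis
    unfolding K_scal_eq_K_of_curl_ric by (rule K_of_curl_ric_cong[OF V])
qed

text \<open>Vanishing on a neighbourhood is required, because the expressions differentiate the
  variation; it will make the flux vanish off the support.\<close>

lemma variation_zero:
  assumes V: "open V" "x \<in> V" and eq: "\<And>y i j k. y \<in> V \<Longrightarrow> \<Psi> i j k y = 0"
  shows "ric_of_curv (lin_curv \<Gamma> \<Psi>) i j x = 0" "curl_ric_var1 \<Gamma> \<Psi> j x = 0"
proof -
  have L: "lin_curv \<Gamma> \<Psi> j k y = 0" if "y \<in> V" for j k y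
    using pd_cong[OF V(1) that, of "\<Psi> _ _ _" "\<lambda>x. 0"] eq that by (simp add: lin_curv_def pd_const)
  then have T: "ric_of_curv (lin_curv \<Gamma> \<Psi>) i j y = 0" if "y \<in> V" for i j y
    using that by (simp add: ric_of_curv_def)
  show "ric_of_curv (lin_curv \<Gamma> \<Psi>) i j x = 0" by (rule T[OF V(2)])
  show "curl_ric_var1 \<Gamma> \<Psi> j x = 0"
    using pd_cong[OF V, of "ric_of_curv (lin_curv \<Gamma> \<Psi>) _ _" "\<lambda>x. 0"] T V(2) eq
    by (simp add: curl_ric_var1_def cov_curl_def curl_alg_def pd_const)
qed

lemma curl_ric_var1_add:
  assumes "chart_variation n S w \<Gamma> \<Psi>" "chart_variation n S w \<Gamma> \<Psi>'" and x: "x \<in> S"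
  shows "curl_ric_var1 \<Gamma> (\<lambda>i j k y. \<Psi> i j k y + \<Psi>' i j k y) j x = curl_ric_var1 \<Gamma> \<Psi> j x + curl_ric_var1 \<Gamma> \<Psi>' j x"
proof -
  interpret A: chart_variation n S w \<Gamma> \<Psi> by fact
  interpret B: chart_variation n S w \<Gamma> \<Psi>' by fact
  have d: "\<Psi> i j k differentiable (at y)" "\<Psi>' i j k differentiable (at y)"
    "ric_of_curv (lin_curv \<Gamma> \<Psi>) i j differentiable (at y)" "ric_of_curv (lin_curv \<Gamma> \<Psi>') i j differentiable (at y)"
    if y: "y \<in> S" for y i j k
    by (rule Ck_on_differentiable[where k = n, OF A.Ck_lower(2) A.open_S y]
        Ck_on_differentiable[where k = n, OF B.Ck_lower(2) A.open_S y]
        Ck_on_differentiable[where k = n, OF Ck_ric_of_curv[OF A.open_S A.Ck_lin_curv] A.open_S y]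
        Ck_on_differentiable[where k = n, OF Ck_ric_of_curv[OF A.open_S B.Ck_lin_curv] A.open_S y], simp)+
  let ?\<Psi> = "\<lambda>i j k y. \<Psi> i j k y + \<Psi>' i j k y"
  have T: "ric_of_curv (lin_curv \<Gamma> ?\<Psi>) i j y = ric_of_curv (lin_curv \<Gamma> \<Psi>) i j y + ric_of_curv (lin_curv \<Gamma> \<Psi>') i j y"
    if "y \<in> S" for i j y
    using d[OF that] by (simp add: ric_of_curv_def lin_curv_def pd_add sum_2 algebra_simps)
  have "pd l (ric_of_curv (lin_curv \<Gamma> ?\<Psi>) i j) x
      = pd l (\<lambda>y. ric_of_curv (lin_curv \<Gamma> \<Psi>) i j y + ric_of_curv (lin_curv \<Gamma> \<Psi>') i j y) x" for l i j
    by (rule pd_cong[OF A.open_S x], erule T)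
  then show ?thesis
    using d[OF x] T[OF x] by (simp add: curl_ric_var1_def cov_curl_def curl_alg_def pd_add sum_2 algebra_simps del: ric.simps)
qed

lemma Ck_on_Un:
  assumes "open S" "open T" "Ck_on k S f" "Ck_on k T f"
  shows "Ck_on k (S \<union> T) f"
  using assms(3,4)
proof (induction k arbitrary: f)
  case 0
  then show ?case using assms by (simp add: continuous_on_open_Un)
next
  case (Suc k)
  then have "f differentiable_on (S \<union> T)"
    using assms(1,2) by (auto simp: differentiable_on_eq_differentiable_at open_Un)
  with Suc show ?case by simp
qed

text \<open>The device that turns statements about K of all varied connections into statements about
  its individual coefficients in t.\<close>

lemma cubic_polynomial_eq:
  fixes a b c d a' b' c' d' :: real
  assumes "\<And>t. a + t * b + t\<^sup>2 * c + t ^ 3 * d = a' + t * b' + t\<^sup>2 * c' + t ^ 3 * d'"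
  shows "a = a'" "b = b'" "c = c'" "d = d'"
proof -
  show "a = a'" using assms[of 0] by simp
  then show "b = b'" "c = c'" "d = d'"
    using assms[of 1] assms[of "- 1"] assms[of 2] by simp_all
qed

section \<open>Variations on a surface\<close>

locale preferred_surface = surface X A \<omega> for X :: "'a topology" and A \<omega> +
  fixes \<Gamma> :: "('a, 2) conn"
  assumes conn: "symplectic_connection A \<omega> \<Gamma>" and pref: "preferred A \<Gamma>"
begin

text \<open>As \<open>sym_cubic\<close>, but with components of class C^4, so that the class is
  closed under multiplication by cutoffs. The value 4 is \<open>n + 3\<close> for
  \<open>n = 1\<close>.\<close>

definition cubic :: "('a, 2) tensor \<Rightarrow> bool" where
  "cubic P \<longleftrightarrow> (\<forall>c\<in>A. \<forall>i j k. Ck_on 4 (img c) (P c [i, j, k])) \<and>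
    (\<forall>c\<in>A. \<forall>x\<in>img c. \<forall>i j k. P c [i, j, k] x = P c [j, i, k] x \<and> P c [i, j, k] x = P c [i, k, j] x) \<and>
    (\<forall>c\<in>A. \<forall>d\<in>A. \<forall>x\<in>overlap c d. \<forall>i j k. P c [i, j, k] x =
      (\<Sum>a\<in>UNIV. \<Sum>b\<in>UNIV. \<Sum>e\<in>UNIV. jac c d i a x * jac c d j b x * jac c d k e x * P d [a, b, e] (trans_map c d x)))"

lemma sym_cubic_imp_cubic:
  assumes "sym_cubic A P"
  shows "cubic P"
proof -
  have T: "tensor_field A 3 P" using assms by (simp add: sym_cubic_def)
  have "P c [i, j, k] x =
      (\<Sum>a\<in>UNIV. \<Sum>b\<in>UNIV. \<Sum>e\<in>UNIV. jac c d i a x * jac c d j b x * jac c d k e x * P d [a, b, e] (trans_map c d x))"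
    if cd: "c \<in> A" "d \<in> A" "x \<in> overlap c d" for c d x i j k
  proof -
    have "P c js x = (\<Sum>ls | length ls = 3.
          (\<Prod>m<3. jac c d (js ! m) (ls ! m) x) * P d ls (trans_map c d x))" if "length js = 3" for js
      using T cd that unfolding tensor_field_def by blast
    from this[of "[i, j, k]"] have "P c [i, j, k] x = (\<Sum>ls | length ls = 3.
          (\<Prod>m<3. jac c d ([i, j, k] ! m) (ls ! m) x) * P d ls (trans_map c d x))" by simp
    also have "\<dots> = (\<Sum>a\<in>UNIV. \<Sum>b\<in>UNIV. \<Sum>e\<in>UNIV. jac c d i a x * jac c d j b x * jac c d k e x * P d [a, b, e] (trans_map c d x))"
      by (simp only: sum_lists_3) (simp add: numeral_3_eq_3 lessThan_Suc mult_ac)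
    finally show ?thesis .
  qed
  moreover have "Ck_on 4 (img c) (P c [i, j, k])" if "c \<in> A" for c i j k
    using T that by (simp add: tensor_field_def smooth_on_def del: Ck_on.simps)
  ultimately show ?thesis
    using assms unfolding cubic_def sym_cubic_def by blast
qed

text \<open>\<open>Psi P\<close> is the difference tensor $\Pi_{ij}{}^k = \Omega^{kp}\Pi_{ijp}$.\<close>

definition Psi :: "('a, 2) tensor \<Rightarrow> ('a, 2) conn" where
  "Psi P c i j k x = (\<Sum>p\<in>UNIV. bivec (\<omega> c) k p x * P c [i, j, p] x)"

lemma vary_eq: "vary \<omega> \<Gamma> t P c = (\<lambda>i j k x. \<Gamma> c i j k x + t * Psi P c i j k x)"
  by (simp add: fun_eq_iff vary_def Psi_def)

lemma Psi_simps:
  assumes "c \<in> A" "x \<in> img c"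
  shows "Psi P c i j 1 x = P c [i, j, 2] x / \<omega> c [1, 2] x"
    "Psi P c i j 2 x = - P c [i, j, 1] x / \<omega> c [1, 2] x"
  using bivec_2[of "\<omega> c" x, OF \<omega>_nz[OF assms] \<omega>_antisym[OF assms]]
  by (simp_all add: Psi_def sum_2)

section \<open>Charts of the surface as instances of the local theory\<close>

lemma chart_geometry_chart:
  assumes c: "c \<in> A"
  shows "chart_geometry n (img c) (\<omega> c [1, 2]) (\<Gamma> c)"
proof
  show "open (img c)" by (rule chart(2)[OF c])
  show "\<omega> c [1, 2] x \<noteq> 0" if "x \<in> img c" for x by (rule \<omega>_nz[OF c that])
  show "\<Gamma> c i j k x = \<Gamma> c j i k x" if "x \<in> img c" for x i j k
    using conn c that unfolding symplectic_connection_def by blast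
  show "pd i (\<omega> c [1, 2]) x = (\<Gamma> c i 1 1 x + \<Gamma> c i 2 2 x) * \<omega> c [1, 2] x" if x: "x \<in> img c" for x i
  proof -
    have "covd (\<Gamma> c) (\<omega> c) [i, 1, 2] x = 0"
      using conn c x unfolding symplectic_connection_def by blast
    then show ?thesis
      using \<omega>_diag[OF c x] by (simp add: covd_2 sum_2 algebra_simps del: covd.simps)
  qed
  show "Ck_on k (img c) (\<omega> c [1, 2])" for k by (rule smooth_\<omega>[OF c])
  show "Ck_on (n + 3) (img c) (\<Gamma> c i j k)" for i j k
    using conn c unfolding symplectic_connection_def affine_connection_def smooth_on_def by blast
qed

lemma preferred_chart_chart:
  assumes c: "c \<in> A"
  shows "preferred_chart (img c) (\<omega> c [1, 2]) (\<Gamma> c)"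
proof -
  interpret chart_geometry 1 "img c" "\<omega> c [1, 2]" "\<Gamma> c" by (rule chart_geometry_chart[OF c])
  show ?thesis
  proof
    fix x i j k assume "x \<in> img c"
    then have "(let D = (\<lambda>i j k. covd (\<Gamma> c) (ric (\<Gamma> c)) [i, j, k] x)
         in (D i j k + D i k j + D j i k + D j k i + D k i j + D k j i) / 6 = 0)"
      using pref c unfolding preferred_def by blast
    then show "covd (\<Gamma> c) (ric (\<Gamma> c)) [i, j, k] x + covd (\<Gamma> c) (ric (\<Gamma> c)) [i, k, j] x
      + covd (\<Gamma> c) (ric (\<Gamma> c)) [j, i, k] x + covd (\<Gamma> c) (ric (\<Gamma> c)) [j, k, i] x
      + covd (\<Gamma> c) (ric (\<Gamma> c)) [k, i, j] x + covd (\<Gamma> c) (ric (\<Gamma> c)) [k, j, i] x = 0"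
      by (simp add: Let_def del: covd.simps)
  qed
qed

lemma chart_variation_chart:
  assumes c: "c \<in> A" and P: "cubic P"
  shows "chart_variation 1 (img c) (\<omega> c [1, 2]) (\<Gamma> c) (Psi P c)"
proof -
  interpret chart_geometry 1 "img c" "\<omega> c [1, 2]" "\<Gamma> c" by (rule chart_geometry_chart[OF c])
  have s: "P c [i, j, k] x = P c [j, i, k] x" "P c [i, j, k] x = P c [i, k, j] x" if "x \<in> img c" for x i j k
    using P c that unfolding cubic_def by blast+
  have C: "Ck_on 4 (img c) (P c [i, j, k])" for i j k
    using P c unfolding cubic_def by blast
  show ?thesis
  proof
    show "Psi P c i j k x = Psi P c j i k x" if "x \<in> img c" for x i j k
      using s(1)[OF that, of i j] by (simp add: Psi_def)
    show "Psi P c i 1 1 x + Psi P c i 2 2 x = 0" if "x \<in> img c" for x i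
      using s(2)[OF that, of i 1 2] by (simp add: Psi_simps[OF c that] add_divide_distrib[symmetric])
    show "Ck_on (1 + 3) (img c) (Psi P c i j k)" for i j k
    proof (cases "k = 1")
      case True
      show ?thesis unfolding True
        by (rule Ck_on_cong[OF open_S Psi_simps(1)[OF c, symmetric]], assumption)
          (simp, intro Ck_on_divide open_S C Ck_w w_nz)
    next
      case False
      then have k: "k = 2" using exhaust_2[of k] by auto
      show ?thesis unfolding k
        by (rule Ck_on_cong[OF open_S Psi_simps(2)[OF c, symmetric]], assumption)
          (simp, intro Ck_on_divide Ck_on_minus open_S C Ck_w w_nz)
    qed
  qed
qed

text \<open>Stated with the Jacobian on the contravariant side, so that t times it can be added to
  the transformation law of the connection.\<close>

lemma Psi_law:
  assumes c: "c \<in> A" and d: "d \<in> A" and P: "cubic P" and x: "x \<in> overlap c d"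
  shows "(\<Sum>k\<in>UNIV. Psi P c i j k x * jac c d k m x) =
    (\<Sum>a\<in>UNIV. \<Sum>b\<in>UNIV. jac c d i a x * jac c d j b x * Psi P d a b m (trans_map c d x))"
proof -
  obtain p where p: "p \<in> fst c" "p \<in> fst d" "x = snd c p" using x by (auto simp: overlap_def)
  have xc: "x \<in> img c" and yd: "trans_map c d x \<in> img d" using p trans_map_eq[OF c p(1)] by auto
  have law: "P c [i, j, k] x =
      (\<Sum>a\<in>UNIV. \<Sum>b\<in>UNIV. \<Sum>e\<in>UNIV. jac c d i a x * jac c d j b x * jac c d k e x * P d [a, b, e] (trans_map c d x))" for k
    using P c d x unfolding cubic_def by blast
  define D where "D = jac c d 1 1 x * jac c d 2 2 x - jac c d 1 2 x * jac c d 2 1 x"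
  have w: "\<omega> c [1, 2] x = D * \<omega> d [1, 2] (trans_map c d x)"
    unfolding D_def by (rule \<omega>_law[OF c d x])
  have nz: "D \<noteq> 0" "\<omega> d [1, 2] (trans_map c d x) \<noteq> 0"
    using \<omega>_nz[OF c xc] w \<omega>_nz[OF d yd] by auto
  have "P c [i, j, 2] x * jac c d 1 m x - P c [i, j, 1] x * jac c d 2 m x =
      D * (\<Sum>a\<in>UNIV. \<Sum>b\<in>UNIV. jac c d i a x * jac c d j b x *
        (if m = 1 then P d [a, b, 2] (trans_map c d x) else - P d [a, b, 1] (trans_map c d x)))"
    unfolding law D_def using exhaust_2[of m] by (auto simp: sum_2 algebra_simps)
  moreover have "(\<Sum>k\<in>UNIV. Psi P c i j k x * jac c d k m x)
      = (P c [i, j, 2] x * jac c d 1 m x - P c [i, j, 1] x * jac c d 2 m x) / (D * \<omega> d [1, 2] (trans_map c d x))"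
    by (simp add: sum_2 Psi_simps[OF c xc] w diff_divide_distrib)
  moreover have "(\<Sum>a\<in>UNIV. \<Sum>b\<in>UNIV. jac c d i a x * jac c d j b x * Psi P d a b m (trans_map c d x))
      = (\<Sum>a\<in>UNIV. \<Sum>b\<in>UNIV. jac c d i a x * jac c d j b x *
        (if m = 1 then P d [a, b, 2] (trans_map c d x) else - P d [a, b, 1] (trans_map c d x))) / \<omega> d [1, 2] (trans_map c d x)"
    using exhaust_2[of m] by (auto simp: sum_divide_distrib Psi_simps[OF d yd])
  ultimately show ?thesis using nz by simp
qed

text \<open>Two charts are kept apart on purpose: \<open>c\<close> will be the arbitrary one picked
  by \<open>K_fun\<close>, \<open>d\<close> the one in which a computation takes place.\<close>

lemma K_coord_chart:
  assumes c: "c \<in> A" and d: "d \<in> A" and P: "cubic P" and p: "p \<in> fst c" "p \<in> fst d"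
  shows "K_coord (\<omega> c) (vary \<omega> \<Gamma> t P c) (snd c p) = K_scal (\<omega> d [1, 2]) (vary \<omega> \<Gamma> t P d) (snd d p)"
proof -
  have cg: "chart_geometry 1 (img c) (\<omega> c [1, 2]) (vary \<omega> \<Gamma> t P c)" if "c \<in> A" for c
    unfolding vary_eq by (rule chart_variation.chart_geometry_vary[OF chart_variation_chart[OF that P]])
  interpret C: chart_geometry 1 "img c" "\<omega> c [1, 2]" "vary \<omega> \<Gamma> t P c" by (rule cg[OF c])
  interpret D: chart_geometry 1 "img d" "\<omega> d [1, 2]" "vary \<omega> \<Gamma> t P d" by (rule cg[OF d])
  interpret chart_change 1 "img c" "\<omega> c [1, 2]" "vary \<omega> \<Gamma> t P c" "img d" "\<omega> d [1, 2]" "vary \<omega> \<Gamma> t P d"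
    "overlap c d" "trans_map c d"
  proof
    show "open (overlap c d)" by (rule open_overlap[OF c d])
    show "overlap c d \<subseteq> img c" by (auto simp: overlap_def)
    show "trans_map c d x \<in> img d" if x: "x \<in> overlap c d" for x
    proof -
      obtain q where "q \<in> fst c" "q \<in> fst d" "x = snd c q" using x by (auto simp: overlap_def)
      then show ?thesis using trans_map_eq[OF c] by simp
    qed
    show "Ck_on k (overlap c d) (\<lambda>x. trans_map c d x $ a)" for k a by (rule Ck_trans_map[OF c d])
    show "\<omega> c [1, 2] x = (pd 1 (\<lambda>z. trans_map c d z $ 1) x * pd 2 (\<lambda>z. trans_map c d z $ 2) x
      - pd 1 (\<lambda>z. trans_map c d z $ 2) x * pd 2 (\<lambda>z. trans_map c d z $ 1) x) * \<omega> d [1, 2] (trans_map c d x)"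
      if "x \<in> overlap c d" for x
      using \<omega>_law[OF c d that] by (simp add: jac_def)
    fix x i j m assume x: "x \<in> overlap c d"
    have "(\<Sum>k\<in>UNIV. \<Gamma> c i j k x * jac c d k m x) =
        (\<Sum>a\<in>UNIV. \<Sum>b\<in>UNIV. jac c d i a x * jac c d j b x * \<Gamma> d a b m (trans_map c d x))
        + pd i (jac c d j m) x"
      using conn c d x unfolding symplectic_connection_def affine_connection_def by blast
    then have G: "(\<Sum>k\<in>UNIV. \<Gamma> c i j k x * jac c d k m x) + t * (\<Sum>k\<in>UNIV. Psi P c i j k x * jac c d k m x) =
        (\<Sum>a\<in>UNIV. \<Sum>b\<in>UNIV. jac c d i a x * jac c d j b x * \<Gamma> d a b m (trans_map c d x))
        + pd i (jac c d j m) x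
        + t * (\<Sum>a\<in>UNIV. \<Sum>b\<in>UNIV. jac c d i a x * jac c d j b x * Psi P d a b m (trans_map c d x))"
      unfolding Psi_law[OF c d P x] by simp
    have "jac c d j m = pd j (\<lambda>z. trans_map c d z $ m)" for j m
      by (simp add: fun_eq_iff jac_def)
    with G show "(\<Sum>k\<in>UNIV. vary \<omega> \<Gamma> t P c i j k x * pd k (\<lambda>z. trans_map c d z $ m) x) =
      (\<Sum>a\<in>UNIV. \<Sum>b\<in>UNIV. pd i (\<lambda>z. trans_map c d z $ a) x * pd j (\<lambda>z. trans_map c d z $ b) x * vary \<omega> \<Gamma> t P d a b m (trans_map c d x))
        + pd i (pd j (\<lambda>z. trans_map c d z $ m)) x"
      by (simp add: vary_eq sum_2 algebra_simps)
  qed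
  have x: "snd c p \<in> overlap c d" "snd c p \<in> img c" using p by (auto simp: overlap_def)
  have "K_coord (\<omega> c) (vary \<omega> \<Gamma> t P c) (snd c p) = K_scal (\<omega> c [1, 2]) (vary \<omega> \<Gamma> t P c) (snd c p)"
    by (rule C.K_coord_eq_K_scal[OF x(2)]) (use \<omega>_antisym[OF c] in blast)+
  then show ?thesis
    using K_scal_law[OF x(1)] trans_map_eq[OF c p(1)] by simp
qed

section \<open>The coefficients of K in t as functions on the surface\<close>

definition chart_at :: "'a \<Rightarrow> ('a, 2) chart" where
  "chart_at p = (SOME c. c \<in> A \<and> p \<in> fst c)"

lemma chart_at:
  assumes "p \<in> topspace X"
  shows "chart_at p \<in> A" "p \<in> fst (chart_at p)"
proof -
  obtain c where "c \<in> A \<and> p \<in> fst c" using assms cover by blast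
  then have "chart_at p \<in> A \<and> p \<in> fst (chart_at p)" unfolding chart_at_def by (rule someI)
  then show "chart_at p \<in> A" "p \<in> fst (chart_at p)" by auto
qed

lemma K_fun_vary_chart:
  assumes "cubic P" "c \<in> A" "p \<in> fst c"
  shows "K_fun A \<omega> (vary \<omega> \<Gamma> t P) p = K_scal (\<omega> c [1, 2]) (vary \<omega> \<Gamma> t P c) (snd c p)"
proof -
  have "p \<in> topspace X" using cover assms by auto
  from K_coord_chart[OF chart_at(1)[OF this] assms(2,1) chart_at(2)[OF this] assms(3)]
  show ?thesis by (simp add: K_fun_def Let_def chart_at_def)
qed

definition K1 :: "('a, 2) tensor \<Rightarrow> 'a \<Rightarrow> real" where
  "K1 P p = (let c = chart_at p in K_of_curl_ric (\<omega> c [1, 2]) (curl_ric_var1 (\<Gamma> c) (Psi P c)) (snd c p))"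

definition K2 :: "('a, 2) tensor \<Rightarrow> 'a \<Rightarrow> real" where
  "K2 P p = (let c = chart_at p in K_of_curl_ric (\<omega> c [1, 2]) (curl_ric_var2 (\<Gamma> c) (Psi P c)) (snd c p))"

definition K3 :: "('a, 2) tensor \<Rightarrow> 'a \<Rightarrow> real" where
  "K3 P p = (let c = chart_at p in K_of_curl_ric (\<omega> c [1, 2]) (curl_ric_var3 (Psi P c)) (snd c p))"

abbreviation "K0 \<equiv> K_fun A \<omega> \<Gamma>"

lemma vary_0: "vary \<omega> \<Gamma> 0 P = \<Gamma>"
  by (simp add: fun_eq_iff vary_def)

lemma K_scal_vary_chart:
  assumes "cubic P" "c \<in> A" "p \<in> fst c"
  shows "K_scal (\<omega> c [1, 2]) (vary \<omega> \<Gamma> t P c) (snd c p) = K_scal (\<omega> c [1, 2]) (\<Gamma> c) (snd c p)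
    + t * K_of_curl_ric (\<omega> c [1, 2]) (curl_ric_var1 (\<Gamma> c) (Psi P c)) (snd c p)
    + t\<^sup>2 * K_of_curl_ric (\<omega> c [1, 2]) (curl_ric_var2 (\<Gamma> c) (Psi P c)) (snd c p)
    + t ^ 3 * K_of_curl_ric (\<omega> c [1, 2]) (curl_ric_var3 (Psi P c)) (snd c p)"
  unfolding vary_eq
  by (rule chart_variation.K_scal_vary[OF chart_variation_chart[OF assms(2,1)]]) (use assms in blast)

lemma K_fun_vary:
  assumes P: "cubic P" and p: "p \<in> topspace X"
  shows "K_fun A \<omega> (vary \<omega> \<Gamma> t P) p = K0 p + t * K1 P p + t\<^sup>2 * K2 P p + t ^ 3 * K3 P p"
proof -
  have "K0 p = K_scal (\<omega> (chart_at p) [1, 2]) (\<Gamma> (chart_at p)) (snd (chart_at p) p)"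
    using K_fun_vary_chart[OF P chart_at[OF p], of 0] by (simp only: vary_0)
  then show ?thesis
    unfolding K_fun_vary_chart[OF P chart_at[OF p]] K_scal_vary_chart[OF P chart_at[OF p]]
    by (simp add: K1_def K2_def K3_def Let_def)
qed

text \<open>Only the polynomial as a whole is known to be invariant under changes of chart; as this
  holds for every t, each coefficient is invariant.\<close>

lemma K_chart:
  assumes P: "cubic P" and c: "c \<in> A" "p \<in> fst c"
  shows "K0 p = K_scal (\<omega> c [1, 2]) (\<Gamma> c) (snd c p)"
    "K1 P p = K_of_curl_ric (\<omega> c [1, 2]) (curl_ric_var1 (\<Gamma> c) (Psi P c)) (snd c p)"
    "K2 P p = K_of_curl_ric (\<omega> c [1, 2]) (curl_ric_var2 (\<Gamma> c) (Psi P c)) (snd c p)"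
    "K3 P p = K_of_curl_ric (\<omega> c [1, 2]) (curl_ric_var3 (Psi P c)) (snd c p)"
proof -
  have p: "p \<in> topspace X" using cover c by auto
  have "K0 p + t * K1 P p + t\<^sup>2 * K2 P p + t ^ 3 * K3 P p = K_scal (\<omega> c [1, 2]) (\<Gamma> c) (snd c p)
    + t * K_of_curl_ric (\<omega> c [1, 2]) (curl_ric_var1 (\<Gamma> c) (Psi P c)) (snd c p)
    + t\<^sup>2 * K_of_curl_ric (\<omega> c [1, 2]) (curl_ric_var2 (\<Gamma> c) (Psi P c)) (snd c p)
    + t ^ 3 * K_of_curl_ric (\<omega> c [1, 2]) (curl_ric_var3 (Psi P c)) (snd c p)" for t
    using K_fun_vary[OF P p, of t] K_fun_vary_chart[OF P c, of t] K_scal_vary_chart[OF P c, of t] by simp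
  note * = cubic_polynomial_eq[OF this]
  show "K0 p = K_scal (\<omega> c [1, 2]) (\<Gamma> c) (snd c p)"
    "K1 P p = K_of_curl_ric (\<omega> c [1, 2]) (curl_ric_var1 (\<Gamma> c) (Psi P c)) (snd c p)"
    "K2 P p = K_of_curl_ric (\<omega> c [1, 2]) (curl_ric_var2 (\<Gamma> c) (Psi P c)) (snd c p)"
    "K3 P p = K_of_curl_ric (\<omega> c [1, 2]) (curl_ric_var3 (Psi P c)) (snd c p)" by (fact *)+
qed

section \<open>Support, continuity and additivity of the coefficients\<close>

definition vanishes_off :: "'a set \<Rightarrow> ('a, 2) tensor \<Rightarrow> bool" where
  "vanishes_off C P \<longleftrightarrow> (\<forall>c\<in>A. \<forall>p\<in>fst c - C. \<forall>i j k. P c [i, j, k] (snd c p) = 0)"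

lemma Psi_vanishes:
  assumes C: "closedin X C" "vanishes_off C P" and c: "c \<in> A"
  shows "open (snd c ` (fst c - C))" "y \<in> snd c ` (fst c - C) \<Longrightarrow> Psi P c i j k y = 0"
proof -
  have "openin X (fst c - C)" using chart(1)[OF c] C(1) by (simp add: openin_diff)
  then show "open (snd c ` (fst c - C))" by (subst open_chart_image[OF c]) auto
  show "Psi P c i j k y = 0" if "y \<in> snd c ` (fst c - C)"
    using that C(2) c unfolding Psi_def vanishes_off_def by auto
qed

lemma K_vanishes:
  assumes P: "cubic P" and C: "closedin X C" "vanishes_off C P" and p: "p \<in> topspace X - C"
  shows "K1 P p = 0" "K2 P p = 0" "K3 P p = 0"
proof -
  obtain c where c: "c \<in> A" "p \<in> fst c" using p cover by blast
  note V = Psi_vanishes[OF C c(1)]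
  have x: "snd c p \<in> snd c ` (fst c - C)" using c p by auto
  \<comment> \<open>Off the support the connection does not change near p, so the polynomial is
    constant in t and its higher coefficients vanish.\<close>
  have "K0 p + t * K1 P p + t\<^sup>2 * K2 P p + t ^ 3 * K3 P p = K0 p + t * 0 + t\<^sup>2 * 0 + t ^ 3 * 0" for t
  proof -
    have "K_scal (\<omega> c [1, 2]) (vary \<omega> \<Gamma> t P c) (snd c p) = K_scal (\<omega> c [1, 2]) (\<Gamma> c) (snd c p)"
      by (rule K_scal_cong[OF V(1) x]) (simp add: vary_eq V(2))
    then show ?thesis
      using K_fun_vary[OF P, of p t] p K_fun_vary_chart[OF P c, of t] K_chart(1)[OF P c] by simp
  qed
  from cubic_polynomial_eq[OF this] show "K1 P p = 0" "K2 P p = 0" "K3 P p = 0" by auto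
qed

lemma continuous_map_charts:
  fixes g :: "'a \<Rightarrow> real"
  assumes "\<And>c. c \<in> A \<Longrightarrow> continuous_on (img c) (F c)" "\<And>c p. c \<in> A \<Longrightarrow> p \<in> fst c \<Longrightarrow> g p = F c (snd c p)"
  shows "continuous_map X euclideanreal g"
  unfolding continuous_map
proof (intro conjI allI impI)
  fix U :: "real set" assume "openin euclideanreal U"
  then have U: "open U" by (rule open_openin[THEN iffD2])
  have "openin X {p \<in> fst c. g p \<in> U}" if c: "c \<in> A" for c
  proof -
    have "open (F c -` U \<inter> img c)"
      using assms(1)[OF c] U chart(2)[OF c] continuous_on_open_vimage by blast
    moreover have "F c -` U \<inter> img c = snd c ` {p \<in> fst c. g p \<in> U}"
      using assms(2)[OF c] by auto
    ultimately show ?thesis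
      by (subst open_chart_image[OF c, symmetric]) auto
  qed
  then have "openin X (\<Union>c\<in>A. {p \<in> fst c. g p \<in> U})" by (intro openin_Union) auto
  moreover have "(\<Union>c\<in>A. {p \<in> fst c. g p \<in> U}) = {p \<in> topspace X. g p \<in> U}"
    using cover by blast
  ultimately show "openin X {p \<in> topspace X. g p \<in> U}" by simp
qed simp

lemma continuous_K_of_curl_ric:
  assumes "open S" "\<And>j. Ck_on 1 S (N j)" "Ck_on 1 S v" "\<And>x. x \<in> S \<Longrightarrow> v x \<noteq> 0"
  shows "continuous_on S (K_of_curl_ric v N)"
proof -
  have "Ck_on 1 S (\<lambda>y. - N j y / v y)" for j
    by (intro Ck_on_divide Ck_on_minus assms)
  then have "continuous_on S (pd i (\<lambda>y. - N j y / v y))" for i j by simp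
  moreover have "continuous_on S v" using assms(3) by (rule Ck_on_imp_continuous_on)
  ultimately show ?thesis
    unfolding K_of_curl_ric_def[abs_def] using assms(4) by (intro continuous_intros) auto
qed

lemma continuous_K:
  assumes P: "cubic P"
  shows "continuous_map X euclideanreal K0" "continuous_map X euclideanreal (K1 P)"
    "continuous_map X euclideanreal (K2 P)" "continuous_map X euclideanreal (K3 P)"
proof -
  have c: "continuous_on (img c) (K_scal (\<omega> c [1, 2]) (\<Gamma> c))"
    "continuous_on (img c) (K_of_curl_ric (\<omega> c [1, 2]) (curl_ric_var1 (\<Gamma> c) (Psi P c)))"
    "continuous_on (img c) (K_of_curl_ric (\<omega> c [1, 2]) (curl_ric_var2 (\<Gamma> c) (Psi P c)))"
    "continuous_on (img c) (K_of_curl_ric (\<omega> c [1, 2]) (curl_ric_var3 (Psi P c)))" if c: "c \<in> A" for c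
  proof -
    interpret chart_variation 1 "img c" "\<omega> c [1, 2]" "\<Gamma> c" "Psi P c" by (rule chart_variation_chart[OF c P])
    show "continuous_on (img c) (K_scal (\<omega> c [1, 2]) (\<Gamma> c))" by (rule Ck_on_imp_continuous_on[OF Ck_K_scal])
    show "continuous_on (img c) (K_of_curl_ric (\<omega> c [1, 2]) (curl_ric_var1 (\<Gamma> c) (Psi P c)))"
      "continuous_on (img c) (K_of_curl_ric (\<omega> c [1, 2]) (curl_ric_var2 (\<Gamma> c) (Psi P c)))"
      "continuous_on (img c) (K_of_curl_ric (\<omega> c [1, 2]) (curl_ric_var3 (Psi P c)))"
      by (rule continuous_K_of_curl_ric[OF open_S Ck_on_mono[OF Ck_curl_ric_var(1)] Ck_w w_nz]
          continuous_K_of_curl_ric[OF open_S Ck_on_mono[OF Ck_curl_ric_var(2)] Ck_w w_nz]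
          continuous_K_of_curl_ric[OF open_S Ck_on_mono[OF Ck_curl_ric_var(3)] Ck_w w_nz]; simp)+
  qed
  show "continuous_map X euclideanreal K0" "continuous_map X euclideanreal (K1 P)"
    "continuous_map X euclideanreal (K2 P)" "continuous_map X euclideanreal (K3 P)"
    by (rule continuous_map_charts[OF c(1) K_chart(1)[OF P]] continuous_map_charts[OF c(2) K_chart(2)[OF P]]
        continuous_map_charts[OF c(3) K_chart(3)[OF P]] continuous_map_charts[OF c(4) K_chart(4)[OF P]]; assumption)+
qed

text \<open>The first variation is linear in the variation, which permits cutting the variation into
  pieces. The higher coefficients are not additive and are never split.\<close>

lemma K1_add:
  assumes P: "cubic P" and Q: "cubic Q" and R: "cubic R"
    and eq: "\<And>c i j k x. c \<in> A \<Longrightarrow> x \<in> img c \<Longrightarrow> P c [i, j, k] x = Q c [i, j, k] x + R c [i, j, k] x"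
    and p: "p \<in> topspace X"
  shows "K1 P p = K1 Q p + K1 R p"
proof -
  obtain c where c: "c \<in> A" "p \<in> fst c" using p cover by blast
  have x: "snd c p \<in> img c" using c by auto
  interpret Q: chart_variation 1 "img c" "\<omega> c [1, 2]" "\<Gamma> c" "Psi Q c" by (rule chart_variation_chart[OF c(1) Q])
  interpret R: chart_variation 1 "img c" "\<omega> c [1, 2]" "\<Gamma> c" "Psi R c" by (rule chart_variation_chart[OF c(1) R])
  let ?N = "\<lambda>P. curl_ric_var1 (\<Gamma> c) (Psi P c)"
  have eqP: "Psi P c i j k y - (Psi Q c i j k y + Psi R c i j k y) = 0" if "y \<in> img c" for i j k y
    using eq[OF c(1) that] by (simp add: Psi_def sum_2 algebra_simps)
  have N: "?N P j y = ?N Q j y + 1 * ?N R j y" if y: "y \<in> img c" for j y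
  proof -
    have "?N P j y = curl_ric_var1 (\<Gamma> c) (\<lambda>i j k y. Psi Q c i j k y + Psi R c i j k y) j y"
    proof -
      have e: "Psi P c i j k y = Psi Q c i j k y + Psi R c i j k y" if "y \<in> img c" for i j k y
        using eqP[OF that, of i j k] by simp
      have L: "ric_of_curv (lin_curv (\<Gamma> c) (Psi P c)) i j y = ric_of_curv (lin_curv (\<Gamma> c) (\<lambda>i j k y. Psi Q c i j k y + Psi R c i j k y)) i j y"
        if "y \<in> img c" for i j y
        using pd_cong[OF Q.open_S that e] e[OF that] by (simp add: ric_of_curv_def lin_curv_def)
      show ?thesis
        using pd_cong[OF Q.open_S y L] L[OF y] e[OF y] by (simp add: curl_ric_var1_def cov_curl_def curl_alg_def del: ric.simps)
    qed
    also have "\<dots> = ?N Q j y + ?N R j y"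
      by (rule curl_ric_var1_add[OF Q.chart_variation_axioms R.chart_variation_axioms y])
    finally show ?thesis by simp
  qed
  have d: "?N Q j differentiable (at (snd c p))" "?N R j differentiable (at (snd c p))" for j
    by (rule Ck_on_differentiable[where k = 1, OF _ Q.open_S x], rule Ck_on_mono[OF Q.Ck_curl_ric_var(1)] Ck_on_mono[OF R.Ck_curl_ric_var(1)], simp)+
  have "K_of_curl_ric (\<omega> c [1, 2]) (?N P) (snd c p) = K_of_curl_ric (\<omega> c [1, 2]) (\<lambda>j y. ?N Q j y + 1 * ?N R j y) (snd c p)"
    by (rule K_of_curl_ric_cong[OF Q.open_S x N])
  also have "\<dots> = K_of_curl_ric (\<omega> c [1, 2]) (?N Q) (snd c p) + 1 * K_of_curl_ric (\<omega> c [1, 2]) (?N R) (snd c p)"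
    by (rule K_of_curl_ric_add_cmult[OF d Q.diff_w[OF x] Q.w_nz[OF x]])
  finally show ?thesis
    using K_chart(2)[OF P c] K_chart(2)[OF Q c] K_chart(2)[OF R c] by simp
qed

end

section \<open>Preferred connections are critical\<close>

context surface begin

section \<open>Coordinate balls, finite volume of compact sets, integrability\<close>

lemma chart_image_par:
  assumes c: "c \<in> A" and B: "B \<subseteq> img c"
  shows "snd c ` par c ` B = B" "par c ` B \<subseteq> fst c"
proof -
  have "snd c ` par c ` B = (\<lambda>y. y) ` B"
    unfolding image_image by (rule image_cong[OF refl chart_par[OF c]]) (use B in blast)
  then show "snd c ` par c ` B = B" by simp
  show "par c ` B \<subseteq> fst c" using par_in[OF c] B by blast
qed

lemma compactin_par_cball:
  assumes c: "c \<in> A" and B: "cball x r \<subseteq> img c"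
  shows "compactin X (par c ` cball x r)"
proof -
  note im = chart_image_par[OF c B]
  have "compactin (top_of_set (img c)) (snd c ` (par c ` cball x r))"
    unfolding im(1) using B by (simp add: compactin_subtopology)
  moreover have "compactin (top_of_set (img c)) (snd c ` (par c ` cball x r)) \<longleftrightarrow>
      compactin (subtopology X (fst c)) (par c ` cball x r)"
    by (rule homeomorphic_map_compactness[OF chart(3)[OF c]]) (unfold top_sub[OF c], rule im(2))
  ultimately show ?thesis by (simp add: compactin_subtopology)
qed

lemma openin_par_ball:
  assumes c: "c \<in> A" and B: "ball x r \<subseteq> img c"
  shows "openin X (par c ` ball x r)"
  using open_chart_image[OF c chart_image_par(2)[OF c B]] unfolding chart_image_par(1)[OF c B] by simp

text \<open>Three concentric radii are reserved: on \<open>r\<close> the cutoff is 1, within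
  \<open>2 * r\<close> it is supported, and on \<open>3 * r\<close> the divergence is
  integrated.\<close>

lemma coordinate_ball:
  assumes "p \<in> topspace X"
  obtains c x r where "c \<in> A" "r > 0" "cball x (3 * r) \<subseteq> img c" "p \<in> par c ` ball x r"
proof -
  obtain c where c: "c \<in> A" "p \<in> fst c" using assms cover by blast
  obtain e where e: "e > 0" "cball (snd c p) e \<subseteq> img c"
    using chart(2)[OF c(1)] c(2) unfolding open_contains_cball by blast
  show thesis
  proof (rule that[of c "e / 3" "snd c p"])
    show "c \<in> A" by (rule c(1))
    show "e / 3 > 0" using e by simp
    show "cball (snd c p) (3 * (e / 3)) \<subseteq> img c" using e by simp
    have "p = par c (snd c p)" using par_chart[OF c] by simp
    then show "p \<in> par c ` ball (snd c p) (e / 3)" using e(1) by (intro image_eqI[of _ _ "snd c p"]) simp_all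
  qed
qed

lemma emeasure_vol_ball:
  assumes c: "c \<in> A" and B: "cball x r \<subseteq> img c"
  shows "emeasure vol (par c ` ball x r) < \<infinity>"
proof -
  have b: "ball x r \<subseteq> img c" using B ball_subset_cball by blast
  have "emeasure vol (par c ` ball x r) = (\<integral>\<^sup>+y\<in>ball x r. ennreal \<bar>\<omega> c [1, 2] y\<bar> \<partial>lborel)"
    using emeasure_vol[OF c openin_borelX[OF openin_par_ball[OF c b]] chart_image_par(2)[OF c b]]
    unfolding chart_image_par(1)[OF c b] .
  also have "\<dots> \<le> (\<integral>\<^sup>+y. ennreal (norm (indicator (cball x r) y *\<^sub>R \<omega> c [1, 2] y)) \<partial>lborel)"
    by (rule nn_integral_mono) (auto simp: indicator_def)
  also have "\<dots> < \<infinity>"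
    using borel_integrable_compact[OF compact_cball continuous_on_subset[OF Ck_on_imp_continuous_on[OF smooth_\<omega>[OF c, of 0]] B]]
    unfolding integrable_iff_bounded by blast
  finally show ?thesis .
qed

text \<open>Every point has a coordinate ball of finite volume as a neighbourhood, and finitely many
  of these cover a compact set.\<close>

lemma emeasure_vol_compact:
  assumes C: "compactin X C"
  shows "emeasure vol C < \<infinity>"
proof -
  have "\<exists>\<F>. finite \<F> \<and> \<F> \<subseteq> {U. openin X U \<and> emeasure vol U < \<infinity>} \<and> C \<subseteq> \<Union>\<F>"
  proof (rule compactinD[OF C])
    show "C \<subseteq> \<Union>{U. openin X U \<and> emeasure vol U < \<infinity>}"
    proof
      fix p assume "p \<in> C"
      then have "p \<in> topspace X" using compactin_subset_topspace[OF C] by blast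
      then obtain c x r where c: "c \<in> A" "r > 0" "cball x (3 * r) \<subseteq> img c" "p \<in> par c ` ball x r"
        by (rule coordinate_ball)
      have le: "cball x r \<subseteq> cball x (3 * r)" using c(2) by (intro subset_cball) simp
      have B: "cball x r \<subseteq> img c" by (rule order_trans[OF le c(3)])
      have b: "ball x r \<subseteq> img c" by (rule order_trans[OF ball_subset_cball B])
      show "p \<in> \<Union>{U. openin X U \<and> emeasure vol U < \<infinity>}"
        by (rule UnionI[OF CollectI c(4)], rule conjI[OF openin_par_ball[OF c(1) b] emeasure_vol_ball[OF c(1) B]])
    qed
  qed simp
  then obtain \<F> where F: "finite \<F>" "\<F> \<subseteq> {U. openin X U \<and> emeasure vol U < \<infinity>}" "C \<subseteq> \<Union>\<F>" by blast
  have Fs: "\<F> \<subseteq> sets vol" using F(2) openin_borelX sets_vol by blast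
  have "emeasure vol C \<le> emeasure vol (\<Union>U\<in>\<F>. U)"
    by (rule emeasure_mono) (use F Fs in auto)
  also have "\<dots> \<le> (\<Sum>U\<in>\<F>. emeasure vol U)"
    by (rule emeasure_subadditive_finite) (use F Fs in auto)
  also have "\<dots> < \<infinity>" using F(2) by (auto simp: F(1))
  finally show ?thesis .
qed

lemma integrable_compact_support:
  fixes f :: "'a \<Rightarrow> real"
  assumes f: "continuous_map X euclideanreal f" and C: "compactin X C" "\<And>p. p \<in> topspace X - C \<Longrightarrow> f p = 0"
  shows "integrable vol f"
proof -
  have "compact (f ` C)" using image_compactin[OF C(1) f] by simp
  then have "bounded (f ` C)" by (rule compact_imp_bounded)
  then obtain M where "\<forall>y\<in>f ` C. norm y \<le> M" unfolding bounded_iff by (elim exE)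
  then have M: "\<And>p. p \<in> C \<Longrightarrow> norm (f p) \<le> M" by simp
  show ?thesis
  proof (rule integrableI_bounded_set[where A = C])
    show "C \<in> sets vol" using closedin_borelX[OF compactin_imp_closedin[OF Hausdorff C(1)]] sets_vol by simp
    show "f \<in> borel_measurable vol" by (rule borel_measurable_continuous_map[OF f])
    show "emeasure vol C < \<infinity>" by (rule emeasure_vol_compact[OF C(1)])
    show "AE p in vol. p \<in> C \<longrightarrow> norm (f p) \<le> M" using M by simp
    show "AE p in vol. p \<notin> C \<longrightarrow> f p = 0" using C(2) by (intro AE_I2) (simp add: space_vol)
  qed
qed

end

context preferred_surface begin

text \<open>In coordinates the integrand is, up to a constant sign, the divergence of a flux with
  compact support inside the ball of radius \<open>3 * r\<close>.\<close>

lemma integral_chart_zero: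
  assumes P: "cubic P" and c: "c \<in> A" and r: "r > 0" "cball x (3 * r) \<subseteq> img c"
    and van: "vanishes_off (par c ` cball x (2 * r)) P"
  shows "(LINT p|vol. K0 p * K1 P p) = 0"
proof -
  let ?w = "\<omega> c [1, 2]" and ?N = "par c ` cball x (2 * r)" and ?B = "ball x (3 * r)"
  let ?f = "\<lambda>p. K0 p * K1 P p"
  interpret preferred_variation "img c" ?w "\<Gamma> c" "Psi P c"
    by (rule preferred_variation.intro[OF preferred_chart_chart[OF c] chart_variation_chart[OF c P]])
  have sub3: "cball x (2 * r) \<subseteq> ?B" using r(1) by (auto simp: subset_iff)
  have sub2: "?B \<subseteq> img c" by (rule order_trans[OF ball_subset_cball r(2)])
  note sub = order_trans[OF sub3 sub2] sub2 sub3
  have N: "closedin X ?N" by (rule compactin_imp_closedin[OF Hausdorff compactin_par_cball[OF c sub(1)]])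
  note K0 = K_chart(1)[OF P c] and K1 = K_chart(2)[OF P c]
  have cont: "continuous_map X euclideanreal ?f"
    by (intro continuous_map_real_mult continuous_K[OF P])
  have off: "par c y \<in> topspace X - ?N" "y \<in> snd c ` (fst c - ?N)" if "y \<in> img c - cball x (2 * r)" for y
  proof -
    have "par c y \<notin> ?N"
    proof
      assume "par c y \<in> ?N"
      then obtain z where z: "z \<in> cball x (2 * r)" "par c y = par c z" by (elim imageE)
      then have "y = z"
        using arg_cong[OF z(2), of "snd c"] chart_par[OF c, of y] chart_par[OF c, of z] that sub(1) by auto
      then show False using z(1) that by blast
    qed
    moreover have "par c y \<in> fst c" using that par_in[OF c] by blast
    moreover have "snd c (par c y) = y" using that chart_par[OF c] by blast
    ultimately show "par c y \<in> topspace X - ?N" "y \<in> snd c ` (fst c - ?N)"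
      using cover c by (blast, intro image_eqI[of y "snd c" "par c y"]) auto
  qed
  have f0: "?f (par c y) = 0" if "y \<in> img c - cball x (2 * r)" for y
    using K_vanishes(1)[OF P N van off(1)[OF that]] by simp
  have flux0: "flux1 y = 0" "flux2 y = 0" if "y \<in> ?B - cball x (2 * r)" for y
  proof -
    have y: "y \<in> snd c ` (fst c - ?N)" using that off(2) sub(2) by blast
    note V = Psi_vanishes[OF N van c]
    show "flux1 y = 0" "flux2 y = 0"
      using variation_zero[OF V(1) y V(2)] V(2)[OF y] by (simp_all add: flux1_def flux2_def)
  qed
  \<comment> \<open>The measure contains the absolute value of \<open>w\<close>, the divergence
    \<open>w\<close> itself. The chart image may be disconnected and \<open>w\<close> may change
    sign between components; on the connected ball its sign is constant.\<close>
  obtain s :: real where s: "\<And>y. y \<in> ?B \<Longrightarrow> \<bar>?w y\<bar> = s * ?w y"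
  proof -
    have con: "connected (?w ` ?B)"
      by (intro connected_continuous_image continuous_on_subset[OF Ck_on_imp_continuous_on[OF Ck_w[of 0]] sub(2)]
          convex_connected convex_ball)
    have z: "0 \<notin> ?w ` ?B" using w_nz sub(2) by auto
    show thesis
    proof (cases "\<exists>y\<in>?B. ?w y < 0")
      case True
      then obtain y where y: "y \<in> ?B" "?w y < 0" by blast
      have "?w z < 0" if "z \<in> ?B" for z
        using connectedD_interval[OF con, of "?w y" "?w z" 0] y that z by fastforce
      then show ?thesis by (intro that[of "- 1"]) (simp add: abs_of_neg)
    next
      case False
      then show ?thesis by (intro that[of 1]) (auto simp: not_less)
    qed
  qed
  have eq: "indicator (img c) y * (\<bar>?w y\<bar> * ?f (par c y))
      = s * (indicator ?B y * pd 1 flux1 y + indicator ?B y * pd 2 flux2 y)" for y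
  proof (cases "y \<in> ?B")
    case True
    then have y: "y \<in> img c" using sub(2) by blast
    have "?f (par c y) = K_scal ?w (\<Gamma> c) y * K_of_curl_ric ?w (curl_ric_var1 (\<Gamma> c) (Psi P c)) y"
      using K0[OF par_in[OF c y]] K1[OF par_in[OF c y]] chart_par[OF c y] by simp
    then show ?thesis
      using True y s[OF True] divergence_flux[OF y] by (simp add: distrib_left[symmetric] mult.assoc)
  next
    case False
    then have "y \<notin> cball x (2 * r)" using sub(3) by blast
    then have "y \<in> img c \<Longrightarrow> ?f (par c y) = 0" by (intro f0) blast
    then show ?thesis using False by (simp add: indicator_def)
  qed
  have "(LINT p|vol. ?f p) = integral\<^sup>L lborel (\<lambda>y. indicator (img c) y * (\<bar>?w y\<bar> * ?f (par c y)))"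
  proof (rule integral_vol_chart[OF c borel_measurable_continuous_map[OF cont]])
    fix p assume p: "p \<in> topspace X - fst c"
    then have "p \<in> topspace X - ?N" using chart_image_par(2)[OF c sub(1)] by blast
    then show "?f p = 0" using K_vanishes(1)[OF P N van] by simp
  qed
  also have "\<dots> = s * (integral\<^sup>L lborel (\<lambda>y. indicator ?B y * pd 1 flux1 y) + integral\<^sup>L lborel (\<lambda>y. indicator ?B y * pd 2 flux2 y))"
    unfolding eq
    using integral_pd_compact_support(1)[OF open_ball Ck_on_subset[OF Ck_flux(1) sub(2)] compact_cball sub(3) flux0(1)]
      integral_pd_compact_support(1)[OF open_ball Ck_on_subset[OF Ck_flux(2) sub(2)] compact_cball sub(3) flux0(2)]
    by simp
  also have "\<dots> = 0"
    using integral_pd_compact_support(2)[OF open_ball Ck_on_subset[OF Ck_flux(1) sub(2)] compact_cball sub(3) flux0(1)]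
      integral_pd_compact_support(2)[OF open_ball Ck_on_subset[OF Ck_flux(2) sub(2)] compact_cball sub(3) flux0(2)]
    by simp
  finally show ?thesis .
qed

section \<open>Cutting variations into pieces supported in charts\<close>

lemma cubic_mult:
  assumes P: "cubic P" and f: "\<And>d. d \<in> A \<Longrightarrow> Ck_on 4 (img d) (\<lambda>y. f (par d y))"
  shows "cubic (\<lambda>d js y. f (par d y) * P d js y)"
proof -
  have tr: "f (par c x) * P c [i, j, k] x = (\<Sum>a\<in>UNIV. \<Sum>b\<in>UNIV. \<Sum>e\<in>UNIV. jac c d i a x * jac c d j b x * jac c d k e x *
      (f (par d (trans_map c d x)) * P d [a, b, e] (trans_map c d x)))"
    if c: "c \<in> A" and d: "d \<in> A" and x: "x \<in> overlap c d" for c d x i j k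
  proof -
    obtain p where p: "p \<in> fst c" "p \<in> fst d" "x = snd c p" using x by (auto simp: overlap_def)
    have e: "par d (trans_map c d x) = par c x"
      using p trans_map_eq[OF c p(1)] par_chart[OF c p(1)] par_chart[OF d p(2)] by simp
    have "P c [i, j, k] x = (\<Sum>a\<in>UNIV. \<Sum>b\<in>UNIV. \<Sum>e\<in>UNIV. jac c d i a x * jac c d j b x * jac c d k e x * P d [a, b, e] (trans_map c d x))"
      using P c d x unfolding cubic_def by blast
    then show ?thesis unfolding e by (simp add: sum_distrib_left mult_ac)
  qed
  have ck: "Ck_on 4 (img c) (\<lambda>y. f (par c y) * P c [i, j, k] y)" if c: "c \<in> A" for c i j k
    using P c unfolding cubic_def by (intro Ck_on_mult chart(2)[OF c] f[OF c]) blast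
  have sy: "P c [i, j, k] x = P c [j, i, k] x" "P c [i, j, k] x = P c [i, k, j] x" if "c \<in> A" "x \<in> img c" for c x i j k
    using P that unfolding cubic_def by blast+
  show ?thesis
    unfolding cubic_def
    by (intro conjI ballI allI; (rule ck | rule tr | rule arg_cong[OF sy(1)] | rule arg_cong[OF sy(2)]); assumption)
qed

text \<open>Extension by zero: any chart image is covered by the overlap with \<open>c\<close>,
  where the function is a cutoff after a transition map, and by the complement of the compact
  support, where it is 0. The latter is open because the surface is Hausdorff.\<close>

lemma Ck_lift:
  assumes c: "c \<in> A" and r: "cball x r \<subseteq> img c" and b: "\<And>S. open S \<Longrightarrow> Ck_on k S b" "\<And>y. y \<notin> cball x r \<Longrightarrow> b y = 0"
    and d: "d \<in> A"
  shows "Ck_on k (img d) (\<lambda>y. if par d y \<in> fst c then b (snd c (par d y)) else 0)"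
proof -
  let ?N = "par c ` cball x r" and ?\<theta> = "\<lambda>p. if p \<in> fst c then b (snd c p) else 0"
  have N: "closedin X ?N" by (rule compactin_imp_closedin[OF Hausdorff compactin_par_cball[OF c r]])
  have "openin X (fst d - ?N)" using chart(1)[OF d] N by (simp add: openin_diff)
  then have o: "open (snd d ` (fst d - ?N))" by (subst open_chart_image[OF d]) auto
  have 1: "Ck_on k (overlap d c) (\<lambda>y. ?\<theta> (par d y))"
  proof (rule Ck_on_cong[OF open_overlap[OF d c]])
    show "Ck_on k (overlap d c) (\<lambda>y. b (trans_map d c y))"
      by (rule Ck_on_compose[OF open_overlap[OF d c] open_UNIV _ Ck_trans_map[OF d c] b(1)]) auto
    fix y assume "y \<in> overlap d c"
    then obtain p where p: "p \<in> fst c" "p \<in> fst d" "y = snd d p" by (auto simp: overlap_def)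
    then show "b (trans_map d c y) = ?\<theta> (par d y)"
      using trans_map_eq[OF d p(2)] par_chart[OF d p(2)] by simp
  qed
  have 2: "Ck_on k (snd d ` (fst d - ?N)) (\<lambda>y. ?\<theta> (par d y))"
  proof (rule Ck_on_cong[OF o _ Ck_on_const[of _ _ 0]])
    fix y assume "y \<in> snd d ` (fst d - ?N)"
    then obtain p where p: "p \<in> fst d" "p \<notin> ?N" "y = snd d p" by blast
    have "b (snd c p) = 0" if pc: "p \<in> fst c"
    proof (rule b(2), rule notI)
      assume "snd c p \<in> cball x r"
      then have "par c (snd c p) \<in> ?N" by (rule imageI)
      then show False using p(2) par_chart[OF c pc] by simp
    qed
    then show "0 = ?\<theta> (par d y)" using par_chart[OF d p(1)] p(3) by simp
  qed
  have "img d = overlap d c \<union> snd d ` (fst d - ?N)"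
  proof -
    have "fst d = (fst d \<inter> fst c) \<union> (fst d - ?N)" using chart_image_par(2)[OF c r] by blast
    then have "img d = snd d ` ((fst d \<inter> fst c) \<union> (fst d - ?N))" by (rule arg_cong)
    then show ?thesis by (simp only: image_Un overlap_def)
  qed
  then show ?thesis using Ck_on_Un[OF open_overlap[OF d c] o 1 2] by simp
qed

text \<open>Induction on the number of coordinate balls covering the support, in place of a
  partition of unity: a cutoff splits off a part living in one chart, and the rest vanishes on that
  chart's ball.\<close>

lemma first_variation_zero_covered:
  assumes "finite F" "\<And>c x r. (c, x, r) \<in> F \<Longrightarrow> c \<in> A \<and> r > 0 \<and> cball x (3 * r) \<subseteq> img c"
    "cubic P" "compactin X C" "vanishes_off C P" "C \<subseteq> (\<Union>(c, x, r)\<in>F. par c ` ball x r)"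
  shows "(LINT p|vol. K0 p * K1 P p) = 0"
  using assms
proof (induction F arbitrary: P C rule: finite_induct)
  case empty
  then have "vanishes_off {} P" by simp
  then have "K1 P p = 0" if "p \<in> topspace X" for p
    using K_vanishes(1)[OF empty(2) closedin_empty] that by simp
  then have "(LINT p|vol. K0 p * K1 P p) = (LINT p|vol. 0)"
    by (intro Bochner_Integration.integral_cong) (simp_all add: space_vol)
  then show ?case by simp
next
  case (insert t F)
  obtain c x r where t: "t = (c, x, r)" by (cases t)
  have c: "c \<in> A" "r > 0" "cball x (3 * r) \<subseteq> img c" using insert.prems(1)[of c x r] t by auto
  have "cball x (2 * r) \<subseteq> cball x (3 * r)" "ball x r \<subseteq> cball x (3 * r)"
    using c(2) by (auto simp: subset_iff)
  then have sub: "cball x (2 * r) \<subseteq> img c" "ball x r \<subseteq> img c" using c(3) by blast+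
  note P = insert.prems(2) and C = insert.prems(3)
  obtain b where b: "\<And>S. open S \<Longrightarrow> Ck_on 4 S b" "\<And>y. y \<in> ball x r \<Longrightarrow> b y = 1" "\<And>y. y \<notin> cball x (2 * r) \<Longrightarrow> b y = 0"
    by (rule cutoff_exists[OF c(2), of 4 x]) blast
  define \<theta> where "\<theta> p = (if p \<in> fst c then b (snd c p) else 0)" for p
  define Q where "Q = (\<lambda>d js y. \<theta> (par d y) * P d js y)"
  define R where "R = (\<lambda>d js y. (1 - \<theta> (par d y)) * P d js y)"
  have \<theta>: "Ck_on 4 (img d) (\<lambda>y. \<theta> (par d y))" if "d \<in> A" for d
    unfolding \<theta>_def by (rule Ck_lift[OF c(1) sub(1) b(1,3) that])
  have Q: "cubic Q" unfolding Q_def by (rule cubic_mult[OF P \<theta>])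
  have R: "cubic R" unfolding R_def
    by (rule cubic_mult[OF P]) (intro Ck_on_diff Ck_on_const \<theta> chart(2))
  let ?N = "par c ` cball x (2 * r)"
  \<comment> \<open>The support left for \<open>R\<close>, where the cutoff need not be 1: closed in
    the compact \<open>C\<close>, and covered by the remaining balls.\<close>
  let ?C = "C \<inter> (topspace X - par c ` ball x r)"
  have vQ: "vanishes_off ?N Q"
  proof -
    have "\<theta> p = 0" if p: "p \<notin> ?N" for p
    proof (cases "p \<in> fst c")
      case True
      have "snd c p \<notin> cball x (2 * r)"
      proof
        assume "snd c p \<in> cball x (2 * r)"
        then have "par c (snd c p) \<in> ?N" by (rule imageI)
        then show False using p par_chart[OF c(1) True] by simp
      qed
      then show ?thesis using True b(3) by (simp add: \<theta>_def)
    qed (simp add: \<theta>_def)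
    then show ?thesis using par_chart unfolding vanishes_off_def Q_def by simp
  qed
  have vR: "vanishes_off ?C R"
  proof -
    have "R d [i, j, k] (snd d p) = 0" if dp: "d \<in> A" "p \<in> fst d" "p \<notin> ?C" for d p i j k
    proof (cases "p \<in> C")
      case True
      have "p \<in> topspace X" using dp cover by blast
      then obtain y where y: "y \<in> ball x r" "p = par c y" using True dp by blast
      then have "y \<in> img c" using sub(2) by blast
      then have "\<theta> p = 1"
        using b(2)[OF y(1)] chart_par[OF c(1)] par_in[OF c(1)] y(2) by (simp add: \<theta>_def)
      then show ?thesis using par_chart[OF dp(1,2)] by (simp add: R_def)
    next
      case False
      then show ?thesis using insert.prems(4) dp unfolding vanishes_off_def R_def by auto
    qed
    then show ?thesis unfolding vanishes_off_def by blast
  qed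
  have cC: "compactin X ?C"
    by (rule compact_Int_closedin[OF C]) (intro closedin_diff closedin_topspace openin_par_ball[OF c(1) sub(2)])
  have zQ: "(LINT p|vol. K0 p * K1 Q p) = 0"
    by (rule integral_chart_zero[OF Q c vQ])
  have zR: "(LINT p|vol. K0 p * K1 R p) = 0"
  proof (rule insert.IH[OF _ R cC vR])
    show "c \<in> A \<and> r > 0 \<and> cball x (3 * r) \<subseteq> img c" if "(c, x, r) \<in> F" for c x r
      using insert.prems(1) that by blast
    show "?C \<subseteq> (\<Union>(c, x, r)\<in>F. par c ` ball x r)"
      using insert.prems(5) t by auto
  qed
  have i: "integrable vol (\<lambda>p. K0 p * K1 T p)" if "cubic T" "compactin X D" "vanishes_off D T" for T D
    by (rule integrable_compact_support[OF continuous_map_real_mult[OF continuous_K(1,2)[OF that(1)]] that(2)])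
      (simp add: K_vanishes(1)[OF that(1) compactin_imp_closedin[OF Hausdorff that(2)] that(3)])
  have "(LINT p|vol. K0 p * K1 P p) = (LINT p|vol. K0 p * K1 Q p + K0 p * K1 R p)"
  proof (rule Bochner_Integration.integral_cong[OF refl])
    fix p assume "p \<in> space vol"
    then have "p \<in> topspace X" by (simp add: space_vol)
    then have "K1 P p = K1 Q p + K1 R p"
      by (intro K1_add[OF P Q R]) (simp_all add: Q_def R_def algebra_simps)
    then show "K0 p * K1 P p = K0 p * K1 Q p + K0 p * K1 R p" by (simp add: algebra_simps)
  qed
  also have "\<dots> = (LINT p|vol. K0 p * K1 Q p) + (LINT p|vol. K0 p * K1 R p)"
    by (intro Bochner_Integration.integral_add i[OF Q compactin_par_cball[OF c(1) sub(1)] vQ] i[OF R cC vR])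
  finally show ?case using zQ zR by simp
qed

lemma first_variation_zero:
  assumes P: "cubic P" and C: "compactin X C" "vanishes_off C P"
  shows "(LINT p|vol. K0 p * K1 P p) = 0"
proof -
  let ?G = "{(c, x, r). c \<in> A \<and> r > 0 \<and> cball x (3 * r) \<subseteq> img c}"
  let ?b = "\<lambda>(c, x, r). par c ` ball x r"
  have "\<exists>\<F>. finite \<F> \<and> \<F> \<subseteq> ?b ` ?G \<and> C \<subseteq> \<Union>\<F>"
  proof (rule compactinD[OF C(1)])
    show "openin X U" if UG: "U \<in> ?b ` ?G" for U
    proof -
      obtain c x r where U: "c \<in> A" "r > 0" "cball x (3 * r) \<subseteq> img c" "U = par c ` ball x r"
        using UG by auto
      have "ball x r \<subseteq> cball x (3 * r)" using U(2) by (auto simp: subset_iff)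
      then have "ball x r \<subseteq> img c" using U(3) by (rule order_trans)
      then show ?thesis using openin_par_ball[OF U(1)] U(4) by simp
    qed
    show "C \<subseteq> \<Union>(?b ` ?G)"
    proof
      fix p assume "p \<in> C"
      then have "p \<in> topspace X" using compactin_subset_topspace[OF C(1)] by blast
      then obtain c x r where c: "c \<in> A" "r > 0" "cball x (3 * r) \<subseteq> img c" "p \<in> par c ` ball x r"
        by (rule coordinate_ball)
      then show "p \<in> \<Union>(?b ` ?G)" by (intro UnionI[of "?b (c, x, r)"] imageI) auto
    qed
  qed
  then obtain \<F> where F: "finite \<F>" "\<F> \<subseteq> ?b ` ?G" "C \<subseteq> \<Union>\<F>" by blast
  obtain G where G: "G \<subseteq> ?G" "finite G" "\<F> = ?b ` G"
    using finite_subset_image[OF F(1,2)] by blast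
  show ?thesis
    by (rule first_variation_zero_covered[OF G(2) _ P C]) (use G F in auto)
qed

lemma critical: "critical X A \<omega> \<Gamma>"
  unfolding critical_def
proof (intro allI impI)
  fix P assume "sym_cubic A P \<and> compactly_supported X A 3 P"
  then have P: "cubic P" and "compactly_supported X A 3 P" by (auto intro: sym_cubic_imp_cubic)
  then obtain C where C: "compactin X C" "\<forall>c\<in>A. \<forall>p\<in>fst c - C. \<forall>js. length js = 3 \<longrightarrow> P c js (snd c p) = 0"
    unfolding compactly_supported_def by blast
  then have van: "vanishes_off C P" by (simp add: vanishes_off_def)
  note cont = continuous_K[OF P] and zero = K_vanishes[OF P compactin_imp_closedin[OF Hausdorff C(1)] van]
  \<comment> \<open>\<open>g n\<close> is the coefficient of \<open>t ^ Suc n\<close> in the square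
    of the cubic polynomial minus its value at 0. Each summand has a factor among
    \<open>K1 P\<close>, \<open>K2 P\<close>, \<open>K3 P\<close>, hence compact support.\<close>
  define g :: "nat \<Rightarrow> 'a \<Rightarrow> real" where "g n p = [2 * (K0 p * K1 P p), K1 P p * K1 P p + 2 * (K0 p * K2 P p),
      2 * (K0 p * K3 P p) + 2 * (K1 P p * K2 P p), K2 P p * K2 P p + 2 * (K1 P p * K3 P p),
      2 * (K2 P p * K3 P p), K3 P p * K3 P p] ! n" for n p
  have g: "integrable vol (g n)" if n: "n < 6" for n
  proof (rule integrable_compact_support[OF _ C(1)])
    have n6: "n = 0 \<or> n = 1 \<or> n = 2 \<or> n = 3 \<or> n = 4 \<or> n = 5" using n by linarith
    then show "continuous_map X euclideanreal (g n)"
      unfolding g_def[abs_def]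
      by (elim disjE; simp; intro continuous_map_real_mult continuous_map_add continuous_map_real_mult_left cont)
    show "g n p = 0" if "p \<in> topspace X - C" for p
      using n6 zero[OF that] by (auto simp: g_def)
  qed
  have diff: "(K_fun A \<omega> (vary \<omega> \<Gamma> t P) p)\<^sup>2 - (K0 p)\<^sup>2 = (\<Sum>n<6. t ^ Suc n * g n p)" if "p \<in> topspace X" for t p
    unfolding K_fun_vary[OF P that] g_def
    by (simp add: eval_nat_numeral lessThan_Suc algebra_simps)
  define I where "I t = (LINT p|vol. (K_fun A \<omega> (vary \<omega> \<Gamma> t P) p)\<^sup>2 - (K0 p)\<^sup>2)" for t
  have I: "I t = (\<Sum>n<6. t ^ Suc n * (LINT p|vol. g n p))" for t
  proof -
    have "I t = (LINT p|vol. (\<Sum>n<6. t ^ Suc n * g n p))"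
      unfolding I_def by (rule Bochner_Integration.integral_cong) (simp_all add: space_vol diff)
    also have "\<dots> = (\<Sum>n<6. LINT p|vol. t ^ Suc n * g n p)"
      by (rule Bochner_Integration.integral_sum) (use g in auto)
    finally show ?thesis by simp
  qed
  have "(LINT p|vol. g 0 p) = 0"
    using first_variation_zero[OF P C(1) van] by (simp add: g_def)
  \<comment> \<open>\<open>I\<close> is a polynomial in t without constant term, so its derivative
    at 0 is its linear coefficient, the integral just shown to vanish.\<close>
  then have D: "(I has_real_derivative 0) (at 0)"
    unfolding I[abs_def] by (auto intro!: derivative_eq_intros simp: eval_nat_numeral lessThan_Suc)
  show "if compact_space X
         then ((\<lambda>t. energy X A \<omega> (vary \<omega> \<Gamma> t P)) has_real_derivative 0) (at 0)
         else ((\<lambda>t. LINT p|vol. (K_fun A \<omega> (vary \<omega> \<Gamma> t P) p)\<^sup>2 - (K0 p)\<^sup>2) has_real_derivative 0) (at 0)"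
  proof (cases "compact_space X")
    case True
    then have X: "compactin X (topspace X)" by (simp add: compact_space_def)
    \<comment> \<open>On a compact surface the unvaried energy is finite, so the energy differs from
      \<open>I\<close> by a constant.\<close>
    have K0: "integrable vol (\<lambda>p. (K0 p)\<^sup>2)"
      unfolding power2_eq_square
      by (rule integrable_compact_support[OF continuous_map_real_mult[OF cont(1) cont(1)] X]) simp
    have "energy X A \<omega> (vary \<omega> \<Gamma> t P) = I t + (LINT p|vol. (K0 p)\<^sup>2)" for t
    proof -
      have "integrable vol (\<lambda>p. (\<Sum>n<6. t ^ Suc n * g n p))" using g by auto
      then have "integrable vol (\<lambda>p. (K_fun A \<omega> (vary \<omega> \<Gamma> t P) p)\<^sup>2 - (K0 p)\<^sup>2)"
        by (rule Bochner_Integration.integrable_cong[OF refl, THEN iffD1, rotated]) (simp add: space_vol diff)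
      from Bochner_Integration.integral_add[OF this K0] show ?thesis
        by (simp add: energy_def I_def)
    qed
    then show ?thesis using True DERIV_add[OF D DERIV_const[of "LINT p|vol. (K0 p)\<^sup>2"]] by simp
  next
    case False
    then show ?thesis using D by (simp add: I_def[abs_def])
  qed
qed

end

theorem theorem1p6:
  fixes X :: "'a topology" and A :: "('a, 2) chart set"
    and \<omega> :: "('a, 2) tensor" and \<Gamma> :: "('a, 2) conn"
  assumes "symplectic_manifold X A \<omega>"
    and "symplectic_connection A \<omega> \<Gamma>"
    and "preferred A \<Gamma>"
  shows "critical X A \<omega> \<Gamma>"
proof -
  interpret preferred_surface X A \<omega> \<Gamma>
    using assms by unfold_locales
  show ?thesis by (rule critical)
qed

end
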